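(* Let $n\ge1$, let $\mathfrak p_0\in A=\mathbb F_q[T]$ be monic irreducible of degree $r$ with $\gcd(n,r)=1$, let $t\in\mathbb F_{q^r}$ be a root of $\mathfrak p_0$, let $\phi$ be the Drinfeld module with $\phi_T=t+\tau^n$, and let $\mathfrak p\neq\mathfrak p_0$ be a monic irreducible element of $A$. Put $\kappa=A/\mathfrak p$, $M=\phi[\mathfrak p]$, $\pi=\tau^r$, $c=\mathfrak p_0\bmod\mathfrak p\in\kappa^\times$. Let $m\mid n$, $s=n/m$, $S=\kappa[\pi|_M]$ and $R_0=\kappa[\pi^m|_M]$ (subrings of $\operatorname{End}_\kappa(M)$). Then $M$ is free of rank $m$ over $R_0$. More precisely: (1) $S\cong\kappa[x]/(x^n-c)$, and $M$ is free of rank one over $S$. (2) $S=\bigoplus_{i=0}^{m-1}\pi^iR_0$ is free of rank $m$ over $R_0$, and $R_0\cong\kappa[u]/(u^s-c)$ with $u=\pi^m|_M$. Hence $M\cong S\cong R_0^{\oplus m}$ as $R_0$-modules.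
   Context: $q$ is a prime power, $A=\mathbb F_q[T]$, and $\overline{\mathbb F}_q$ is a fixed algebraic closure. For $i\ge0$ write $[i]=q^i$, so $\beta^{[i]}=\beta^{q^i}$. $\mathbb F_{q^r}\{\tau\}$ is the twisted polynomial ring with $\tau a=a^q\tau$; it acts on $\overline{\mathbb F}_q$ with $\tau$ acting as $x\mapsto x^q$ and constants by multiplication. The Drinfeld module $\phi$ is the $\mathbb F_q$-algebra homomorphism $A\to\mathbb F_{q^r}\{\tau\}$, $a\mapsto\phi_a$, determined by $\phi_T=t+\tau^n$. Its $\mathfrak p$-torsion is $M=\phi[\mathfrak p]=\{v\in\overline{\mathbb F}_q:\phi_{\mathfrak p}(v)=0\}$, on which $a\in A$ acts by $v\mapsto\phi_a(v)$; this makes $M$ a $\kappa$-vector space of dimension $n$. The element $\pi=\tau^r$ commutes with all $\phi_a$, hence acts $\kappa$-linearly on $M$ by $v\mapsto v^{[r]}$. *)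

theory Defs
  imports "HOL-Algebra.Algebra" "HOL-Algebra.Algebraic_Closure_Type"
    "HOL-Library.Cardinality"
begin

text \<open>
  The field with \<open>q\<close> elements is a finite field type \<open>'f\<close>, so that \<open>q = CARD('f)\<close>; its algebraic
  closure is \<open>'f alg_closure\<close>, and \<open>A\<close> is \<open>ring_of_type_algebra :: 'f poly ring\<close>.
\<close>

section \<open>Twisted polynomials and Drinfeld modules\<close>

definition frob_fixed :: "nat \<Rightarrow> 'f::{field,finite} alg_closure set" where
  "frob_fixed r = {x. x ^ (CARD('f) ^ r) = x}"

text \<open>
  The twisted polynomial \<open>\<Sum>i. a\<^sub>i \<tau>\<^sup>i\<close> is represented by the ordinary polynomial with coefficients
  \<open>a\<^sub>i\<close>; only the product, determined by \<open>(a \<tau>\<^sup>i) (b \<tau>\<^sup>j) = a b\<^bsup>q^i\<^esup> \<tau>\<^bsup>i+j\<^esup>\<close>, differs from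
  that of ordinary polynomials.
\<close>

definition twisted_mult ::
  "'f::{field,finite} alg_closure poly \<Rightarrow> 'f alg_closure poly \<Rightarrow> 'f alg_closure poly" where
  "twisted_mult f g =
    (\<Sum>i\<le>Polynomial.degree f. \<Sum>j\<le>Polynomial.degree g. Polynomial.monom (Polynomial.coeff f i * Polynomial.coeff g j ^ (CARD('f) ^ i)) (i + j))"

definition twisted_poly_ring :: "nat \<Rightarrow> 'f::{field,finite} alg_closure poly ring" where
  "twisted_poly_ring r =
    \<lparr>carrier = {f. \<forall>i. Polynomial.coeff f i \<in> frob_fixed r}, monoid.mult = twisted_mult, one = 1,
     ring.zero = 0, add = (+)\<rparr>"

definition twisted_act ::
  "'f::{field,finite} alg_closure poly \<Rightarrow> 'f alg_closure \<Rightarrow> 'f alg_closure" where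
  "twisted_act f v = (\<Sum>i\<le>Polynomial.degree f. Polynomial.coeff f i * v ^ (CARD('f) ^ i))"

text \<open>
  \<open>\<phi>\<close> is the algebra homomorphism over the finite field \<open>'f\<close> with \<open>\<phi>\<^sub>T = t + \<tau>\<^sup>n\<close>;
  the variable \<open>T\<close> is \<open>[:0, 1:]\<close>.
\<close>

definition is_drinfeld_module ::
  "nat \<Rightarrow> nat \<Rightarrow> 'f::{field,finite} alg_closure \<Rightarrow>
    ('f poly \<Rightarrow> 'f alg_closure poly) \<Rightarrow> bool" where
  "is_drinfeld_module r n t \<phi> \<longleftrightarrow>
    \<phi> \<in> ring_hom ring_of_type_algebra (twisted_poly_ring r) \<and>
    (\<forall>a. \<phi> [:a:] = [:to_ac a:]) \<and>
    \<phi> [:0, 1:] = [:t:] + Polynomial.monom 1 n"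

definition residue_ring_at :: "'f::field poly \<Rightarrow> 'f poly set ring" where
  "residue_ring_at p = ring_of_type_algebra Quot (PIdl\<^bsub>ring_of_type_algebra\<^esub> p)"

definition residue_class_at :: "'f::field poly \<Rightarrow> 'f poly \<Rightarrow> 'f poly set" where
  "residue_class_at p a = PIdl\<^bsub>ring_of_type_algebra\<^esub> p +>\<^bsub>ring_of_type_algebra\<^esub> a"

text \<open>
  The torsion module. A residue class acts through any of its representatives. The multiplicative
  fields of the record play no role in a module.
\<close>

definition torsion_module ::
  "('f::{field,finite} poly \<Rightarrow> 'f alg_closure poly) \<Rightarrow> 'f poly \<Rightarrow>
    ('f poly set, 'f alg_closure) module" where
  "torsion_module \<phi> p =
    \<lparr>carrier = {v. twisted_act (\<phi> p) v = 0}, monoid.mult = undefined, one = undefined,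
     ring.zero = 0, add = (+), module.smult = (\<lambda>k v. twisted_act (\<phi> (SOME a. a \<in> k)) v)\<rparr>"

section \<open>Linear algebra over commutative rings\<close>

text \<open>
  Endomorphisms are extensional functions, i.e. \<open>undefined\<close> outside the carrier, so that
  equality of functions is equality of endomorphisms.
\<close>

definition module_End :: "('r, 'x) ring_scheme \<Rightarrow> ('r, 'a, 'y) module_scheme \<Rightarrow> ('a \<Rightarrow> 'a) ring" where
  "module_End R M =
    \<lparr>carrier = {f \<in> carrier M \<rightarrow>\<^sub>E carrier M.
        (\<forall>v\<in>carrier M. \<forall>w\<in>carrier M. f (v \<oplus>\<^bsub>M\<^esub> w) = f v \<oplus>\<^bsub>M\<^esub> f w) \<and>
        (\<forall>a\<in>carrier R. \<forall>v\<in>carrier M. f (a \<odot>\<^bsub>M\<^esub> v) = a \<odot>\<^bsub>M\<^esub> f v)},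
     monoid.mult = (\<lambda>f g. compose (carrier M) f g),
     one = (\<lambda>v\<in>carrier M. v),
     ring.zero = (\<lambda>v\<in>carrier M. \<zero>\<^bsub>M\<^esub>),
     add = (\<lambda>f g. \<lambda>v\<in>carrier M. f v \<oplus>\<^bsub>M\<^esub> g v)\<rparr>"

definition scalar_End :: "('r, 'a, 'y) module_scheme \<Rightarrow> 'r \<Rightarrow> 'a \<Rightarrow> 'a" where
  "scalar_End M a = (\<lambda>v\<in>carrier M. a \<odot>\<^bsub>M\<^esub> v)"

text \<open>\<open>R[f]\<close>, the subring of \<open>module_End R M\<close> generated by the scalars and \<open>f\<close>.\<close>

definition adjoin_End ::
  "('r, 'x) ring_scheme \<Rightarrow> ('r, 'a, 'y) module_scheme \<Rightarrow> ('a \<Rightarrow> 'a) \<Rightarrow> ('a \<Rightarrow> 'a) set" where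
  "adjoin_End R M f = generate_ring (module_End R M) (insert f (scalar_End M ` carrier R))"

text \<open>The underlying group of \<open>M\<close> as a module over a ring of endomorphisms of \<open>M\<close>.\<close>

definition evaluation_module :: "('r, 'a, 'y) module_scheme \<Rightarrow> ('a \<Rightarrow> 'a, 'a) module" where
  "evaluation_module M =
    \<lparr>carrier = carrier M, monoid.mult = undefined, one = undefined,
     ring.zero = \<zero>\<^bsub>M\<^esub>, add = add M, module.smult = (\<lambda>f v. f v)\<rparr>"

text \<open>A ring as a module over any of its subrings.\<close>

definition regular_module :: "('r, 'x) ring_scheme \<Rightarrow> ('r, 'r) module" where
  "regular_module R =
    \<lparr>carrier = carrier R, monoid.mult = monoid.mult R, one = \<one>\<^bsub>R\<^esub>,
     ring.zero = \<zero>\<^bsub>R\<^esub>, add = add R, module.smult = monoid.mult R\<rparr>"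

definition power_module :: "('r, 'x) ring_scheme \<Rightarrow> nat \<Rightarrow> ('r, nat \<Rightarrow> 'r) module" where
  "power_module R k =
    \<lparr>carrier = {..<k} \<rightarrow>\<^sub>E carrier R, monoid.mult = undefined, one = undefined,
     ring.zero = (\<lambda>i\<in>{..<k}. \<zero>\<^bsub>R\<^esub>),
     add = (\<lambda>x y. \<lambda>i\<in>{..<k}. x i \<oplus>\<^bsub>R\<^esub> y i),
     module.smult = (\<lambda>a x. \<lambda>i\<in>{..<k}. a \<otimes>\<^bsub>R\<^esub> x i)\<rparr>"

definition is_free_module ::
  "('r, 'x) ring_scheme \<Rightarrow> ('r, 'a, 'y) module_scheme \<Rightarrow> nat \<Rightarrow> bool" where
  "is_free_module R M k \<longleftrightarrow>
    module R M \<and>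
    (\<exists>b \<in> {..<k} \<rightarrow> carrier M. \<forall>v\<in>carrier M.
      \<exists>!a. a \<in> {..<k} \<rightarrow>\<^sub>E carrier R \<and> v = (\<Oplus>\<^bsub>M\<^esub>i\<in>{..<k}. a i \<odot>\<^bsub>M\<^esub> b i))"

definition is_module_iso ::
  "('r, 'x) ring_scheme \<Rightarrow> ('r, 'a, 'y) module_scheme \<Rightarrow> ('r, 'b, 'z) module_scheme \<Rightarrow>
    ('a \<Rightarrow> 'b) \<Rightarrow> bool" where
  "is_module_iso R M N f \<longleftrightarrow>
    module R M \<and> module R N \<and> bij_betw f (carrier M) (carrier N) \<and>
    (\<forall>v\<in>carrier M. \<forall>w\<in>carrier M. f (v \<oplus>\<^bsub>M\<^esub> w) = f v \<oplus>\<^bsub>N\<^esub> f w) \<and>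
    (\<forall>a\<in>carrier R. \<forall>v\<in>carrier M. f (a \<odot>\<^bsub>M\<^esub> v) = a \<odot>\<^bsub>N\<^esub> f v)"

definition is_internal_direct_sum ::
  "('r, 'x) ring_scheme \<Rightarrow> ('r, 'a, 'y) module_scheme \<Rightarrow> 'i set \<Rightarrow> ('i \<Rightarrow> 'a set) \<Rightarrow> bool" where
  "is_internal_direct_sum R M I H \<longleftrightarrow>
    module R M \<and> (\<forall>i\<in>I. submodule (H i) R M) \<and>
    (\<forall>v\<in>carrier M. \<exists>!h. h \<in> Pi\<^sub>E I H \<and> v = (\<Oplus>\<^bsub>M\<^esub>i\<in>I. h i))"

section \<open>The algebras \<open>K[x]/(x\<^sup>k - c)\<close>\<close>

definition binomial_ideal :: "('k, 'x) ring_scheme \<Rightarrow> nat \<Rightarrow> 'k \<Rightarrow> (nat \<Rightarrow> 'k) set" where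
  "binomial_ideal K k c =
    PIdl\<^bsub>UP K\<^esub> (UnivPoly.monom (UP K) \<one>\<^bsub>K\<^esub> k \<ominus>\<^bsub>UP K\<^esub> UnivPoly.monom (UP K) c 0)"

text \<open>
  \<open>\<psi>\<close> is an isomorphism \<open>K[x]/(x\<^sup>k - c) \<cong> B\<close> of \<open>K\<close>-algebras, where \<open>h\<close> is the structure
  map of \<open>B\<close>, and \<open>\<psi>\<close> sends the class of \<open>x\<close> to \<open>z\<close>.
\<close>

definition is_binomial_algebra_iso ::
  "('k, 'x) ring_scheme \<Rightarrow> nat \<Rightarrow> 'k \<Rightarrow> ('b, 'y) ring_scheme \<Rightarrow> ('k \<Rightarrow> 'b) \<Rightarrow> 'b \<Rightarrow>
    ((nat \<Rightarrow> 'k) set \<Rightarrow> 'b) \<Rightarrow> bool" where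
  "is_binomial_algebra_iso K k c B h z \<psi> \<longleftrightarrow>
    \<psi> \<in> ring_iso (UP K Quot binomial_ideal K k c) B \<and>
    (\<forall>a\<in>carrier K. \<psi> (binomial_ideal K k c +>\<^bsub>UP K\<^esub> UnivPoly.monom (UP K) a 0) = h a) \<and>
    \<psi> (binomial_ideal K k c +>\<^bsub>UP K\<^esub> UnivPoly.monom (UP K) \<one>\<^bsub>K\<^esub> 1) = z"

end

theory Submission
  imports Defs
begin

text \<open>
  Write \<open>q\<close> for the order of the base field and \<open>D\<close> for the ring of twisted polynomials over its
  algebraic closure. As \<open>D\<close> acts faithfully on the algebraic closure, it is treated as a ring of
  additive operators, in which associativity of the product is associativity of composition.
  The theorem rests on three facts.

  \<^item> \<open>\<pi>\<^sup>n = \<phi>(p\<^sub>0)\<close> (\<open>act_phi_p0\<close>). With \<open>\<sigma> = \<tau>\<^sup>n\<close> and \<open>L = \<phi>(T) = t + \<sigma>\<close>, induction gives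
    \<open>\<sigma>\<^sup>k = \<Prod>\<^sub>i\<^sub><\<^sub>k (X - \<sigma>\<^sup>i(t))\<close> evaluated at \<open>L\<close> with coefficients on the left. As \<open>n\<close> is prime to
    \<open>r\<close>, the \<open>r\<close> conjugates \<open>\<sigma>\<^sup>i(t)\<close> are distinct, so for \<open>k = r\<close> the product is \<open>p\<^sub>0\<close>.

  \<^item> \<open>1, \<pi>, \<dots>, \<pi>\<^sup>n\<^sup>-\<^sup>1\<close> are linearly independent over \<open>\<kappa>\<close> on \<open>M\<close> (\<open>endo_kills_torsion_imp_dvd\<close>).
    If \<open>F = \<Sum>\<^sub>i \<phi>(a\<^sub>i) \<tau>\<^sup>r\<^sup>i\<close> kills \<open>M = ker \<phi>(p)\<close>, then \<open>F = G \<phi>(p)\<close>, because \<open>\<phi>(p)\<close> is separable, and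
    \<open>G\<close> commutes with \<open>\<phi>(T)\<close> and \<open>\<tau>\<^sup>r\<close>. The elements of \<open>D\<close> that do so are themselves of the form
    \<open>\<Sum>\<^sub>i \<phi>(b\<^sub>i) \<tau>\<^sup>r\<^sup>i\<close> (\<open>commutant\<close>), and such a representation is unique since the degrees
    \<open>n deg b + r i\<close> of its terms are distinct. Hence \<open>a\<^sub>i = b\<^sub>i p\<close>, which is zero in \<open>\<kappa>\<close>.

  \<^item> A faithful module over a finite commutative ring with only principal ideals contains a vector
    with zero annihilator (\<open>faithful_imp_cyclic_vector\<close>).

  By the first two facts \<open>S\<close> is \<open>\<kappa>[x]/(x\<^sup>n - c)\<close>. Its ideals are principal and it acts faithfully on
  \<open>M\<close>, so the third fact provides a \<open>v\<close> for which \<open>x \<mapsto> x v\<close> is an injection \<open>S \<rightarrow> M\<close>. Separability of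
  \<open>\<phi>(p)\<close> gives \<open>|M| = |\<kappa>|\<^sup>n = |S|\<close>, so it is an isomorphism of \<open>S\<close>-modules. The statements on
  \<open>R\<^sub>0\<close> follow by sorting the exponents of \<open>\<pi>\<close> by their residues modulo \<open>m\<close>
  (\<open>combination_tower\<close>).
\<close>

(* leaves the unqualified names to the polynomials of type 'a poly *)
hide_const (open) Polynomials.degree Polynomials.lead_coeff up_ring.coeff up_ring.monom

section \<open>The Frobenius endomorphism\<close>

text \<open>Translation by \<open>1\<close> permutes the field, so it leaves the sum of all elements unchanged.\<close>

lemma of_nat_card_eq_0: "of_nat CARD('f::{field,finite}) = (0::'f)"
proof -
  have "(\<Sum>x\<in>(UNIV::'f set). x) = (\<Sum>x\<in>UNIV. x + 1)"
    by (rule sum.reindex_bij_witness[of _ "\<lambda>x. x + 1" "\<lambda>x. x - 1"]) auto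
  then show ?thesis by (simp add: sum.distrib)
qed

text \<open>Multiplication by a nonzero \<open>x\<close> permutes the nonzero elements, so it leaves their product unchanged.\<close>

lemma power_card_eq_self: "x ^ CARD('f) = (x::'f::{field,finite})"
proof (cases "x = 0")
  case False
  have "(\<Prod>y\<in>UNIV-{0}. y) = (\<Prod>y\<in>UNIV-{0}. x * y)"
    by (rule prod.reindex_bij_witness[of _ "\<lambda>y. x * y" "\<lambda>y. y / x"]) (use False in auto)
  also have "\<dots> = x ^ (CARD('f) - 1) * (\<Prod>y\<in>UNIV-{0}. y)"
    by (simp add: prod.distrib card_Diff_singleton)
  finally have "x ^ (CARD('f) - 1) = 1" by simp
  moreover have "CARD('f) = Suc (CARD('f) - 1)"
    using finite_UNIV_card_ge_0[where 'a='f] by simp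
  ultimately show ?thesis by (metis power_Suc mult.right_neutral)
qed (simp add: zero_power)

lemma card_field_gt_1: "CARD('f::{field,finite}) > 1"
proof -
  have "card {0, 1::'f} \<le> CARD('f)" by (rule card_mono) auto
  then show ?thesis by simp
qed

text \<open>
  The polynomial \<open>(X + 1)\<^sup>q - X\<^sup>q - 1\<close> has degree below \<open>q\<close> and vanishes at the \<open>q\<close> elements of the
  base field, so it is zero; homogeneity then gives the case of general \<open>x\<close> and \<open>y\<close>.
\<close>

lemma frob_add:
  fixes x y :: "'f::{field,finite} alg_closure"
  shows "(x + y) ^ (CARD('f) ^ i) = x ^ (CARD('f) ^ i) + y ^ (CARD('f) ^ i)"
proof -
  let ?q = "CARD('f)"
  have q: "?q > 1" by (rule card_field_gt_1)
  define g :: "'f alg_closure poly" where "g = [:1, 1:] ^ ?q - monom 1 ?q - 1"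
  have deg1: "degree ([:1, 1::'f alg_closure:] ^ ?q - monom 1 ?q) < ?q"
  proof (rule degree_lessI)
    show "[:1, 1::'f alg_closure:] ^ ?q - monom 1 ?q \<noteq> 0 \<or> 0 < ?q" using q by simp
    show "\<forall>k\<ge>?q. coeff ([:1, 1::'f alg_closure:] ^ ?q - monom 1 ?q) k = 0"
    proof (intro allI impI)
      fix k assume k: "k \<ge> ?q"
      have d: "degree ([:1, 1::'f alg_closure:] ^ ?q) = ?q"
        by (simp add: degree_power_eq)
      have "lead_coeff ([:1, 1::'f alg_closure:] ^ ?q) = 1"
        by (subst lead_coeff_power) simp
      then show "coeff ([:1, 1::'f alg_closure:] ^ ?q - monom 1 ?q) k = 0"
        using k d by (cases "k = ?q") (auto simp: coeff_eq_0)
    qed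
  qed
  have "g = 0"
  proof (rule ccontr)
    assume g0: "g \<noteq> 0"
    have "degree g < ?q" unfolding g_def
      by (rule degree_diff_less[OF deg1]) (use q in simp)
    moreover have "range to_ac \<subseteq> {x. poly g x = 0}"
    proof clarify
      fix x :: 'f
      have "to_ac ((1 + x) ^ ?q - x ^ ?q - 1) = (0 :: 'f alg_closure)"
        by (simp only: power_card_eq_self) simp
      then show "poly g (to_ac x) = 0" by (simp add: g_def poly_monom)
    qed
    then have "card (range (to_ac :: 'f \<Rightarrow> _)) \<le> card {x. poly g x = 0}"
      by (rule card_mono[OF poly_roots_finite[OF g0]])
    ultimately show False
      using card_poly_roots_bound[OF g0] by (simp add: card_image inj_to_ac)
  qed
  then have one: "(1 + z) ^ ?q = 1 + z ^ ?q" for z :: "'f alg_closure"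
  proof -
    have "poly g z = 0" using \<open>g = 0\<close> by simp
    then show ?thesis unfolding g_def by (simp add: poly_monom algebra_simps)
  qed
  have add: "(x + y) ^ ?q = x ^ ?q + y ^ ?q" for x y :: "'f alg_closure"
  proof (cases "x = 0")
    case False
    then have "x + y = x * (1 + y / x)" by (simp add: field_simps)
    then show ?thesis using False by (simp only: power_mult_distrib one) (simp add: field_simps)
  qed (use q in \<open>simp add: zero_power\<close>)
  show ?thesis
    by (induction i) (simp_all add: power_mult add mult.commute[of ?q])
qed

lemma frob_sum:
  "(\<Sum>x\<in>A. f x :: 'f::{field,finite} alg_closure) ^ (CARD('f) ^ i) = (\<Sum>x\<in>A. f x ^ (CARD('f) ^ i))"
  by (induction A rule: infinite_finite_induct) (simp_all add: frob_add zero_power)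

lemma frob_minus:
  "(- x :: 'f::{field,finite} alg_closure) ^ (CARD('f) ^ i) = - (x ^ (CARD('f) ^ i))"
proof -
  have "(- x + x) ^ (CARD('f) ^ i) = (- x) ^ (CARD('f) ^ i) + x ^ (CARD('f) ^ i)" by (rule frob_add)
  then show ?thesis by (simp add: zero_power eq_neg_iff_add_eq_0)
qed

lemma frob_diff:
  "(x - y :: 'f::{field,finite} alg_closure) ^ (CARD('f) ^ i) = x ^ (CARD('f) ^ i) - y ^ (CARD('f) ^ i)"
  using frob_add[of x "- y" i] by (simp add: frob_minus)

lemma frob_frob:
  "((x :: 'f::{field,finite} alg_closure) ^ (CARD('f) ^ i)) ^ (CARD('f) ^ j) = x ^ (CARD('f) ^ (i + j))"
  by (simp add: power_mult[symmetric] power_add)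

lemma frob_inj:
  "(x :: 'f::{field,finite} alg_closure) ^ (CARD('f) ^ i) = y ^ (CARD('f) ^ i) \<longleftrightarrow> x = y"
  using frob_diff[of x y i] by auto

lemma frob_to_ac: "to_ac (x :: 'f::{field,finite}) ^ (CARD('f) ^ i) = to_ac x"
proof -
  have "x ^ (CARD('f) ^ i) = x"
    by (induction i) (simp_all add: power_mult power_card_eq_self)
  then show ?thesis by (metis to_ac_power)
qed

section \<open>Twisted polynomials as operators\<close>

lemma twisted_act_altdef:
  fixes f :: "'f::{field,finite} alg_closure poly"
  assumes "degree f \<le> N"
  shows "twisted_act f v = (\<Sum>i\<le>N. coeff f i * v ^ (CARD('f) ^ i))"
  unfolding twisted_act_def
  by (rule sum.mono_neutral_left) (use assms in \<open>auto simp: coeff_eq_0\<close>)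

lemma twisted_act_add: "twisted_act (f + g) v = twisted_act f v + twisted_act g v"
proof -
  define N where "N = max (degree f) (degree g)"
  have "degree f \<le> N" "degree g \<le> N" "degree (f + g) \<le> N"
    unfolding N_def by (auto intro: degree_add_le)
  then show ?thesis by (simp add: twisted_act_altdef sum.distrib algebra_simps)
qed

lemma twisted_act_0 [simp]: "twisted_act 0 v = 0" by (simp add: twisted_act_def)

lemma twisted_act_minus: "twisted_act (- f) v = - twisted_act f v"
  by (simp add: twisted_act_def sum_negf)

lemma twisted_act_diff: "twisted_act (f - g) v = twisted_act f v - twisted_act g v"
  using twisted_act_add[of f "- g" v] by (simp add: twisted_act_minus)

lemma twisted_act_sum: "twisted_act (\<Sum>i\<in>I. f i) v = (\<Sum>i\<in>I. twisted_act (f i) v)"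
  by (induction I rule: infinite_finite_induct) (simp_all add: twisted_act_add)

lemma twisted_act_monom:
  "twisted_act (monom a i) v = a * v ^ (CARD('f) ^ i)"
    for a :: "'f::{field,finite} alg_closure"
proof -
  have "twisted_act (monom a i) v = (\<Sum>j\<le>i. if j = i then a * v ^ (CARD('f) ^ i) else 0)"
    unfolding twisted_act_altdef[OF degree_monom_le] by (rule sum.cong) auto
  then show ?thesis by simp
qed

lemma twisted_act_const: "twisted_act [:a:] v = a * v"
  using twisted_act_monom[of a 0 v] by (simp add: monom_0)

lemma twisted_act_arg_add: "twisted_act f (v + w) = twisted_act f v + twisted_act f w"
  by (simp add: twisted_act_def frob_add sum.distrib algebra_simps)

lemma twisted_act_arg_0 [simp]: "twisted_act f 0 = 0"
  by (simp add: twisted_act_def zero_power)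

lemma twisted_act_arg_minus: "twisted_act f (- v) = - twisted_act f v"
  by (simp add: twisted_act_def frob_minus sum_negf)

lemma twisted_act_arg_diff: "twisted_act f (v - w) = twisted_act f v - twisted_act f w"
  using twisted_act_arg_add[of f v "- w"] by (simp add: twisted_act_arg_minus)

lemma twisted_act_arg_sum: "twisted_act f (\<Sum>i\<in>I. g i) = (\<Sum>i\<in>I. twisted_act f (g i))"
  by (induction I rule: infinite_finite_induct) (simp_all add: twisted_act_arg_add)

text \<open>
  The product of twisted polynomials is composition of operators. Together with the faithfulness of
  the action (\<open>twisted_act_eqI\<close>), this reduces identities in the twisted polynomial ring to identities
  between operators.
\<close>

lemma twisted_act_mult: "twisted_act (twisted_mult f g) v = twisted_act f (twisted_act g v)"
  by (simp add: twisted_mult_def twisted_act_sum twisted_act_monom)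
     (simp add: twisted_act_def frob_sum sum_distrib_left power_mult_distrib frob_frob
        mult.assoc add.commute)

lemma coeff_twisted_mult:
  "coeff (twisted_mult f g) k =
    (\<Sum>i\<le>k. coeff f i * coeff g (k - i) ^ (CARD('f) ^ i))"
    for f :: "'f::{field,finite} alg_closure poly"
proof -
  let ?h = "\<lambda>i. coeff f i * coeff g (k - i) ^ (CARD('f) ^ i)"
  have "coeff (twisted_mult f g) k =
     (\<Sum>i\<le>degree f. \<Sum>j\<le>degree g. if j = k - i \<and> i \<le> k then ?h i else 0)"
    unfolding twisted_mult_def coeff_sum coeff_monom
    by (intro sum.cong) auto
  also have "\<dots> = (\<Sum>i\<le>degree f. if i \<le> k then ?h i else 0)"
  proof (rule sum.cong)
    fix i
    show "(\<Sum>j\<le>degree g. if j = k - i \<and> i \<le> k then ?h i else 0) = (if i \<le> k then ?h i else 0)"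
      by (cases "i \<le> k") (auto simp: coeff_eq_0 zero_power)
  qed simp
  also have "\<dots> = (\<Sum>i\<in>{..degree f} \<inter> {..k}. ?h i)"
    by (subst sum.inter_restrict) simp_all
  also have "\<dots> = (\<Sum>i\<le>k. ?h i)"
    by (rule sum.mono_neutral_left) (auto simp: coeff_eq_0)
  finally show ?thesis .
qed

lemma degree_twisted_mult_le: "degree (twisted_mult f g) \<le> degree f + degree g"
proof (rule degree_le, intro allI impI)
  fix k assume k: "degree f + degree g < k"
  show "coeff (twisted_mult f g) k = 0"
    unfolding coeff_twisted_mult
  proof (rule sum.neutral, clarify)
    fix i
    show "coeff f i * coeff g (k - i) ^ (CARD('a) ^ i) = 0"
      using k by (cases "i \<le> degree f") (auto simp: coeff_eq_0 zero_power)
  qed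
qed

lemma coeff_twisted_mult_degree_sum:
  "coeff (twisted_mult f g) (degree f + degree g) =
    lead_coeff f * lead_coeff g ^ (CARD('f) ^ degree f)"
    for f :: "'f::{field,finite} alg_closure poly"
proof -
  have "coeff (twisted_mult f g) (degree f + degree g) =
     (\<Sum>i\<le>degree f + degree g. if i = degree f then
      lead_coeff f * lead_coeff g ^ (CARD('f) ^ degree f) else 0)"
    unfolding coeff_twisted_mult
  proof (rule sum.cong)
    fix i
    show "coeff f i * coeff g (degree f + degree g - i) ^ (CARD('f) ^ i) =
      (if i = degree f then lead_coeff f * lead_coeff g ^ (CARD('f) ^ degree f) else 0)"
      by (cases i "degree f" rule: linorder_cases) (auto simp: coeff_eq_0 zero_power)
  qed simp
  then show ?thesis by simp
qed

lemma degree_twisted_mult: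
  assumes "f \<noteq> 0" "g \<noteq> 0"
  shows "degree (twisted_mult f g) = degree f + degree g"
  by (rule antisym[OF degree_twisted_mult_le le_degree])
     (use assms in \<open>simp add: coeff_twisted_mult_degree_sum\<close>)

text \<open>
  The ordinary polynomial with the same values as the operator. Kernel and image of the operator are
  read off from its roots.
\<close>

definition additive_poly :: "'f::{field,finite} alg_closure poly \<Rightarrow> 'f alg_closure poly" where
  "additive_poly f = (\<Sum>i\<le>degree f. monom (coeff f i) (CARD('f) ^ i))"

lemma poly_additive_poly: "poly (additive_poly f) v = twisted_act f v"
  by (simp add: additive_poly_def twisted_act_def poly_sum poly_monom)

lemma degree_additive_poly:
  fixes f :: "'f::{field,finite} alg_closure poly"
  assumes "f \<noteq> 0"
  shows "degree (additive_poly f) = CARD('f) ^ degree f"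
proof (rule antisym)
  have q: "CARD('f) > 1" by (rule card_field_gt_1)
  show "degree (additive_poly f) \<le> CARD('f) ^ degree f"
    unfolding additive_poly_def
    by (rule degree_sum_le) (use q in \<open>auto intro!: order.trans[OF degree_monom_le] power_increasing\<close>)
  have "coeff (additive_poly f) (CARD('f) ^ degree f) =
     (\<Sum>i\<le>degree f. if i = degree f then lead_coeff f else 0)"
    unfolding additive_poly_def coeff_sum coeff_monom
    by (intro sum.cong) (use q in \<open>auto simp: power_inject_exp\<close>)
  then show "CARD('f) ^ degree f \<le> degree (additive_poly f)"
    using assms by (intro le_degree) simp
qed

lemma additive_poly_eq_0_iff: "additive_poly f = 0 \<longleftrightarrow> f = 0"
proof
  assume "additive_poly f = 0"
  then show "f = 0"
    using degree_additive_poly[of f] by (metis degree_0 power_eq_0_iff zero_neq_one card_field_gt_1 not_one_less_zero)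
qed (simp add: additive_poly_def)

lemma card_twisted_kernel_le:
  fixes f :: "'f::{field,finite} alg_closure poly"
  assumes "f \<noteq> 0"
  shows "finite {v. twisted_act f v = 0}"
    and "card {v. twisted_act f v = 0} \<le> CARD('f) ^ degree f"
proof -
  have "additive_poly f \<noteq> 0" using assms by (simp add: additive_poly_eq_0_iff)
  from poly_roots_finite[OF this] card_poly_roots_bound[OF this]
  show "finite {v. twisted_act f v = 0}" "card {v. twisted_act f v = 0} \<le> CARD('f) ^ degree f"
    using assms by (simp_all add: poly_additive_poly degree_additive_poly)
qed

text \<open>All roots are simple, and there are as many roots with multiplicity as the degree says.\<close>

lemma card_roots_separable:
  fixes f :: "'a::alg_closed_field poly"
  assumes f0: "f \<noteq> 0" and sep: "\<And>x. poly f x = 0 \<Longrightarrow> poly (pderiv f) x \<noteq> 0"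
  shows "card {x. poly f x = 0} = degree f"
proof -
  obtain A where A: "size A = degree f"
    "f = Polynomial.smult (lead_coeff f) (\<Prod>x\<in>#A. [:-x, 1:])"
    using alg_closed_imp_factorization[OF f0] by blast
  have "proots (\<Prod>x\<in>#A. [:-x, 1:]) = A"
  proof (induction A)
    case (add x A)
    have "(\<Prod>x\<in>#A. [:-x, 1:]) \<noteq> 0" by (induction A) (simp_all del: mult_pCons_left)
    then show ?case using add by (simp add: proots_mult del: mult_pCons_left)
  qed simp
  then have roots: "proots f = A"
    using f0 by (subst A(2)) simp
  have le1: "count A x \<le> 1" for x
  proof (rule ccontr)
    assume "\<not> count A x \<le> 1"
    then have "2 \<le> Polynomial.order x f" using f0 unfolding roots[symmetric] by simp
    then have "[:-x, 1:] ^ 2 dvd f" by (simp add: order_divides)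
    then obtain g where "f = [:-x, 1:] * ([:-x, 1:] * g)"
      by (elim dvdE) (simp only: power2_eq_square mult.assoc)
    then show False using sep[of x] by (simp add: pderiv_mult pderiv_pCons del: mult_pCons_left)
  qed
  have "count A x = (if x \<in> set_mset A then 1 else 0)" for x
    using le1[of x] count_greater_zero_iff[of A x] by (cases "x \<in># A") (simp_all add: not_in_iff del: count_greater_zero_iff)
  then have "A = mset_set (set_mset A)"
    by (intro multiset_eqI) simp
  then have "size A = card (set_mset A)" by (metis size_mset_set)
  moreover have "set_mset A = {x. poly f x = 0}"
    using f0 unfolding roots[symmetric] by simp
  ultimately show ?thesis using A(1) by simp
qed

text \<open>Since \<open>q = 0\<close> in the field, the derivative of the additive polynomial is the constant \<open>coeff f 0\<close>.\<close>

lemma card_twisted_kernel: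
  fixes f :: "'f::{field,finite} alg_closure poly"
  assumes "coeff f 0 \<noteq> 0"
  shows "card {v. twisted_act f v = 0} = CARD('f) ^ degree f"
proof -
  have f0: "f \<noteq> 0" using assms by auto
  have q0: "(of_nat CARD('f) :: 'f alg_closure) = 0"
    by (metis of_nat_card_eq_0 to_ac_0 to_ac_of_nat)
  have pd: "pderiv (\<Sum>i\<in>I. g i) = (\<Sum>i\<in>I. pderiv (g i))" for I and g :: "nat \<Rightarrow> 'f alg_closure poly"
    by (induction I rule: infinite_finite_induct) (simp_all add: pderiv_add)
  have "pderiv (additive_poly f) = (\<Sum>i\<le>degree f. if i = 0 then [:coeff f 0:] else 0)"
    unfolding additive_poly_def pd pderiv_monom
    by (rule sum.cong) (auto simp: q0 monom_0 zero_power)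
  then have "pderiv (additive_poly f) = [:coeff f 0:]" by simp
  then have "card {x. poly (additive_poly f) x = 0} = degree (additive_poly f)"
    using assms f0 by (intro card_roots_separable) (simp_all add: additive_poly_eq_0_iff)
  then show ?thesis
    using f0 by (simp add: poly_additive_poly degree_additive_poly)
qed

lemma twisted_act_surj:
  assumes "f \<noteq> 0"
  obtains v where "twisted_act f v = w"
proof -
  have "degree (additive_poly f - [:w:]) = CARD('a) ^ degree f"
    using degree_additive_poly[OF assms] card_field_gt_1[where 'f='a]
    unfolding diff_conv_add_uminus by (subst degree_add_eq_left) simp_all
  then obtain v where "poly (additive_poly f - [:w:]) v = 0"
    using alg_closed_imp_poly_has_root[of "additive_poly f - [:w:]"] card_field_gt_1[where 'f='a] by auto
  then show ?thesis using that by (simp add: poly_additive_poly)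
qed

text \<open>If the field were finite, \<open>1 + \<Prod>\<^sub>x (X - x)\<close> would have no root.\<close>

lemma infinite_UNIV_alg_closed: "infinite (UNIV :: 'a :: alg_closed_field set)"
proof
  assume fin: "finite (UNIV :: 'a set)"
  define P :: "'a poly" where "P = (\<Prod>x\<in>UNIV. [:-x, 1:])"
  have "degree P = CARD('a)"
    unfolding P_def by (subst degree_prod_eq_sum_degree) auto
  moreover have "CARD('a) > 0" using fin by (simp add: finite_UNIV_card_ge_0)
  ultimately have "degree (P + 1) > 0" by (subst degree_add_eq_left) auto
  then obtain x where "poly (P + 1) x = 0" using alg_closed_imp_poly_has_root by blast
  moreover have "poly P x = 0" unfolding P_def poly_prod using fin by (simp add: prod_zero_iff)
  ultimately show False by simp
qed

lemma twisted_act_eqI: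
  assumes "\<And>v. twisted_act f v = twisted_act g v"
  shows "f = g"
proof (rule ccontr)
  assume "f \<noteq> g"
  then have "finite {v. twisted_act (f - g) v = 0}" by (intro card_twisted_kernel_le) simp
  then show False using assms by (simp add: twisted_act_diff infinite_UNIV_alg_closed)
qed

text \<open>
  Division with the divisor on the right. To cancel the leading term of \<open>f\<close> against \<open>a \<tau>\<^sup>k g\<close>, one
  divides by the \<open>q\<^sup>k\<close>-th power of the leading coefficient of \<open>g\<close>.
\<close>

lemma twisted_right_division:
  fixes f g :: "'f::{field,finite} alg_closure poly"
  assumes "g \<noteq> 0"
  obtains h r where "f = twisted_mult h g + r" "r = 0 \<or> degree r < degree g"
proof -
  have "\<exists>h r. f = twisted_mult h g + r \<and> (r = 0 \<or> degree r < degree g)"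
  proof (induction "degree f" arbitrary: f rule: less_induct)
    case less
    show ?case
    proof (cases "f = 0 \<or> degree f < degree g")
      case True
      have "f = twisted_mult 0 g + f" by (simp add: twisted_mult_def)
      with True show ?thesis by blast
    next
      case False
      define k where "k = degree f - degree g"
      define h where "h = monom (lead_coeff f / lead_coeff g ^ (CARD('f) ^ k)) k"
      have h: "h \<noteq> 0" "degree h = k"
        using False assms by (simp_all add: h_def degree_monom_eq)
      have deg: "k + degree g = degree f" using False by (simp add: k_def)
      have lead: "coeff (twisted_mult h g) (degree f) = lead_coeff f"
        using coeff_twisted_mult_degree_sum[of h g] assms False h deg by (simp add: h_def degree_monom_eq)
      show ?thesis
      proof (cases "f - twisted_mult h g = 0 \<or> degree f = 0")
        case True
        have d: "degree (f - twisted_mult h g) \<le> degree f"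
          using degree_twisted_mult_le[of h g] h deg by (intro degree_diff_le) auto
        have "f - twisted_mult h g = 0"
          using True d lead by (metis coeff_diff diff_self le_zero_eq leading_coeff_0_iff)
        then have "f = twisted_mult h g + 0" by simp
        then show ?thesis by blast
      next
        case F: False
        have "degree (f - twisted_mult h g) < degree f"
        proof (rule degree_lessI)
          show "\<forall>k\<ge>degree f. coeff (f - twisted_mult h g) k = 0"
          proof (intro allI impI)
            fix j assume "j \<ge> degree f"
            then show "coeff (f - twisted_mult h g) j = 0"
              using lead degree_twisted_mult[OF h(1) assms] h(2) deg
              by (cases "j = degree f") (auto simp: coeff_eq_0)
          qed
        qed (use F in auto)
        from less[OF this] obtain h' r where
          "f - twisted_mult h g = twisted_mult h' g + r" "r = 0 \<or> degree r < degree g"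
          by blast
        moreover have "twisted_mult (h + h') g = twisted_mult h g + twisted_mult h' g"
          by (rule twisted_act_eqI) (simp add: twisted_act_mult twisted_act_add)
        ultimately have "f = twisted_mult (h + h') g + r" by (simp add: algebra_simps)
        with \<open>r = 0 \<or> _\<close> show ?thesis by blast
      qed
    qed
  qed
  then show ?thesis using that by blast
qed

section \<open>Polynomials over a field modulo an irreducible one\<close>

lemma poly_map_to_ac_add:
  "poly (map_poly to_ac (a + b)) t = poly (map_poly to_ac a) t + poly (map_poly to_ac b) t"
proof -
  have "map_poly to_ac (a + b) = map_poly to_ac a + map_poly to_ac b"
    by (rule poly_eqI) (simp add: coeff_map_poly)
  then show ?thesis by simp
qed

lemma poly_map_to_ac_mult:
  "poly (map_poly to_ac (a * b)) t = poly (map_poly to_ac a) t * poly (map_poly to_ac b) t"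
proof -
  have "map_poly to_ac (a * b) = map_poly to_ac a * map_poly to_ac b"
    by (rule poly_eqI) (simp add: coeff_map_poly coeff_mult to_ac_sum)
  then show ?thesis by simp
qed

text \<open>A nonzero element of least degree in the ideal generated by \<open>p\<close> and \<open>a\<close> divides both, hence is a unit.\<close>

lemma irreducible_bezout:
  fixes p a :: "'a::field poly"
  assumes "Factorial_Ring.irreducible p" "\<not> p dvd a"
  obtains u w where "u * p + w * a = 1"
proof -
  define I where "I = {g. \<exists>u w. g = u * p + w * a}"
  have "p \<in> I" "a \<in> I" unfolding I_def
    by (rule CollectI, rule exI[of _ 1], rule exI[of _ 0], simp)
       (rule CollectI, rule exI[of _ 0], rule exI[of _ 1], simp)
  have "p \<noteq> 0" using assms by auto
  define g where "g = (ARG_MIN degree g. g \<in> I \<and> g \<noteq> 0)"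
  have g: "g \<in> I \<and> g \<noteq> 0" and gmin: "\<And>h. h \<in> I \<and> h \<noteq> 0 \<Longrightarrow> degree g \<le> degree h"
    unfolding g_def
    using arg_min_nat_lemma[of "\<lambda>g. g \<in> I \<and> g \<noteq> 0" p degree] \<open>p \<in> I\<close> \<open>p \<noteq> 0\<close> by auto
  have g_dvd: "g dvd h" if hI: "h \<in> I" for h
  proof (rule ccontr)
    assume n: "\<not> g dvd h"
    have "h mod g \<in> I"
    proof -
      obtain u w u' w' where "h = u * p + w * a" "g = u' * p + w' * a"
        using g hI unfolding I_def by blast
      then have "h mod g = (u - h div g * u') * p + (w - h div g * w') * a"
        by (simp add: minus_div_mult_eq_mod[symmetric] algebra_simps)
      then show ?thesis unfolding I_def by blast
    qed
    moreover have "h mod g \<noteq> 0" using n by (simp add: dvd_eq_mod_eq_0)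
    ultimately show False
      using gmin[of "h mod g"] degree_mod_less'[of g h] g by linarith
  qed
  obtain k where k: "p = g * k" using g_dvd[OF \<open>p \<in> I\<close>] by (elim dvdE)
  have "is_unit g"
  proof (rule ccontr)
    assume "\<not> is_unit g"
    then have "is_unit k" using Factorial_Ring.irreducibleD[OF assms(1) k] by blast
    then have "p dvd g" unfolding k by (simp add: mult_unit_dvd_iff)
    then show False using g_dvd[OF \<open>a \<in> I\<close>] assms(2) dvd_trans by blast
  qed
  then obtain e where e: "1 = g * e" by (elim dvdE)
  obtain u w where "g = u * p + w * a" using g unfolding I_def by blast
  then have "(e * u) * p + (e * w) * a = 1" using e by (simp add: algebra_simps)
  then show ?thesis by (rule that)
qed

lemma root_imp_irreducible_dvd:
  assumes "Factorial_Ring.irreducible p" "poly (map_poly to_ac p) t = 0" "poly (map_poly to_ac a) t = 0"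
  shows "p dvd a"
proof (rule ccontr)
  assume "\<not> p dvd a"
  then obtain u w where "u * p + w * a = 1" using irreducible_bezout[OF assms(1)] by blast
  then have "poly (map_poly to_ac (u * p + w * a)) t = 1" by (simp only:) simp
  then show False using assms by (simp add: poly_map_to_ac_add poly_map_to_ac_mult)
qed

lemma degree_irreducible_pos:
  assumes "Factorial_Ring.irreducible (p :: 'a::field poly)"
  shows "degree p > 0"
  using assms by (auto simp: Factorial_Ring.irreducible_def is_unit_iff_degree)

lemma card_small_polys:
  "finite {a :: 'f::{field,finite} poly. a = 0 \<or> degree a < d}"
  "card {a :: 'f::{field,finite} poly. a = 0 \<or> degree a < d} = CARD('f) ^ d"
proof -
  let ?A = "{a :: 'f poly. a = 0 \<or> degree a < d}"
  have bij: "bij_betw (\<lambda>a. restrict (coeff a) {..<d}) ?A ({..<d} \<rightarrow>\<^sub>E UNIV)"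
  proof (rule bij_betwI')
    fix a b assume ab: "a \<in> ?A" "b \<in> ?A"
    show "restrict (coeff a) {..<d} = restrict (coeff b) {..<d} \<longleftrightarrow> a = b"
    proof
      assume eq: "restrict (coeff a) {..<d} = restrict (coeff b) {..<d}"
      show "a = b"
      proof (rule poly_eqI)
        fix i
        show "coeff a i = coeff b i"
        proof (cases "i < d")
          case True
          then show ?thesis using fun_cong[OF eq, of i] by simp
        next
          case False
          then show ?thesis using ab by (auto simp: coeff_eq_0)
        qed
      qed
    qed simp
  next
    fix F assume F: "F \<in> {..<d} \<rightarrow>\<^sub>E (UNIV :: 'f set)"
    define a where "a = (\<Sum>i<d. monom (F i) i)"
    have ca: "coeff a i = (if i < d then F i else 0)" for i
      unfolding a_def coeff_sum coeff_monom by simp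
    have "a \<in> ?A"
    proof (cases "a = 0")
      case False
      have "degree a < d" by (rule degree_lessI) (use False ca in auto)
      then show ?thesis by simp
    qed simp
    moreover have "F = restrict (coeff a) {..<d}"
      using F by (auto simp: ca fun_eq_iff PiE_def extensional_def)
    ultimately show "\<exists>a\<in>?A. F = restrict (coeff a) {..<d}" by blast
  qed simp
  from bij_betw_finite[OF bij] show "finite ?A" by (simp add: finite_PiE)
  from bij_betw_same_card[OF bij] show "card ?A = CARD('f) ^ d" by (simp add: card_PiE)
qed

section \<open>Galois orbits\<close>

lemma frob_period_gcd:
  fixes x :: "'f::{field,finite} alg_closure"
  assumes "x ^ (CARD('f) ^ a) = x" "x ^ (CARD('f) ^ b) = x"
  shows "x ^ (CARD('f) ^ gcd a b) = x"
proof (cases "a = 0")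
  case False
  have mult: "x ^ (CARD('f) ^ (e * k)) = x" if "x ^ (CARD('f) ^ e) = x" for e k
    by (induction k) (simp_all add: frob_frob[symmetric] that)
  obtain u w where "a * u = b * w + gcd a b" using bezout_nat[OF False] by blast
  then have "x = (x ^ (CARD('f) ^ (b * w))) ^ (CARD('f) ^ gcd a b)"
    using mult[OF assms(1), of u] by (simp add: frob_frob)
  then show ?thesis using mult[OF assms(2), of w] by simp
qed (use assms in simp)

lemma frob_fixed_card_le:
  assumes "e > 0"
  shows "finite {x :: 'f::{field,finite} alg_closure. x ^ (CARD('f) ^ e) = x}"
    and "card {x :: 'f::{field,finite} alg_closure. x ^ (CARD('f) ^ e) = x} \<le> CARD('f) ^ e"
proof -
  define f :: "'f alg_closure poly" where "f = monom 1 e - 1"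
  have deg: "degree f = e" unfolding f_def diff_conv_add_uminus
    using assms by (subst degree_add_eq_left) (simp_all add: degree_monom_eq)
  then have "f \<noteq> 0" using assms by auto
  from card_twisted_kernel_le[OF this]
  have "finite {v. twisted_act f v = 0}" "card {v. twisted_act f v = 0} \<le> CARD('f) ^ e"
    by (simp_all add: deg)
  moreover have "twisted_act f v = v ^ (CARD('f) ^ e) - v" for v
    using twisted_act_const[of 1 v] by (simp add: f_def twisted_act_diff twisted_act_monom one_pCons)
  ultimately show "finite {x :: 'f alg_closure. x ^ (CARD('f) ^ e) = x}"
    "card {x :: 'f alg_closure. x ^ (CARD('f) ^ e) = x} \<le> CARD('f) ^ e" by simp_all
qed

text \<open>The polynomial \<open>X\<^sup>q - X\<close> has at most \<open>q\<close> roots, and the elements of the base field are such roots.\<close>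

lemma frob_fixed_1:
  fixes x :: "'f::{field,finite} alg_closure"
  assumes "x ^ CARD('f) = x"
  shows "x \<in> range to_ac"
proof -
  let ?F = "{x :: 'f alg_closure. x ^ (CARD('f) ^ 1) = x}"
  have "range to_ac \<subseteq> ?F" using frob_to_ac[of _ 1] by auto
  moreover have "card ?F \<le> card (range (to_ac :: 'f \<Rightarrow> _))"
    using frob_fixed_card_le(2)[where 'f='f, of 1] by (simp add: card_image inj_to_ac)
  ultimately have "range to_ac = ?F"
    using frob_fixed_card_le(1)[where 'f='f, of 1] by (intro card_seteq) auto
  then show ?thesis using assms by auto
qed

lemma poly_to_ac_frob:
  "poly (map_poly to_ac a) (x ^ (CARD('f) ^ i)) = poly (map_poly to_ac a) x ^ (CARD('f) ^ i)"
  for x :: "'f::{field,finite} alg_closure"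
  by (induction a)
     (simp_all add: map_poly_pCons frob_add power_mult_distrib frob_to_ac zero_power)

locale irreducible_root =
  fixes p0 :: "'f::{field,finite} poly" and r :: nat and t :: "'f alg_closure"
  assumes irr0: "Factorial_Ring.irreducible p0" and deg0: "degree p0 = r"
    and monic0: "lead_coeff p0 = 1"
    and root0: "poly (map_poly to_ac p0) t = 0" and t_fixed: "t ^ (CARD('f) ^ r) = t"
begin

lemma r_pos: "r > 0" using degree_irreducible_pos[OF irr0] deg0 by simp

text \<open>
  The exponents \<open>e\<close> with \<open>t\<^bsup>q^e\<^esup> = t\<close> are closed under gcd, so it suffices that the gcd \<open>g\<close> of \<open>e\<close>
  and \<open>r\<close> is at least \<open>r\<close>. Evaluation at \<open>t\<close> embeds the \<open>q\<^sup>r\<close> polynomials of degree below \<open>r\<close>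
  into the field fixed by the \<open>g\<close>-th power of Frobenius, which has at most \<open>q\<^sup>g\<close> elements.
\<close>

lemma frob_t_eq_imp_dvd:
  assumes "t ^ (CARD('f) ^ e) = t"
  shows "r dvd e"
proof -
  define g where "g = gcd e r"
  have g: "g > 0" "g dvd r" "t ^ (CARD('f) ^ g) = t"
    using r_pos frob_period_gcd[OF assms t_fixed] by (simp_all add: g_def)
  let ?A = "{a :: 'f poly. a = 0 \<or> degree a < r}"
  let ?ev = "\<lambda>a. poly (map_poly to_ac a) t"
  have "inj_on ?ev ?A"
  proof (rule inj_onI)
    fix a b assume ab: "a \<in> ?A" "b \<in> ?A" "?ev a = ?ev b"
    have "?ev (a - b) + ?ev b = ?ev a" by (simp add: poly_map_to_ac_add[symmetric])
    then have "?ev (a - b) = 0" using ab by simp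
    then have "p0 dvd a - b" by (rule root_imp_irreducible_dvd[OF irr0 root0])
    moreover have "a - b \<noteq> 0 \<Longrightarrow> degree (a - b) < r"
      using ab r_pos by (auto intro: degree_diff_less)
    ultimately show "a = b" using dvd_imp_degree_le[of p0 "a - b"] deg0 by (cases "a = b") auto
  qed
  moreover have "?ev ` ?A \<subseteq> {x. x ^ (CARD('f) ^ g) = x}"
    using g(3) by (auto simp: poly_to_ac_frob[symmetric])
  ultimately have "card ?A \<le> card {x :: 'f alg_closure. x ^ (CARD('f) ^ g) = x}"
    using frob_fixed_card_le(1)[OF g(1)] by (rule card_inj_on_le)
  also have "\<dots> \<le> CARD('f) ^ g" by (rule frob_fixed_card_le[OF g(1)])
  finally have "r \<le> g"
    using card_field_gt_1[where 'f='f] by (simp add: card_small_polys power_increasing_iff)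
  then have "g = r" using g(2) r_pos by (intro dvd_antisym) (auto dest: dvd_imp_le)
  then show ?thesis unfolding g_def by (metis gcd_dvd1)
qed

text \<open>
  As \<open>n\<close> is a unit modulo \<open>r\<close>, the \<open>r\<close> listed conjugates of \<open>t\<close> are distinct, and they are roots
  of the monic polynomial \<open>p0\<close> of degree \<open>r\<close>.
\<close>

lemma prod_conjugates:
  assumes "coprime n r"
  shows "map_poly to_ac p0 = (\<Prod>i<r. [:- (t ^ (CARD('f) ^ (n * i))), 1:])"
    (is "_ = ?P")
proof (rule poly_eqI_degree_lead_coeff)
  let ?A = "(\<lambda>i. t ^ (CARD('f) ^ (n * i))) ` {..<r}"
  have le: "i = j" if "t ^ (CARD('f) ^ (n * i)) = t ^ (CARD('f) ^ (n * j))" "i \<le> j" "j < r" for i j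
  proof -
    have "n * j = n * (j - i) + n * i" using that(2) by (simp add: algebra_simps)
    then have "(t ^ (CARD('f) ^ (n * (j - i)))) ^ (CARD('f) ^ (n * i)) = t ^ (CARD('f) ^ (n * i))"
      using that(1) by (simp add: frob_frob)
    then have "r dvd n * (j - i)" by (intro frob_t_eq_imp_dvd) (simp add: frob_inj)
    then have "r dvd j - i" using assms by (simp add: coprime_dvd_mult_right_iff coprime_commute)
    then show ?thesis using that by (auto dest: dvd_imp_le)
  qed
  have "inj_on (\<lambda>i. t ^ (CARD('f) ^ (n * i))) {..<r}"
  proof (rule inj_onI)
    fix i j assume "i \<in> {..<r}" "j \<in> {..<r}" "t ^ (CARD('f) ^ (n * i)) = t ^ (CARD('f) ^ (n * j))"
    then show "i = j" using le[of i j] le[of j i] by (cases "i \<le> j") auto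
  qed
  then show "r \<le> card ?A" by (simp add: card_image)
  have degP: "degree ?P = r"
    by (subst degree_prod_eq_sum_degree) simp_all
  then show "degree ?P \<le> r" by simp
  show "degree (map_poly to_ac p0) \<le> r"
    using deg0 by (simp add: degree_map_poly)
  have "lead_coeff ?P = 1" by (simp add: lead_coeff_prod)
  then show "coeff (map_poly to_ac p0) r = coeff ?P r"
    using degP monic0 deg0 by (simp add: coeff_map_poly)
  fix z assume "z \<in> ?A"
  then obtain i where i: "i < r" "z = t ^ (CARD('f) ^ (n * i))" by auto
  have "poly (map_poly to_ac p0) z = 0"
    using root0 unfolding i by (simp add: poly_to_ac_frob zero_power)
  moreover have "poly ?P z = 0" unfolding poly_prod using i by (auto simp: prod_zero_iff)
  ultimately show "poly (map_poly to_ac p0) z = poly ?P z" by simp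
qed

end

section \<open>The Drinfeld module\<close>

text \<open>
  The coefficient of \<open>\<tau>\<^sup>k\<close> is \<open>1\<close>, so the twisted product \<open>f \<tau>\<^sup>k\<close> is the ordinary one. Right
  multiplication by powers of \<open>\<tau>\<close> is therefore written with the ordinary product.
\<close>

lemma twisted_act_mult_monom:
  "twisted_act (f * monom 1 k) v = twisted_act f (v ^ (CARD('f) ^ k))"
  for v :: "'f::{field,finite} alg_closure"
proof -
  have "f * monom 1 k = (\<Sum>i\<le>degree f. monom (coeff f i) (i + k))"
    by (subst poly_as_sum_of_monoms[of f, symmetric])
       (simp add: sum_distrib_right mult_monom)
  then show ?thesis
    by (simp add: twisted_act_sum twisted_act_monom) (simp add: twisted_act_def frob_frob add.commute)
qed

lemma twisted_act_frob_commute: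
  fixes v :: "'f::{field,finite} alg_closure"
  assumes "\<And>i. coeff f i \<in> frob_fixed r"
  shows "twisted_act f (v ^ (CARD('f) ^ (r * k))) = twisted_act f v ^ (CARD('f) ^ (r * k))"
proof -
  have "twisted_act f (v ^ (CARD('f) ^ r)) = twisted_act f v ^ (CARD('f) ^ r)" for v
    unfolding twisted_act_def frob_sum power_mult_distrib
    using assms by (intro sum.cong) (simp_all add: frob_fixed_def frob_frob add.commute)
  then show ?thesis by (induction k arbitrary: v) (simp_all add: frob_frob[symmetric])
qed

locale drinfeld =
  fixes r n :: nat and t :: "'f::{field,finite} alg_closure" and \<phi>
  assumes drinfeld: "is_drinfeld_module r n t \<phi>" and n_pos: "n \<ge> 1"
begin

lemma phi_hom: "\<phi> \<in> ring_hom ring_of_type_algebra (twisted_poly_ring r)"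
  using drinfeld by (simp add: is_drinfeld_module_def)

lemma phi_const: "\<phi> [:a:] = [:to_ac a:]"
  using drinfeld by (simp add: is_drinfeld_module_def)

lemma phi_T: "\<phi> [:0, 1:] = [:t:] + monom 1 n"
  using drinfeld by (simp add: is_drinfeld_module_def)

lemma phi_add: "\<phi> (a + b) = \<phi> a + \<phi> b"
  using ring_hom_add[OF phi_hom, of a b] by (simp add: ring_of_type_algebra_def twisted_poly_ring_def)

lemma phi_mult: "\<phi> (a * b) = twisted_mult (\<phi> a) (\<phi> b)"
  using ring_hom_mult[OF phi_hom, of a b] by (simp add: ring_of_type_algebra_def twisted_poly_ring_def)

lemma phi_fixed: "coeff (\<phi> a) i \<in> frob_fixed r"
  using ring_hom_closed[OF phi_hom, of a] by (simp add: ring_of_type_algebra_def twisted_poly_ring_def)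

lemma phi_0: "\<phi> 0 = 0" using phi_const[of 0] by simp

lemma phi_diff: "\<phi> (a - b) = \<phi> a - \<phi> b"
  using phi_add[of "a - b" b] by simp

lemma phi_pCons: "\<phi> (pCons a b) = [:to_ac a:] + twisted_mult (\<phi> [:0, 1:]) (\<phi> b)"
proof -
  have "pCons a b = [:a:] + [:0, 1:] * b" by simp
  then show ?thesis by (metis phi_add phi_mult phi_const)
qed

lemma act_phi_mult: "twisted_act (\<phi> (a * b)) v = twisted_act (\<phi> a) (twisted_act (\<phi> b) v)"
  by (simp add: phi_mult twisted_act_mult)

lemma act_phi_commute:
  "twisted_act (\<phi> a) (twisted_act (\<phi> b) v) = twisted_act (\<phi> b) (twisted_act (\<phi> a) v)"
  by (metis act_phi_mult mult.commute)

lemma act_phi_frob: "twisted_act (\<phi> a) (v ^ (CARD('f) ^ (r * k))) = twisted_act (\<phi> a) v ^ (CARD('f) ^ (r * k))"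
  by (rule twisted_act_frob_commute) (rule phi_fixed)

lemma act_phi_T: "twisted_act (\<phi> [:0, 1:]) v = t * v + v ^ (CARD('f) ^ n)"
  by (simp add: phi_T twisted_act_add twisted_act_const twisted_act_monom)

lemma coeff_phi_T: "coeff (\<phi> [:0, 1:]) k = (if k = 0 then t else if k = n then 1 else 0)"
  using n_pos unfolding phi_T by (auto simp: coeff_pCons split: nat.split)

lemma degree_phi_T: "degree (\<phi> [:0, 1:]) = n" "\<phi> [:0, 1:] \<noteq> 0"
proof -
  show d: "degree (\<phi> [:0, 1:]) = n" unfolding phi_T
    using n_pos by (subst degree_add_eq_right) (simp_all add: degree_monom_eq)
  show "\<phi> [:0, 1:] \<noteq> 0" using d n_pos by auto
qed

lemma degree_phi:
  assumes "a \<noteq> 0"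
  shows "degree (\<phi> a) = n * degree a"
    and "lead_coeff (\<phi> a) = to_ac (lead_coeff a)"
proof -
  have "a \<noteq> 0 \<Longrightarrow> degree (\<phi> a) = n * degree a \<and>
    lead_coeff (\<phi> a) = to_ac (lead_coeff a)"
  proof (induction a)
    case (pCons a b)
    show ?case
    proof (cases "b = 0")
      case False
      let ?g = "twisted_mult (\<phi> [:0, 1:]) (\<phi> b)"
      from False pCons have IH: "degree (\<phi> b) = n * degree b"
        "lead_coeff (\<phi> b) = to_ac (lead_coeff b)" by auto
      have b0: "\<phi> b \<noteq> 0" using IH(2) False by (metis leading_coeff_0_iff to_ac_eq_0_iff)
      have dg: "degree ?g = n + n * degree b"
        using degree_twisted_mult[OF degree_phi_T(2) b0] by (simp add: degree_phi_T IH)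
      have lg: "coeff ?g (n + n * degree b) = to_ac (lead_coeff b)"
        using coeff_twisted_mult_degree_sum[of "\<phi> [:0, 1:]" "\<phi> b"] n_pos IH(2)
        by (simp add: degree_phi_T IH(1) coeff_phi_T frob_to_ac)
      have dsum: "degree (\<phi> (pCons a b)) = n + n * degree b"
        using n_pos by (subst phi_pCons, subst degree_add_eq_right) (simp_all add: dg)
      have "lead_coeff (\<phi> (pCons a b)) = coeff ?g (n + n * degree b)"
        unfolding dsum using n_pos by (subst phi_pCons) (simp add: coeff_pCons split: nat.split)
      then show ?thesis using False dsum lg by simp
    qed (use pCons in \<open>simp add: phi_const\<close>)
  qed simp
  then show "degree (\<phi> a) = n * degree a"
    "lead_coeff (\<phi> a) = to_ac (lead_coeff a)"
    using assms by blast+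
qed

lemma phi_eq_0_iff: "\<phi> a = 0 \<longleftrightarrow> a = 0"
  by (metis degree_phi(2) leading_coeff_0_iff phi_0 to_ac_eq_0_iff)

lemma coeff_phi_0: "coeff (\<phi> a) 0 = poly (map_poly to_ac a) t"
proof (induction a)
  case (pCons a b)
  then show ?case
    by (subst phi_pCons) (simp add: coeff_twisted_mult coeff_phi_T map_poly_pCons)
qed (simp add: phi_0)

lemma act_phi_expand:
  assumes "degree a \<le> N"
  shows "twisted_act (\<phi> a) v =
    (\<Sum>j\<le>N. to_ac (coeff a j) * (twisted_act (\<phi> [:0, 1:]) ^^ j) v)"
  using assms
proof (induction a arbitrary: N v)
  case (pCons a b)
  let ?L = "twisted_act (\<phi> [:0, 1:])"
  show ?case
  proof (cases "b = 0")
    case True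
    have "(\<Sum>j\<le>N. to_ac (coeff [:a:] j) * (?L ^^ j) v) = (\<Sum>j\<le>N. if j = 0 then to_ac a * v else 0)"
      by (rule sum.cong) (auto simp: coeff_pCons split: nat.split)
    then show ?thesis using True by (simp add: phi_const twisted_act_const)
  next
    case False
    then obtain M where M: "N = Suc M" using pCons.prems by (cases N) auto
    have "twisted_act (\<phi> (pCons a b)) v = to_ac a * v + twisted_act (\<phi> b) (?L v)"
      by (subst phi_pCons) (simp add: twisted_act_add twisted_act_const twisted_act_mult
        act_phi_commute[of b])
    also have "twisted_act (\<phi> b) (?L v) = (\<Sum>j\<le>M. to_ac (coeff b j) * (?L ^^ j) (?L v))"
      by (rule pCons.IH) (use pCons.prems False M in simp)
    finally show ?thesis unfolding M sum.atMost_Suc_shift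
      by (simp add: funpow_swap1)
  qed
qed (simp add: phi_0)

end

section \<open>The commutant of the Drinfeld module and Frobenius\<close>

locale drinfeld_frobenius = irreducible_root p0 r t + drinfeld r n t \<phi>
  for p0 :: "'f::{field,finite} poly" and r n t \<phi> +
  assumes coprime_n_r: "coprime n r"
begin

text \<open>
  Let \<open>\<sigma>\<close> be \<open>v \<mapsto> v\<^bsup>q^n\<^esup>\<close> and \<open>L = t + \<sigma>\<close>, the action of \<open>\<phi>(T)\<close>. Scalars do not commute with
  \<open>L\<close>, but polynomials may be evaluated at \<open>L\<close> with the coefficients on the left; this is \<open>ev\<close>.
  Since \<open>\<sigma>\<^sup>k t = t\<^sub>k \<sigma>\<^sup>k\<close> for \<open>t\<^sub>k = \<sigma>\<^sup>k(t)\<close>,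
  \<open>\<sigma>\<^sup>k\<^sup>+\<^sup>1 = \<sigma>\<^sup>k (L - t) = \<sigma>\<^sup>k L - t\<^sub>k \<sigma>\<^sup>k\<close>, so passing from \<open>k\<close> to \<open>k + 1\<close> multiplies the polynomial
  by \<open>X - t\<^sub>k\<close>.
\<close>

lemma act_phi_p0: "twisted_act (\<phi> p0) v = v ^ (CARD('f) ^ (r * n))"
proof -
  define L where "L = twisted_act (\<phi> [:0, 1:])"
  define F where "F k = (\<Prod>i<k. [:- (t ^ (CARD('f) ^ (n * i))), 1:])" for k
  define ev where "ev f v = (\<Sum>j\<le>r. coeff f j * (L ^^ j) v)" for f v
  have degF: "degree (F k) = k" for k
    unfolding F_def by (subst degree_prod_eq_sum_degree) simp_all
  have "k \<le> r \<Longrightarrow> v ^ (CARD('f) ^ (n * k)) = ev (F k) v" for k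
  proof (induction k arbitrary: v)
    case 0
    have "ev (F 0) v = (\<Sum>j\<le>r. if j = 0 then v else 0)"
      unfolding ev_def F_def by (rule sum.cong) auto
    then show ?case by simp
  next
    case (Suc k)
    let ?tk = "t ^ (CARD('f) ^ (n * k))"
    have F_Suc: "F (Suc k) = pCons 0 (F k) - Polynomial.smult ?tk (F k)"
      by (simp add: F_def mult.commute[of _ "[:_, _:]"])
    have "v ^ (CARD('f) ^ (n * Suc k)) = (L v - t * v) ^ (CARD('f) ^ (n * k))"
      by (simp add: L_def act_phi_T frob_frob add.commute)
    also have "\<dots> = ev (F k) (L v) - ?tk * ev (F k) v"
      using Suc.IH[of v] Suc.IH[of "L v"] Suc.prems by (simp add: frob_diff power_mult_distrib)
    also have "ev (F k) (L v) = ev (pCons 0 (F k)) v"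
    proof -
      obtain r' where r': "r = Suc r'" using r_pos by (cases r) auto
      have "ev (F k) (L v) = (\<Sum>j\<le>r'. coeff (F k) j * (L ^^ j) (L v))"
        unfolding ev_def r' using Suc.prems degF[of k] r' by (simp add: coeff_eq_0)
      also have "\<dots> = ev (pCons 0 (F k)) v"
        unfolding ev_def r' sum.atMost_Suc_shift by (simp add: funpow_swap1)
      finally show ?thesis .
    qed
    also have "ev (pCons 0 (F k)) v - ?tk * ev (F k) v = ev (F (Suc k)) v"
      unfolding F_Suc by (simp add: ev_def sum_subtractf sum_distrib_left algebra_simps)
    finally show ?case .
  qed
  then have "v ^ (CARD('f) ^ (n * r)) = ev (F r) v" by simp
  also have "F r = map_poly to_ac p0"
    unfolding F_def using prod_conjugates[OF coprime_n_r] by simp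
  also have "ev (map_poly to_ac p0) v = twisted_act (\<phi> p0) v"
    using act_phi_expand[of p0 r v] deg0 by (simp add: ev_def L_def coeff_map_poly)
  finally show ?thesis by (simp add: mult.commute)
qed

text \<open>
  The general element of the subring generated by the image of \<open>\<phi>\<close> and \<open>\<tau>\<^sup>r\<close>: exponents of
  \<open>\<tau>\<^sup>r\<close> below \<open>n\<close> suffice because \<open>\<tau>\<^sup>r\<^sup>n = \<phi>(p\<^sub>0)\<close>.
\<close>

definition endo :: "(nat \<Rightarrow> 'f poly) \<Rightarrow> 'f alg_closure poly" where
  "endo a = (\<Sum>i<n. \<phi> (a i) * monom 1 (r * i))"

lemma act_endo: "twisted_act (endo a) v = (\<Sum>i<n. twisted_act (\<phi> (a i)) (v ^ (CARD('f) ^ (r * i))))"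
  by (simp add: endo_def twisted_act_sum twisted_act_mult_monom)

text \<open>The terms of \<open>endo a\<close> have pairwise distinct degrees, because \<open>r\<close> is a unit modulo \<open>n\<close>.\<close>

lemma exponent_inj:
  assumes "n * a + r * i = n * b + r * j" "i < n" "j < n"
  shows "i = j"
proof -
  have le: "x = y" if "n * a' + r * x = n * b' + r * y" "x \<le> y" "y < n" for a' b' x y
  proof -
    have "r * (y - x) = n * (a' - b')"
      using that(1) mult_le_mono2[OF that(2), of r] by (simp add: diff_mult_distrib2)
    then have "n dvd y - x"
      using coprime_n_r by (metis coprime_dvd_mult_right_iff dvd_triv_left)
    then show ?thesis using that(2,3) by (auto dest: dvd_imp_le)
  qed
  show ?thesis using le[of a i b j] le[of b j a i] assms by (cases "i \<le> j") simp_all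
qed

lemma endo_eq_0:
  assumes "endo a = 0" "i < n"
  shows "a i = 0"
proof (rule ccontr)
  assume "a i \<noteq> 0"
  define I where "I = {i. i < n \<and> a i \<noteq> 0}"
  define d where "d i = n * degree (a i) + r * i" for i
  have I: "finite I" "i \<in> I" using assms \<open>a i \<noteq> 0\<close> by (simp_all add: I_def)
  \<comment> \<open>The term of largest degree cannot be cancelled by the others.\<close>
  define k where "k = (ARG_MAX d i. i \<in> I)"
  have bd: "\<forall>y. y \<in> I \<longrightarrow> d y < Suc (Max (d ` I))" using I by (simp add: less_Suc_eq_le)
  have k: "k \<in> I" "\<And>j. j \<in> I \<Longrightarrow> d j \<le> d k"
    using arg_max_nat_lemma[of "\<lambda>i. i \<in> I" i d, OF I(2) bd] unfolding k_def by auto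
  have "coeff (\<phi> (a j) * monom 1 (r * j)) (d k) =
    (if j = k then to_ac (lead_coeff (a k)) else 0)" if j: "j < n" for j
  proof (cases "a j = 0")
    case True
    then show ?thesis using k(1) by (auto simp: phi_0 I_def)
  next
    case False
    then have dj: "d j \<le> d k" using j k(2) by (simp add: I_def)
    have c: "coeff (\<phi> (a j) * monom 1 (r * j)) (d k) =
      (if d k < r * j then 0 else coeff (\<phi> (a j)) (d k - r * j))"
      by (simp add: mult.commute[of "\<phi> (a j)"] coeff_monom_mult)
    show ?thesis
    proof (cases "j = k")
      case True
      then show ?thesis unfolding c using degree_phi[OF False] by (simp add: d_def)
    next
      case jk: False
      have "d j \<noteq> d k"
        using exponent_inj[of "degree (a j)" j "degree (a k)" k] j k(1) jk
        by (auto simp: d_def I_def)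
      then have "d k - r * j > degree (\<phi> (a j))"
        using dj degree_phi(1)[OF False] by (simp add: d_def)
      then show ?thesis unfolding c using jk by (simp add: coeff_eq_0)
    qed
  qed
  then have "coeff (endo a) (d k) = (\<Sum>j<n. if j = k then to_ac (lead_coeff (a k)) else 0)"
    unfolding endo_def coeff_sum by (intro sum.cong) auto
  then show False using assms(1) k(1) by (simp add: I_def)
qed

text \<open>
  Comparing coefficients of \<open>\<tau>\<^sup>i\<close> in \<open>G \<phi>(T) = \<phi>(T) G\<close> gives
  \<open>g\<^sub>i (t\<^bsup>q^i\<^esup> - t) = g\<^bsub>i-n\<^esub>\<^bsup>q^n\<^esup> - g\<^bsub>i-n\<^esub>\<close>. Going down from \<open>i\<close> in steps of \<open>n\<close> along nonzero
  coefficients, the last index \<open>j\<close> must satisfy \<open>t\<^bsup>q^j\<^esup> = t\<close>, that is \<open>r | j\<close>; so every exponent in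
  \<open>G\<close> has the form \<open>r j + n a\<close>. The same equation at \<open>i = deg G + n\<close> shows that the leading
  coefficient is fixed by the \<open>n\<close>-th power of Frobenius; all coefficients are fixed by the \<open>r\<close>-th,
  so it lies in the base field. There is therefore an element of the form \<open>endo b\<close> with the
  leading term of \<open>G\<close>, and subtracting it lowers the degree.
\<close>

lemma commutant:
  assumes "\<And>v. twisted_act G (twisted_act (\<phi> [:0, 1:]) v) = twisted_act (\<phi> [:0, 1:]) (twisted_act G v)"
    and "\<And>i. coeff G i \<in> frob_fixed r"
  obtains b where "G = endo b"
proof -
  have "\<exists>b. G = endo b"
    using assms
  proof (induction "degree G" arbitrary: G rule: less_induct)
    case less
    show ?case
    proof (cases "G = 0")
      case True
      have "endo (\<lambda>_. 0) = 0" by (simp add: endo_def phi_0)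
      then show ?thesis using True by metis
    next
      case False
      define g where "g = coeff G"
      define N where "N = degree G"
      have "twisted_mult G (\<phi> [:0, 1:]) = twisted_mult (\<phi> [:0, 1:]) G"
        by (rule twisted_act_eqI) (simp add: twisted_act_mult less.prems)
      then have eq: "coeff (twisted_mult G (\<phi> [:0, 1:])) i =
          coeff (twisted_mult (\<phi> [:0, 1:]) G) i" for i by simp
      have c1: "coeff (twisted_mult G (\<phi> [:0, 1:])) i =
         g i * t ^ (CARD('f) ^ i) + (if n \<le> i then g (i - n) else 0)" for i
      proof -
        have "coeff (twisted_mult G (\<phi> [:0, 1:])) i =
         (\<Sum>j\<le>i. (if j = i then g i * t ^ (CARD('f) ^ i) else 0) + (if j = i - n then (if n \<le> i then g (i - n) else 0) else 0))"
          unfolding coeff_twisted_mult coeff_phi_T g_def[symmetric]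
          by (rule sum.cong) (use n_pos in \<open>auto simp: zero_power\<close>)
        then show ?thesis by (simp add: sum.distrib)
      qed
      have c2: "coeff (twisted_mult (\<phi> [:0, 1:]) G) i =
         t * g i + (if n \<le> i then g (i - n) ^ (CARD('f) ^ n) else 0)" for i
      proof -
        have "coeff (twisted_mult (\<phi> [:0, 1:]) G) i =
         (\<Sum>j\<le>i. (if j = 0 then t * g i else 0) + (if j = n then (if n \<le> i then g (i - n) ^ (CARD('f) ^ n) else 0) else 0))"
          unfolding coeff_twisted_mult coeff_phi_T g_def[symmetric]
          by (rule sum.cong) (use n_pos in auto)
        then show ?thesis by (simp add: sum.distrib)
      qed
      note rec = eq[unfolded c1 c2]
      have g_fixed: "g i ^ (CARD('f) ^ r) = g i" for i
        using less.prems(2)[of i] by (simp add: g_def frob_fixed_def)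
      have "g N ^ (CARD('f) ^ n) = g N"
        using rec[of "N + n"] n_pos by (simp add: g_def N_def coeff_eq_0)
      then have "g N ^ (CARD('f) ^ gcd n r) = g N" by (rule frob_period_gcd) (rule g_fixed)
      then have "g N \<in> range to_ac" using coprime_n_r by (intro frob_fixed_1) simp
      then obtain \<gamma> where \<gamma>: "g N = to_ac \<gamma>" by auto
      have gN: "g N \<noteq> 0" using False by (simp add: g_def N_def)
      have "g i \<noteq> 0 \<Longrightarrow> \<exists>j a. i = r * j + n * a" for i
      proof (induction i rule: less_induct)
        case (less i)
        show ?case
        proof (cases "t ^ (CARD('f) ^ i) = t")
          case True
          then obtain j where "i = r * j" using frob_t_eq_imp_dvd by blast
          then show ?thesis by (intro exI[of _ j] exI[of _ 0]) simp
        next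
          case False
          have "n \<le> i \<and> g (i - n) \<noteq> 0"
          proof (rule ccontr)
            assume "\<not> (n \<le> i \<and> g (i - n) \<noteq> 0)"
            then have "(if n \<le> i then g (i - n) else 0) = 0" "(if n \<le> i then g (i - n) ^ (CARD('f) ^ n) else 0) = 0"
              by (auto simp: zero_power)
            then have "g i * t ^ (CARD('f) ^ i) = t * g i"
              using rec[of i] by (simp only: add_0_right)
            then show False using False less.prems by simp
          qed
          then obtain j a where "i - n = r * j + n * a" using less.IH[of "i - n"] n_pos by auto
          then have "i = r * j + n * Suc a"
            using \<open>n \<le> i \<and> _\<close> unfolding mult_Suc_right by linarith
          then show ?thesis by blast
        qed
      qed
      from this[OF gN] obtain j a where N: "N = r * j + n * a" by blast
      define j0 where "j0 = j mod n"
      \<comment> \<open>Reduce the exponent \<open>j\<close> of \<open>\<tau>\<^sup>r\<close> modulo \<open>n\<close>, using that \<open>\<tau>\<^sup>r\<^sup>n\<close> is the action of \<open>p0\<close>.\<close>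
      define b0 where "b0 = monom \<gamma> a * p0 ^ (j div n)"
      have j0: "j0 < n" using n_pos by (simp add: j0_def)
      have b0: "b0 \<noteq> 0" using \<gamma> gN monic0 by (auto simp: b0_def)
      have \<gamma>0: "\<gamma> \<noteq> 0" using \<gamma> gN by auto
      have deg_b0: "degree b0 = a + r * (j div n)"
      proof -
        have "p0 \<noteq> 0" using irr0 by auto
        then show ?thesis unfolding b0_def using \<gamma>0 deg0
          by (subst degree_mult_eq) (auto simp: degree_monom_eq degree_power_eq)
      qed
      have lead_b0: "lead_coeff b0 = \<gamma>"
        unfolding b0_def lead_coeff_mult lead_coeff_power monic0
        using \<gamma>0 by (simp add: degree_monom_eq)
      define h where "h = \<phi> b0 * monom 1 (r * j0)"
      have N': "N = n * degree b0 + r * j0"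
      proof -
        have "r * j = r * (n * (j div n) + j0)" by (simp add: j0_def)
        then show ?thesis unfolding N deg_b0 by (simp add: algebra_simps)
      qed
      have h_coeff: "coeff h i = (if i < r * j0 then 0 else coeff (\<phi> b0) (i - r * j0))" for i
        by (simp add: h_def mult.commute[of "\<phi> b0"] coeff_monom_mult)
      have h_lead: "coeff h N = g N"
        using degree_phi[OF b0] lead_b0 by (simp add: h_coeff N' \<gamma>[unfolded N'])
      have h_0: "coeff h i = 0" if "i > N" for i
        using that degree_phi(1)[OF b0] by (simp add: h_coeff N' coeff_eq_0)
      have h_act: "twisted_act h v = twisted_act (\<phi> b0) (v ^ (CARD('f) ^ (r * j0)))" for v
        by (simp add: h_def twisted_act_mult_monom)
      have h_endo: "endo (\<lambda>i. b i + (if i = j0 then b0 else 0)) = endo b + h" for b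
      proof -
        have "endo (\<lambda>i. b i + (if i = j0 then b0 else 0)) = endo b + (\<Sum>i<n. if i = j0 then h else 0)"
          unfolding endo_def sum.distrib[symmetric]
          by (rule sum.cong) (simp_all add: phi_add phi_0 h_def algebra_simps)
        then show ?thesis using j0 by simp
      qed
      show ?thesis
      proof (cases "G - h = 0")
        case True
        have "endo (\<lambda>_. 0) = 0" by (simp add: endo_def phi_0)
        then show ?thesis using True h_endo[of "\<lambda>_. 0"] by (metis add_0 eq_iff_diff_eq_0)
      next
        case Gh: False
        have small: "coeff (G - h) i = 0" if "i \<ge> N" for i
          using that h_lead h_0[of i] by (cases "i = N") (simp_all add: g_def N_def coeff_eq_0)
        have "degree (G - h) < degree G"
          unfolding N_def[symmetric] using small Gh by (intro degree_lessI) auto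
        moreover have "twisted_act (G - h) (twisted_act (\<phi> [:0, 1:]) v) =
            twisted_act (\<phi> [:0, 1:]) (twisted_act (G - h) v)" for v
          by (simp add: twisted_act_diff twisted_act_arg_diff less.prems(1) h_act
              act_phi_frob[symmetric] act_phi_commute[of b0])
        moreover have "coeff (G - h) i \<in> frob_fixed r" for i
          using less.prems(2)[of i] phi_fixed[of b0 "i - r * j0"]
          by (simp add: frob_fixed_def frob_diff h_coeff zero_power)
        ultimately obtain b where "G - h = endo b" using less.hyps by blast
        then have "G = endo (\<lambda>i. b i + (if i = j0 then b0 else 0))"
          unfolding h_endo by (simp add: diff_eq_eq)
        then show ?thesis by blast
      qed
    qed
  qed
  then show ?thesis using that by blast
qed

text \<open>The constant coefficient of \<open>\<phi> p\<close> is \<open>p(t)\<close>, so the operator is separable unless \<open>p0\<close> divides \<open>p\<close>.\<close>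

lemma card_torsion:
  assumes "\<not> p0 dvd p"
  shows "finite {v. twisted_act (\<phi> p) v = 0}"
    and "card {v. twisted_act (\<phi> p) v = 0} = CARD('f) ^ (n * degree p)"
proof -
  have "p \<noteq> 0" using assms by auto
  show "finite {v. twisted_act (\<phi> p) v = 0}"
    by (rule card_twisted_kernel_le) (simp add: phi_eq_0_iff \<open>p \<noteq> 0\<close>)
  have "coeff (\<phi> p) 0 \<noteq> 0"
    using assms root_imp_irreducible_dvd[OF irr0 root0] by (auto simp: coeff_phi_0)
  then show "card {v. twisted_act (\<phi> p) v = 0} = CARD('f) ^ (n * degree p)"
    using degree_phi(1)[OF \<open>p \<noteq> 0\<close>] by (simp add: card_twisted_kernel)
qed

text \<open>
  A nonzero remainder of \<open>endo a\<close> modulo \<open>\<phi> p\<close> would kill more elements than its degree allows,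
  so \<open>endo a = G \<phi>(p)\<close>. As \<open>\<phi>(p)\<close> is surjective and commutes with \<open>\<phi>(T)\<close> and \<open>\<tau>\<^sup>r\<close>, the quotient
  \<open>G\<close> commutes with them too and equals some \<open>endo b\<close>; uniqueness of the coefficients gives
  \<open>a i = b i * p\<close>.
\<close>

lemma endo_kills_torsion_imp_dvd:
  assumes "\<not> p0 dvd p"
    and kill: "\<And>v. twisted_act (\<phi> p) v = 0 \<Longrightarrow> twisted_act (endo a) v = 0"
    and "i < n"
  shows "p dvd a i"
proof -
  let ?T = "\<phi> [:0, 1:]"
  have P0: "\<phi> p \<noteq> 0" using assms(1) by (auto simp: phi_eq_0_iff)
  obtain G R where GR: "endo a = twisted_mult G (\<phi> p) + R"
    "R = 0 \<or> degree R < degree (\<phi> p)"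
    using twisted_right_division[OF P0] by blast
  have "R = 0"
  proof (rule ccontr)
    assume R: "R \<noteq> 0"
    have "{v. twisted_act (\<phi> p) v = 0} \<subseteq> {v. twisted_act R v = 0}"
    proof clarify
      fix v assume "twisted_act (\<phi> p) v = 0"
      then show "twisted_act R v = 0"
        using kill[of v] by (simp add: GR(1) twisted_act_add twisted_act_mult)
    qed
    then have "CARD('f) ^ degree (\<phi> p) \<le> CARD('f) ^ degree R"
      using card_twisted_kernel_le[OF R] card_torsion(2)[OF assms(1)] degree_phi(1)[of p] P0
      by (metis (no_types, lifting) card_mono order.trans phi_eq_0_iff)
    then show False using R GR(2) card_field_gt_1[where 'f='f] by (simp add: power_increasing_iff)
  qed
  then have act: "twisted_act (endo a) v = twisted_act G (twisted_act (\<phi> p) v)" for v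
    by (simp add: GR twisted_act_mult)
  have "twisted_act G (twisted_act ?T w) = twisted_act ?T (twisted_act G w)" for w
  proof -
    obtain v where v: "twisted_act (\<phi> p) v = w" using twisted_act_surj[OF P0] by blast
    have "twisted_act G (twisted_act ?T w) = twisted_act (endo a) (twisted_act ?T v)"
      by (simp add: act v[symmetric] act_phi_commute[of _ p])
    also have "\<dots> = twisted_act ?T (twisted_act (endo a) v)"
      by (simp add: act_endo act_phi_frob[symmetric] act_phi_commute[of "a _"] twisted_act_arg_sum)
    finally show ?thesis by (simp add: act v)
  qed
  moreover have "coeff G i \<in> frob_fixed r" for i
  proof -
    have "twisted_act G (w ^ (CARD('f) ^ r)) = twisted_act G w ^ (CARD('f) ^ r)" for w
    proof -
      obtain v where v: "twisted_act (\<phi> p) v = w" using twisted_act_surj[OF P0] by blast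
      have "twisted_act G (w ^ (CARD('f) ^ r)) = twisted_act (endo a) (v ^ (CARD('f) ^ r))"
        using act_phi_frob[of p v 1] by (simp add: act v[symmetric])
      also have "\<dots> = twisted_act (endo a) v ^ (CARD('f) ^ r)"
        unfolding act_endo frob_sum
      proof (rule sum.cong)
        fix i
        have "(v ^ (CARD('f) ^ r)) ^ (CARD('f) ^ (r * i)) = (v ^ (CARD('f) ^ (r * i))) ^ (CARD('f) ^ r)"
          by (simp add: frob_frob add.commute)
        then show "twisted_act (\<phi> (a i)) ((v ^ (CARD('f) ^ r)) ^ (CARD('f) ^ (r * i))) =
            twisted_act (\<phi> (a i)) (v ^ (CARD('f) ^ (r * i))) ^ (CARD('f) ^ r)"
          using act_phi_frob[of "a i" "v ^ (CARD('f) ^ (r * i))" 1] by simp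
      qed simp
      finally show ?thesis by (simp add: act v)
    qed
    then have "twisted_mult G (monom 1 r) = twisted_mult (monom 1 r) G"
      by (intro twisted_act_eqI) (simp add: twisted_act_mult twisted_act_monom)
    then have "coeff (twisted_mult G (monom 1 r)) (i + r) =
      coeff (twisted_mult (monom 1 r) G) (i + r)" by simp
    moreover have "coeff (twisted_mult G (monom 1 r)) (i + r) =
      (\<Sum>j\<le>i + r. if j = i then coeff G i else 0)"
      unfolding coeff_twisted_mult by (rule sum.cong) (auto simp: zero_power)
    moreover have "coeff (twisted_mult (monom 1 r) G) (i + r) =
      (\<Sum>j\<le>i + r. if j = r then coeff G i ^ (CARD('f) ^ r) else 0)"
      unfolding coeff_twisted_mult by (rule sum.cong) auto
    ultimately show ?thesis by (simp add: frob_fixed_def)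
  qed
  ultimately obtain b where b: "G = endo b" using commutant by blast
  have "endo (\<lambda>i. a i - b i * p) = 0"
  proof (rule twisted_act_eqI)
    fix v
    have "twisted_act (endo (\<lambda>i. a i - b i * p)) v = twisted_act (endo a) v -
      (\<Sum>i<n. twisted_act (\<phi> (b i)) (twisted_act (\<phi> p) v ^ (CARD('f) ^ (r * i))))"
      by (simp add: act_endo phi_diff twisted_act_diff sum_subtractf act_phi_mult act_phi_frob)
    then show "twisted_act (endo (\<lambda>i. a i - b i * p)) v = twisted_act 0 v"
      by (simp add: act) (simp add: b act_endo)
  qed
  from endo_eq_0[OF this \<open>i < n\<close>] show ?thesis by (simp add: dvd_def mult.commute)
qed

end

section \<open>Cyclic vectors\<close>

lemma (in cring) ideal_annihilator_elem:
  assumes y: "y \<in> carrier R"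
  shows "ideal {x \<in> carrier R. x \<otimes> y = \<zero>} R"
proof (rule idealI)
  show "ring R" by (rule ring_axioms)
  show "subgroup {x \<in> carrier R. x \<otimes> y = \<zero>} (add_monoid R)"
    by (rule subgroup.intro) (use y in \<open>auto simp: l_distr l_minus a_inv_def[symmetric]\<close>)
next
  fix a x assume "a \<in> {x \<in> carrier R. x \<otimes> y = \<zero>}" "x \<in> carrier R"
  then show "x \<otimes> a \<in> {x \<in> carrier R. x \<otimes> y = \<zero>}" "a \<otimes> x \<in> {x \<in> carrier R. x \<otimes> y = \<zero>}"
    using y by (simp_all add: m_assoc m_comm[of a x])
qed

lemma (in cring) card_eq_annihilator_times_principal:
  assumes fin: "finite (carrier R)" and y: "y \<in> carrier R"
  shows "card (carrier R) = card {x \<in> carrier R. x \<otimes> y = \<zero>} * card (PIdl y)"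
proof -
  let ?A = "{x \<in> carrier R. x \<otimes> y = \<zero>}"
  define s where "s b = (SOME x. x \<in> carrier R \<and> b = x \<otimes> y)" for b
  have s: "s b \<in> carrier R \<and> b = s b \<otimes> y" if "b \<in> PIdl y" for b
    unfolding s_def by (rule someI_ex) (use that in \<open>auto simp: cgenideal_def\<close>)
  have "bij_betw (\<lambda>(x, b). x \<oplus> s b) (?A \<times> (PIdl y)) (carrier R)"
  proof (rule bij_betw_byWitness[where f' = "\<lambda>x. (x \<ominus> s (x \<otimes> y), x \<otimes> y)"])
    have mem: "x \<otimes> y \<in> PIdl y" if "x \<in> carrier R" for x using that by (auto simp: cgenideal_def)
    show "\<forall>a\<in>?A \<times> (PIdl y). (\<lambda>x. (x \<ominus> s (x \<otimes> y), x \<otimes> y)) (case a of (x, b) \<Rightarrow> x \<oplus> s b) = a"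
    proof clarify
      fix x b assume x: "x \<in> carrier R" "x \<otimes> y = \<zero>" and b: "b \<in> PIdl y"
      have 1: "(x \<oplus> s b) \<otimes> y = b" using x s[OF b] y by (metis l_distr l_zero m_closed)
      have 2: "x \<oplus> s b \<ominus> s b = x" using x s[OF b] by algebra
      show "((x \<oplus> s b) \<ominus> s ((x \<oplus> s b) \<otimes> y) = x) \<and> ((x \<oplus> s b) \<otimes> y = b)"
        using 1 2 by simp
    qed
    show "\<forall>a'\<in>carrier R. (case (a' \<ominus> s (a' \<otimes> y), a' \<otimes> y) of (x, b) \<Rightarrow> x \<oplus> s b) = a'"
    proof clarify
      fix x assume x: "x \<in> carrier R"
      then show "(x \<ominus> s (x \<otimes> y)) \<oplus> s (x \<otimes> y) = x" using s[OF mem[OF x]] by algebra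
    qed
    show "(\<lambda>(x, b). x \<oplus> s b) ` (?A \<times> (PIdl y)) \<subseteq> carrier R"
      using s by auto
    show "(\<lambda>x. (x \<ominus> s (x \<otimes> y), x \<otimes> y)) ` carrier R \<subseteq> ?A \<times> (PIdl y)"
    proof (rule image_subsetI)
      fix x assume x: "x \<in> carrier R"
      have sx: "s (x \<otimes> y) \<in> carrier R" "x \<otimes> y = s (x \<otimes> y) \<otimes> y" using s[OF mem[OF x]] by blast+
      have "(x \<ominus> s (x \<otimes> y)) \<otimes> y = x \<otimes> y \<ominus> s (x \<otimes> y) \<otimes> y" using x sx(1) y by algebra
      also have "\<dots> = \<zero>" using x y sx(2) by (metis m_closed r_neg minus_eq)
      finally show "(x \<ominus> s (x \<otimes> y), x \<otimes> y) \<in> ?A \<times> (PIdl y)"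
        using x sx(1) mem[OF x] by simp
    qed
  qed
  from bij_betw_same_card[OF this] show ?thesis by (simp add: card_cartesian_product)
qed

text \<open>The powers of \<open>g\<close> are eventually periodic; a multiple of the period beyond the pre-period does it.\<close>

lemma (in monoid) finite_idempotent_power:
  assumes fin: "finite (carrier G)" and g: "g \<in> carrier G"
  obtains k :: nat where "k > 0" "g [^] k \<otimes> g [^] k = g [^] k"
proof -
  have "\<not> inj (\<lambda>i::nat. g [^] i)"
    using finite_subset[OF _ fin, of "range (\<lambda>i::nat. g [^] i)"] g by (auto dest: range_inj_infinite)
  then obtain i j :: nat where ij: "i < j" "g [^] i = g [^] j"
    unfolding inj_def by (metis linorder_neqE_nat)
  define d where "d = j - i"
  have step: "g [^] (a + d) = g [^] a" if "a \<ge> i" for a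
  proof -
    have "g [^] (a + d) = g [^] (a - i) \<otimes> g [^] j" using that ij(1) g by (simp add: nat_pow_mult d_def)
    also have "\<dots> = g [^] a" using that g by (simp add: ij(2)[symmetric] nat_pow_mult)
    finally show ?thesis .
  qed
  have steps: "g [^] (a + d * m) = g [^] a" if "a \<ge> i" for a m
  proof (induction m)
    case (Suc m)
    then show ?case using step[of "a + d * m"] that by (simp add: algebra_simps)
  qed simp
  define k where "k = d * Suc i"
  have "d > 0" using ij by (simp add: d_def)
  then have "k > 0" "k \<ge> i" by (simp_all add: k_def trans_le_add2)
  then show ?thesis using steps[of k "Suc i"] g by (intro that[of k]) (simp_all add: nat_pow_mult k_def)
qed

text \<open>
  Choose \<open>v\<close> with the smallest annihilator, suppose it is nonzero, and choose \<open>y\<close> in it generating a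
  minimal nonzero ideal. Faithfulness gives \<open>w\<close> with \<open>y w \<noteq> 0\<close>. The annihilator of \<open>y\<close> is
  generated by some \<open>g\<close>; let \<open>e\<^sub>0\<close> be an idempotent power of \<open>g\<close> and \<open>e = 1 - e\<^sub>0\<close>, so that \<open>e\<close>
  cuts out the local component of the ring on which \<open>y\<close> lives. Then \<open>v' = e\<^sub>0 v + e w\<close> has a smaller
  annihilator than \<open>v\<close>. Indeed \<open>y v' = y w \<noteq> 0\<close>; and if \<open>s v' = 0\<close>, then \<open>s e\<^sub>0 v = 0\<close> and
  \<open>s e w = 0\<close>. In the local component every nonzero ideal contains \<open>y\<close>, so \<open>s e \<noteq> 0\<close> would give
  \<open>y w = 0\<close>; hence \<open>s e = 0\<close> and \<open>s v = s e\<^sub>0 v = 0\<close>.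
\<close>

lemma (in module) faithful_imp_cyclic_vector:
  assumes finR: "finite (carrier R)"
    and principal: "\<And>I. ideal I R \<Longrightarrow> \<exists>g\<in>carrier R. I = PIdl\<^bsub>R\<^esub> g"
    and faithful: "\<And>a. a \<in> carrier R \<Longrightarrow> (\<And>v. v \<in> carrier M \<Longrightarrow> a \<odot>\<^bsub>M\<^esub> v = \<zero>\<^bsub>M\<^esub>) \<Longrightarrow> a = \<zero>"
  obtains v where "v \<in> carrier M" "\<And>a. a \<in> carrier R \<Longrightarrow> a \<odot>\<^bsub>M\<^esub> v = \<zero>\<^bsub>M\<^esub> \<Longrightarrow> a = \<zero>"
proof -
  define ann where "ann v = {a \<in> carrier R. a \<odot>\<^bsub>M\<^esub> v = \<zero>\<^bsub>M\<^esub>}" for v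
  define v where "v = (ARG_MIN (\<lambda>v. card (ann v)) v. v \<in> carrier M)"
  have v: "v \<in> carrier M" and vmin: "\<And>w. w \<in> carrier M \<Longrightarrow> card (ann v) \<le> card (ann w)"
    unfolding v_def
    using arg_min_nat_lemma[of "\<lambda>v. v \<in> carrier M" "\<zero>\<^bsub>M\<^esub>" "\<lambda>v. card (ann v)"] by auto
  have fin_ann: "finite (ann w)" for w using finR by (simp add: ann_def)
  have "a = \<zero>" if "a \<in> ann v" for a
  proof (rule ccontr)
    assume "a \<noteq> \<zero>"
    define y where "y = (ARG_MIN (\<lambda>y. card (PIdl\<^bsub>R\<^esub> y)) y. y \<in> ann v \<and> y \<noteq> \<zero>)"
    have y: "y \<in> ann v" "y \<noteq> \<zero>"
      and ymin: "\<And>z. z \<in> ann v \<Longrightarrow> z \<noteq> \<zero> \<Longrightarrow> card (PIdl\<^bsub>R\<^esub> y) \<le> card (PIdl\<^bsub>R\<^esub> z)"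
      unfolding y_def
      using arg_min_nat_lemma[of "\<lambda>y. y \<in> ann v \<and> y \<noteq> \<zero>" a "\<lambda>y. card (PIdl\<^bsub>R\<^esub> y)"] that \<open>a \<noteq> \<zero>\<close> by auto
    have yR: "y \<in> carrier R" and yv: "y \<odot>\<^bsub>M\<^esub> v = \<zero>\<^bsub>M\<^esub>" using y by (simp_all add: ann_def)
    obtain w where w: "w \<in> carrier M" "y \<odot>\<^bsub>M\<^esub> w \<noteq> \<zero>\<^bsub>M\<^esub>"
      using faithful[OF yR] y(2) by blast
    obtain g where g: "g \<in> carrier R" and Ann_y: "{x \<in> carrier R. x \<otimes> y = \<zero>} = PIdl\<^bsub>R\<^esub> g"
      using principal[OF R.ideal_annihilator_elem[OF yR]] by blast
    have PIdl_sub: "PIdl\<^bsub>R\<^esub> x \<subseteq> carrier R" if "x \<in> carrier R" for x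
      using that by (auto simp: cgenideal_def)
    have fin_PIdl: "finite (PIdl\<^bsub>R\<^esub> x)" if "x \<in> carrier R" for x
      using PIdl_sub[OF that] finR finite_subset by blast
    have gy: "g \<otimes> y = \<zero>" using Ann_y R.cgenideal_self[OF g] by blast
    define A where "A = {x \<in> carrier R. x \<otimes> g = \<zero>}"
    \<comment> \<open>Both \<open>card A\<close> and \<open>card (PIdl y)\<close> are the index of the ideal generated by \<open>g\<close>.\<close>
    have "PIdl\<^bsub>R\<^esub> y = A"
    proof (rule card_subset_eq)
      show "finite A" using finR by (simp add: A_def)
      show "PIdl\<^bsub>R\<^esub> y \<subseteq> A"
        using yR g gy by (auto simp: A_def cgenideal_def R.m_assoc R.m_comm[of y g])
      have "card (carrier R) = card (PIdl\<^bsub>R\<^esub> g) * card (PIdl\<^bsub>R\<^esub> y)"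
        using R.card_eq_annihilator_times_principal[OF finR yR] by (simp only: Ann_y)
      moreover have "card (carrier R) = card (PIdl\<^bsub>R\<^esub> g) * card A"
        using R.card_eq_annihilator_times_principal[OF finR g] by (simp only: A_def mult.commute)
      moreover have "card (PIdl\<^bsub>R\<^esub> g) > 0"
        using fin_PIdl[OF g] R.cgenideal_self[OF g] by (auto simp: card_gt_0_iff)
      ultimately show "card (PIdl\<^bsub>R\<^esub> y) = card A" by (metis mult_left_cancel less_irrefl)
    qed
    then have socle: "y \<in> PIdl\<^bsub>R\<^esub> z" if z: "z \<in> carrier R" "z \<noteq> \<zero>" "z \<otimes> g = \<zero>" for z
    proof -
      have "z \<in> PIdl\<^bsub>R\<^esub> y" using z \<open>PIdl\<^bsub>R\<^esub> y = A\<close> by (simp add: A_def)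
      then obtain b where b: "b \<in> carrier R" "z = b \<otimes> y" by (auto simp: cgenideal_def)
      then have "z \<in> ann v" using yR v yv by (simp add: ann_def smult_assoc1)
      moreover have "PIdl\<^bsub>R\<^esub> z \<subseteq> PIdl\<^bsub>R\<^esub> y"
      proof
        fix x assume "x \<in> PIdl\<^bsub>R\<^esub> z"
        then obtain e where "e \<in> carrier R" "x = e \<otimes> z" by (auto simp: cgenideal_def)
        then have "x = (e \<otimes> b) \<otimes> y" "e \<otimes> b \<in> carrier R" using b yR by (simp_all add: R.m_assoc)
        then show "x \<in> PIdl\<^bsub>R\<^esub> y" by (auto simp: cgenideal_def)
      qed
      ultimately have "PIdl\<^bsub>R\<^esub> z = PIdl\<^bsub>R\<^esub> y"
        using ymin[of z] z(2) fin_PIdl[OF yR] by (intro card_seteq) auto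
      then show ?thesis using R.cgenideal_self[OF yR] by simp
    qed
    obtain k :: nat where k: "k > 0" "g [^] k \<otimes> g [^] k = g [^] k"
      using R.finite_idempotent_power[OF finR g] by blast
    define e0 where "e0 = g [^] k"
    define e where "e = \<one> \<ominus> e0"
    have e0: "e0 \<in> carrier R" "e0 \<otimes> e0 = e0" using g k by (simp_all add: e0_def)
    have e: "e \<in> carrier R" using e0 by (simp add: e_def)
    have e_e0: "e \<otimes> e0 = \<zero>"
    proof -
      have "e \<otimes> e0 = e0 \<ominus> e0 \<otimes> e0" unfolding e_def using e0(1) by algebra
      then show ?thesis using e0 by (simp add: R.minus_eq R.r_neg)
    qed
    have e0y: "e0 \<otimes> y = \<zero>"
    proof -
      obtain k' where "k = Suc k'" using k by (cases k) auto
      then show ?thesis using g yR gy by (simp add: e0_def R.m_assoc)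
    qed
    have decomp: "a = a \<otimes> e0 \<oplus> a \<otimes> e" if "a \<in> carrier R" for a
      unfolding e_def using that e0(1) by algebra
    define v' where "v' = e0 \<odot>\<^bsub>M\<^esub> v \<oplus>\<^bsub>M\<^esub> e \<odot>\<^bsub>M\<^esub> w"
    have v': "v' \<in> carrier M" using e0 e v w by (simp add: v'_def)
    have "ann v' \<subset> ann v"
    proof
      have "y \<odot>\<^bsub>M\<^esub> v' = (e0 \<otimes> y) \<odot>\<^bsub>M\<^esub> v \<oplus>\<^bsub>M\<^esub> (y \<otimes> e) \<odot>\<^bsub>M\<^esub> w"
        unfolding v'_def using yR e0 e v w
        by (simp add: smult_r_distr smult_assoc1[symmetric] R.m_comm[OF e0(1) yR])
      also have "y \<otimes> e = y"
      proof -
        have "y \<otimes> e0 = \<zero>" using e0y R.m_comm[OF e0(1) yR] by simp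
        then have "y = \<zero> \<oplus> y \<otimes> e" using decomp[OF yR] by simp
        then show ?thesis using e yR by (metis R.l_zero R.m_closed)
      qed
      finally have "y \<odot>\<^bsub>M\<^esub> v' = y \<odot>\<^bsub>M\<^esub> w" using e0y v w yR by simp
      then have "y \<notin> ann v'" using w(2) by (simp add: ann_def)
      then show "ann v' \<noteq> ann v" using y(1) by blast
      show "ann v' \<subseteq> ann v"
      proof
        fix s assume "s \<in> ann v'"
        then have s: "s \<in> carrier R" "s \<odot>\<^bsub>M\<^esub> v' = \<zero>\<^bsub>M\<^esub>" by (simp_all add: ann_def)
        have part: "(x \<otimes> s \<otimes> e0) \<odot>\<^bsub>M\<^esub> v \<oplus>\<^bsub>M\<^esub> (x \<otimes> s \<otimes> e) \<odot>\<^bsub>M\<^esub> w = \<zero>\<^bsub>M\<^esub>" if x: "x \<in> carrier R" for x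
        proof -
          have "x \<odot>\<^bsub>M\<^esub> (s \<odot>\<^bsub>M\<^esub> v') = \<zero>\<^bsub>M\<^esub>" using s x by simp
          then show ?thesis using x s(1) e0 e v w v'
            by (simp add: v'_def smult_r_distr smult_assoc1[symmetric] R.m_assoc)
        qed
        have E1: "e0 \<otimes> s \<otimes> e0 = s \<otimes> e0" using e0 s(1) by (metis R.m_comm R.m_assoc)
        have E2: "e0 \<otimes> s \<otimes> e = \<zero>" using e0(1) e e_e0 s(1) by (metis R.m_comm R.m_assoc R.r_null)
        have se0: "(s \<otimes> e0) \<odot>\<^bsub>M\<^esub> v = \<zero>\<^bsub>M\<^esub>"
          using part[OF e0(1)] unfolding E1 E2 using s(1) e0(1) v w by simp
        then have sew: "(s \<otimes> e) \<odot>\<^bsub>M\<^esub> w = \<zero>\<^bsub>M\<^esub>"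
          using part[OF R.one_closed] s(1) e0(1) e v w by simp
        have "s \<otimes> e = \<zero>"
        proof (rule ccontr)
          assume ne: "s \<otimes> e \<noteq> \<zero>"
          \<comment> \<open>The last nonzero element of the sequence \<open>s e, s e g, s e g\<^sup>2, \<dots>\<close> is killed by \<open>g\<close>.\<close>
          define Q where "Q j \<longleftrightarrow> s \<otimes> e \<otimes> g [^] j = \<zero>" for j :: nat
          have "Q k" unfolding Q_def e0_def[symmetric]
            using s(1) e e0(1) e_e0 by (simp add: R.m_assoc)
          moreover have "\<not> Q 0" using ne s(1) e by (simp add: Q_def)
          ultimately obtain j where j: "\<not> Q j" "Q (Suc j)"
            using ex_least_nat_less[of Q k] by blast
          define z where "z = s \<otimes> e \<otimes> g [^] j"
          have z: "z \<in> carrier R" "z \<noteq> \<zero>" "z \<otimes> g = \<zero>"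
            using j s(1) e g by (simp_all add: z_def Q_def R.m_assoc)
          obtain b where b: "b \<in> carrier R" "y = b \<otimes> z" using socle[OF z] by (auto simp: cgenideal_def)
          then have "y = (b \<otimes> g [^] j) \<otimes> (s \<otimes> e)"
            using s(1) e g by (simp add: z_def R.m_assoc R.m_comm R.m_lcomm)
          then have "y \<odot>\<^bsub>M\<^esub> w = (b \<otimes> g [^] j) \<odot>\<^bsub>M\<^esub> ((s \<otimes> e) \<odot>\<^bsub>M\<^esub> w)"
            using b(1) g s(1) e w(1) by (simp add: smult_assoc1)
          then show False using w sew b(1) g by simp
        qed
        then have "s = s \<otimes> e0" using decomp[OF s(1)] s(1) e0(1) by simp
        then show "s \<in> ann v" using se0 s(1) by (simp add: ann_def)
      qed
    qed
    then have "card (ann v') < card (ann v)" using fin_ann by (rule psubset_card_mono[rotated])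
    then show False using vmin[OF v'] by simp
  qed
  then show ?thesis using v by (intro that[of v]) (auto simp: ann_def)
qed

section \<open>Algebras generated by a root of a binomial\<close>

text \<open>
  A commutative \<open>K\<close>-algebra \<open>B\<close> generated by an element \<open>f\<close> with \<open>f\<^sup>k = c\<close> whose powers below
  \<open>k\<close> are independent over \<open>K\<close>. Generation is stated for subrings of \<open>B\<close>, the form in which it is
  used to show that evaluation of polynomials at \<open>f\<close> is onto.
\<close>

locale binomial_generator = ring_hom_cring K B h for K and B and h +
  fixes f k c
  assumes f_closed [simp]: "f \<in> carrier B" and k_pos: "k > 0" and c_closed [simp]: "c \<in> carrier K"
    and root: "f [^]\<^bsub>B\<^esub> (k::nat) = h c"
    and indep: "\<And>a. a \<in> {..<k} \<rightarrow> carrier K \<Longrightarrow>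
      (\<Oplus>\<^bsub>B\<^esub>i\<in>{..<k}. h (a i) \<otimes>\<^bsub>B\<^esub> f [^]\<^bsub>B\<^esub> i) = \<zero>\<^bsub>B\<^esub> \<Longrightarrow> \<forall>i<k. a i = \<zero>\<^bsub>K\<^esub>"
    and gen: "\<And>U. subring U B \<Longrightarrow> h ` carrier K \<subseteq> U \<Longrightarrow> f \<in> U \<Longrightarrow> carrier B \<subseteq> U"
    and nontrivial: "\<one>\<^bsub>K\<^esub> \<noteq> \<zero>\<^bsub>K\<^esub>"
begin

lemma h_hom: "h \<in> ring_hom K B" by (rule homh)

sublocale UP_pre_univ_prop K B h "UP K"
  by unfold_locales simp

sublocale UP_univ_prop K B h "UP K" f "UnivPoly.eval K B h f"
  by unfold_locales simp_all

abbreviation "P \<equiv> UP K"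
abbreviation "ev \<equiv> UnivPoly.eval K B h f"

definition binomial where
  "binomial = UnivPoly.monom P \<one>\<^bsub>K\<^esub> k \<ominus>\<^bsub>P\<^esub> UnivPoly.monom P c 0"

lemma binomial_closed [simp]: "binomial \<in> carrier P"
  by (simp add: binomial_def)

lemma coeff_binomial:
  "UnivPoly.coeff P binomial i = (if i = k then \<one>\<^bsub>K\<^esub> else if i = 0 then \<ominus>\<^bsub>K\<^esub> c else \<zero>\<^bsub>K\<^esub>)"
  using k_pos by (simp add: binomial_def a_minus_def)

lemma deg_binomial: "UnivPoly.deg K binomial = k"
  by (rule le_antisym[OF deg_aboveI deg_belowI]) (use k_pos nontrivial in \<open>auto simp: coeff_binomial\<close>)

lemma ev_binomial: "ev binomial = \<zero>\<^bsub>B\<^esub>"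
  by (simp add: binomial_def Eval_monom root a_minus_def S.r_neg)

lemma ev_expand:
  assumes g: "g \<in> carrier P" and "g = \<zero>\<^bsub>P\<^esub> \<or> UnivPoly.deg K g < k"
  shows "ev g = (\<Oplus>\<^bsub>B\<^esub>i\<in>{..<k}. h (UnivPoly.coeff P g i) \<otimes>\<^bsub>B\<^esub> f [^]\<^bsub>B\<^esub> i)"
proof -
  have deg: "UnivPoly.deg K g < k" using assms k_pos by auto
  show ?thesis unfolding eval_on_carrier[OF g]
    by (rule S.add.finprod_mono_neutral_cong_left) (use deg g in \<open>auto simp: deg_aboveD\<close>)
qed

lemma binomial_division:
  assumes g: "g \<in> carrier P"
  obtains q r where "q \<in> carrier P" "r \<in> carrier P" "g = binomial \<otimes>\<^bsub>P\<^esub> q \<oplus>\<^bsub>P\<^esub> r"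
    "r = \<zero>\<^bsub>P\<^esub> \<or> UnivPoly.deg K r < k"
proof -
  have "binomial \<noteq> \<zero>\<^bsub>P\<^esub>" using deg_binomial k_pos by auto
  from long_div_theorem[OF binomial_closed g this] that g show ?thesis
    by (auto simp: deg_binomial coeff_binomial)
qed

lemma ev_surj: "ev ` carrier P = carrier B"
proof
  show "carrier B \<subseteq> ev ` carrier P"
  proof (rule gen)
    show "subring (ev ` carrier P) B"
      using ring_hom_ring.img_is_subring[OF ring.ring_hom_ring_axioms P.carrier_is_subring] .
    show "h ` carrier K \<subseteq> ev ` carrier P"
    proof clarify
      fix a assume "a \<in> carrier K"
      then have "h a = ev (UnivPoly.monom P a 0)" "UnivPoly.monom P a 0 \<in> carrier P"
        by (simp_all add: Eval_monom)
      then show "h a \<in> ev ` carrier P" by blast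
    qed
    have "f = ev (UnivPoly.monom P \<one>\<^bsub>K\<^esub> 1)" by (simp add: Eval_monom)
    then show "f \<in> ev ` carrier P" by (metis image_eqI monom_closed R.one_closed)
  qed
qed auto

lemma expansion:
  assumes "b \<in> carrier B"
  obtains a where "a \<in> {..<k} \<rightarrow>\<^sub>E carrier K"
    "b = (\<Oplus>\<^bsub>B\<^esub>i\<in>{..<k}. h (a i) \<otimes>\<^bsub>B\<^esub> f [^]\<^bsub>B\<^esub> i)"
proof -
  obtain g where g: "g \<in> carrier P" "b = ev g" using assms ev_surj by blast
  obtain q r where qr: "q \<in> carrier P" "r \<in> carrier P" "g = binomial \<otimes>\<^bsub>P\<^esub> q \<oplus>\<^bsub>P\<^esub> r"
    "r = \<zero>\<^bsub>P\<^esub> \<or> UnivPoly.deg K r < k"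
    using binomial_division[OF g(1)] by blast
  let ?a = "restrict (UnivPoly.coeff P r) {..<k}"
  have "b = ev r" unfolding g(2) qr(3) using qr(1,2) by (simp add: ev_binomial)
  also have "\<dots> = (\<Oplus>\<^bsub>B\<^esub>i\<in>{..<k}. h (?a i) \<otimes>\<^bsub>B\<^esub> f [^]\<^bsub>B\<^esub> i)"
    unfolding ev_expand[OF qr(2,4)] by (rule S.finsum_cong') (use qr(2) in auto)
  finally have "b = (\<Oplus>\<^bsub>B\<^esub>i\<in>{..<k}. h (?a i) \<otimes>\<^bsub>B\<^esub> f [^]\<^bsub>B\<^esub> i)" .
  moreover have "?a \<in> {..<k} \<rightarrow>\<^sub>E carrier K"
    unfolding restrict_PiE_iff using qr(2) by simp
  ultimately show ?thesis using that by blast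
qed

lemma expansion_unique:
  assumes a: "a \<in> {..<k} \<rightarrow> carrier K" and b: "b \<in> {..<k} \<rightarrow> carrier K"
    and eq: "(\<Oplus>\<^bsub>B\<^esub>i\<in>{..<k}. h (a i) \<otimes>\<^bsub>B\<^esub> f [^]\<^bsub>B\<^esub> i) = (\<Oplus>\<^bsub>B\<^esub>i\<in>{..<k}. h (b i) \<otimes>\<^bsub>B\<^esub> f [^]\<^bsub>B\<^esub> i)"
    and "i < k"
  shows "a i = b i"
proof -
  let ?F = "\<lambda>a i. h (a i) \<otimes>\<^bsub>B\<^esub> f [^]\<^bsub>B\<^esub> i"
  let ?d = "\<lambda>i. a i \<ominus>\<^bsub>K\<^esub> b i"
  have F: "?F a \<in> {..<k} \<rightarrow> carrier B" "?F b \<in> {..<k} \<rightarrow> carrier B" "?F ?d \<in> {..<k} \<rightarrow> carrier B"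
    using a b by (auto simp: Pi_iff)
  have "finsum B (?F a) {..<k} = finsum B (\<lambda>i. ?F ?d i \<oplus>\<^bsub>B\<^esub> ?F b i) {..<k}"
  proof (rule S.finsum_cong')
    fix i assume "i \<in> {..<k}"
    then have ab: "a i \<in> carrier K" "b i \<in> carrier K" using a b by auto
    have "h (a i) \<in> carrier B" "h (b i) \<in> carrier B" "f [^]\<^bsub>B\<^esub> i \<in> carrier B"
      using ab by simp_all
    then have "(h (a i) \<ominus>\<^bsub>B\<^esub> h (b i)) \<otimes>\<^bsub>B\<^esub> f [^]\<^bsub>B\<^esub> i \<oplus>\<^bsub>B\<^esub> ?F b i = ?F a i"
      by algebra
    then show "?F a i = ?F ?d i \<oplus>\<^bsub>B\<^esub> ?F b i" using ab by simp
  qed (use F in auto)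
  also have "\<dots> = finsum B (?F ?d) {..<k} \<oplus>\<^bsub>B\<^esub> finsum B (?F b) {..<k}"
    by (rule S.finsum_addf) (use F in auto)
  finally have "finsum B (?F ?d) {..<k} \<oplus>\<^bsub>B\<^esub> finsum B (?F b) {..<k} = finsum B (?F b) {..<k}"
    using eq by simp
  then have "finsum B (?F ?d) {..<k} = \<zero>\<^bsub>B\<^esub>"
    by (rule S.add.r_cancel_one[THEN iffD1, rotated 2]) (intro S.finsum_closed F)+
  moreover have "?d \<in> {..<k} \<rightarrow> carrier K" using a b by (auto simp: Pi_iff)
  ultimately have "\<forall>i<k. ?d i = \<zero>\<^bsub>K\<^esub>" by (intro indep)
  then have "?d i = \<zero>\<^bsub>K\<^esub>" using \<open>i < k\<close> by blast
  moreover have "a i \<in> carrier K" "b i \<in> carrier K" using a b \<open>i < k\<close> by auto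
  ultimately show ?thesis by (simp only: R.r_right_minus_eq)
qed

lemma bij_expansion:
  "bij_betw (\<lambda>a. \<Oplus>\<^bsub>B\<^esub>i\<in>{..<k}. h (a i) \<otimes>\<^bsub>B\<^esub> f [^]\<^bsub>B\<^esub> i) ({..<k} \<rightarrow>\<^sub>E carrier K) (carrier B)"
    (is "bij_betw ?X _ _")
proof (rule bij_betw_imageI)
  show "inj_on ?X ({..<k} \<rightarrow>\<^sub>E carrier K)"
  proof (rule inj_onI)
    fix a b assume ab: "a \<in> {..<k} \<rightarrow>\<^sub>E carrier K" "b \<in> {..<k} \<rightarrow>\<^sub>E carrier K"
      "(\<Oplus>\<^bsub>B\<^esub>i\<in>{..<k}. h (a i) \<otimes>\<^bsub>B\<^esub> f [^]\<^bsub>B\<^esub> i) = (\<Oplus>\<^bsub>B\<^esub>i\<in>{..<k}. h (b i) \<otimes>\<^bsub>B\<^esub> f [^]\<^bsub>B\<^esub> i)"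
    show "a = b"
    proof (rule PiE_ext[OF ab(1,2)])
      fix i assume "i \<in> {..<k}"
      then show "a i = b i" using ab by (intro expansion_unique) auto
    qed
  qed
  show "?X ` ({..<k} \<rightarrow>\<^sub>E carrier K) = carrier B"
  proof
    show "?X ` ({..<k} \<rightarrow>\<^sub>E carrier K) \<subseteq> carrier B"
      by (rule image_subsetI, rule S.finsum_closed) auto
    show "carrier B \<subseteq> ?X ` ({..<k} \<rightarrow>\<^sub>E carrier K)"
      by (rule subsetI, erule expansion) blast
  qed
qed

lemma card_carrier: "card (carrier B) = card (carrier K) ^ k"
  using bij_betw_same_card[OF bij_expansion] by (simp add: card_PiE)

lemma finite_carrier: "finite (carrier K) \<Longrightarrow> finite (carrier B)"
  using bij_betw_finite[OF bij_expansion] by (simp add: finite_PiE)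

lemma kernel_ev: "a_kernel P B ev = binomial_ideal K k c"
proof -
  have ideal_eq: "binomial_ideal K k c = PIdl\<^bsub>P\<^esub> binomial"
    by (simp add: binomial_ideal_def binomial_def)
  show ?thesis unfolding ideal_eq a_kernel_def'
  proof
    show "PIdl\<^bsub>P\<^esub> binomial \<subseteq> {x \<in> carrier P. ev x = \<zero>\<^bsub>B\<^esub>}"
      by (auto simp: cgenideal_def ev_binomial)
    show "{x \<in> carrier P. ev x = \<zero>\<^bsub>B\<^esub>} \<subseteq> PIdl\<^bsub>P\<^esub> binomial"
    proof clarify
      fix g assume g: "g \<in> carrier P" "ev g = \<zero>\<^bsub>B\<^esub>"
      obtain q r where qr: "q \<in> carrier P" "r \<in> carrier P" "g = binomial \<otimes>\<^bsub>P\<^esub> q \<oplus>\<^bsub>P\<^esub> r"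
        "r = \<zero>\<^bsub>P\<^esub> \<or> UnivPoly.deg K r < k"
        using binomial_division[OF g(1)] by blast
      have "ev r = \<zero>\<^bsub>B\<^esub>" using g(2) qr(1,2) unfolding qr(3) by (simp add: ev_binomial)
      then have "\<forall>i<k. UnivPoly.coeff P r i = \<zero>\<^bsub>K\<^esub>"
        unfolding ev_expand[OF qr(2,4)] using qr(2) by (intro indep) auto
      then have "r = \<zero>\<^bsub>P\<^esub>"
        using qr(2,4) lcoeff_nonzero[of r] by blast
      then have "g = q \<otimes>\<^bsub>P\<^esub> binomial" using qr by (simp add: P.m_comm)
      then show "g \<in> PIdl\<^bsub>P\<^esub> binomial" using qr(1) by (auto simp: cgenideal_def)
    qed
  qed
qed

theorem binomial_algebra_iso: "\<exists>\<psi>. is_binomial_algebra_iso K k c B h f \<psi>"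
proof -
  let ?\<psi> = "\<lambda>C. the_elem (ev ` C)"
  have "?\<psi> \<in> ring_iso (P Quot binomial_ideal K k c) B"
    using ring.FactRing_iso_set[OF ev_surj] by (simp add: kernel_ev)
  moreover have val: "?\<psi> (binomial_ideal K k c +>\<^bsub>P\<^esub> g) = ev g" if "g \<in> carrier P" for g
    using ring.the_elem_simp[OF that] by (simp add: kernel_ev)
  ultimately show ?thesis
    unfolding is_binomial_algebra_iso_def
    by (intro exI[of _ ?\<psi>]) (simp add: val Eval_monom)
qed

text \<open>
  Among the nonzero polynomials with value in the ideal, which include \<open>binomial\<close>, one of least
  degree has a value that generates the ideal.
\<close>

lemma ideal_principal:
  assumes K: "field K" and I: "ideal I B"
  shows "\<exists>g\<in>carrier B. I = PIdl\<^bsub>B\<^esub> g"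
proof -
  interpret K: field K by fact
  have K_monoid: "monoid K" using K by (simp add: field_def domain_def cring_def ring_def)
  interpret I: ideal I B by fact
  define J where "J g \<longleftrightarrow> g \<in> carrier P \<and> ev g \<in> I \<and> g \<noteq> \<zero>\<^bsub>P\<^esub>" for g
  have "J binomial" using deg_binomial k_pos I.zero_closed by (auto simp: J_def ev_binomial)
  define g where "g = (ARG_MIN (UnivPoly.deg K) g. J g)"
  have g: "J g" and gmin: "\<And>r. J r \<Longrightarrow> UnivPoly.deg K g \<le> UnivPoly.deg K r"
    unfolding g_def using arg_min_nat_lemma[of J binomial "UnivPoly.deg K"] \<open>J binomial\<close> by auto
  have gP: "g \<in> carrier P" "ev g \<in> I" "g \<noteq> \<zero>\<^bsub>P\<^esub>" using g by (simp_all add: J_def)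
  have "I \<subseteq> PIdl\<^bsub>B\<^esub> (ev g)"
  proof
    fix b assume b: "b \<in> I"
    then obtain x where x: "x \<in> carrier P" "b = ev x" using ev_surj I.Icarr by blast
    obtain q r and j :: nat where qr: "q \<in> carrier P" "r \<in> carrier P"
      "UnivPoly.coeff P g (UnivPoly.deg K g) [^]\<^bsub>K\<^esub> j \<odot>\<^bsub>P\<^esub> x = g \<otimes>\<^bsub>P\<^esub> q \<oplus>\<^bsub>P\<^esub> r"
      "r = \<zero>\<^bsub>P\<^esub> \<or> UnivPoly.deg K r < UnivPoly.deg K g"
      using long_div_theorem[OF gP(1) x(1) gP(3)] by blast
    define l where "l = UnivPoly.coeff P g (UnivPoly.deg K g) [^]\<^bsub>K\<^esub> j"
    have "UnivPoly.coeff P g (UnivPoly.deg K g) \<in> Units K"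
      using lcoeff_nonzero[OF gP(3,1)] gP(1) by (simp add: K.field_Units)
    then have l: "l \<in> Units K" unfolding l_def
      by (rule monoid.Units_pow_closed[OF K_monoid])
    then have lK: "l \<in> carrier K" "inv\<^bsub>K\<^esub> l \<in> carrier K" "inv\<^bsub>K\<^esub> l \<otimes>\<^bsub>K\<^esub> l = \<one>\<^bsub>K\<^esub>"
      using monoid.Units_closed[OF K_monoid l] monoid.Units_inv_closed[OF K_monoid l]
        monoid.Units_l_inv[OF K_monoid l] by simp_all
    have eq: "h l \<otimes>\<^bsub>B\<^esub> b = ev g \<otimes>\<^bsub>B\<^esub> ev q \<oplus>\<^bsub>B\<^esub> ev r"
    proof -
      have "ev (l \<odot>\<^bsub>P\<^esub> x) = ev (g \<otimes>\<^bsub>P\<^esub> q \<oplus>\<^bsub>P\<^esub> r)" using qr(3) by (simp add: l_def)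
      then show ?thesis using lK(1) x gP(1) qr(1,2) by (simp add: Eval_smult)
    qed
    have evs: "ev g \<in> carrier B" "ev q \<in> carrier B" "ev r \<in> carrier B" "b \<in> carrier B" "h l \<in> carrier B"
      using gP qr(1,2) x lK(1) by simp_all
    have "ev r = h l \<otimes>\<^bsub>B\<^esub> b \<ominus>\<^bsub>B\<^esub> ev g \<otimes>\<^bsub>B\<^esub> ev q"
      unfolding eq using evs by algebra
    also have "\<dots> \<in> I"
      using b gP(2) evs I.I_l_closed[of b "h l"] I.I_r_closed[of "ev g" "ev q"]
      by (simp add: a_minus_def I.a_closed I.a_inv_closed)
    finally have "\<not> J r \<longrightarrow> r = \<zero>\<^bsub>P\<^esub>" using qr(2) by (simp add: J_def)
    then have "r = \<zero>\<^bsub>P\<^esub>" using gmin[of r] qr(4) by auto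
    then have "h l \<otimes>\<^bsub>B\<^esub> b = ev q \<otimes>\<^bsub>B\<^esub> ev g" using eq evs by (simp add: S.m_comm)
    then have "h (inv\<^bsub>K\<^esub> l) \<otimes>\<^bsub>B\<^esub> (h l \<otimes>\<^bsub>B\<^esub> b) = (h (inv\<^bsub>K\<^esub> l) \<otimes>\<^bsub>B\<^esub> ev q) \<otimes>\<^bsub>B\<^esub> ev g"
      using evs lK by (simp add: S.m_assoc)
    moreover have "h (inv\<^bsub>K\<^esub> l) \<otimes>\<^bsub>B\<^esub> (h l \<otimes>\<^bsub>B\<^esub> b) = b"
    proof -
      have "h (inv\<^bsub>K\<^esub> l) \<otimes>\<^bsub>B\<^esub> h l = \<one>\<^bsub>B\<^esub>"
        using ring_hom_mult[OF h_hom lK(2,1)] lK(3) ring_hom_one[OF h_hom] by simp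
      then show ?thesis
        using evs ring_hom_closed[OF h_hom lK(2)] S.m_assoc[of "h (inv\<^bsub>K\<^esub> l)" "h l" b] by simp
    qed
    ultimately have "b = (h (inv\<^bsub>K\<^esub> l) \<otimes>\<^bsub>B\<^esub> ev q) \<otimes>\<^bsub>B\<^esub> ev g" by simp
    then show "b \<in> PIdl\<^bsub>B\<^esub> (ev g)" using evs lK by (auto simp: cgenideal_def)
  qed
  moreover have "PIdl\<^bsub>B\<^esub> (ev g) \<subseteq> I" by (rule S.cgenideal_minimal[OF I gP(2)])
  ultimately show ?thesis using gP(1) by (intro bexI[of _ "ev g"]) auto
qed

end

section \<open>Free modules and module isomorphisms\<close>

lemma ex1_unique: "\<exists>!x. P x \<Longrightarrow> P x \<Longrightarrow> P y \<Longrightarrow> x = y"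
  by blast

lemma module_iso_zero:
  assumes "is_module_iso R M N f"
  shows "f \<zero>\<^bsub>M\<^esub> = \<zero>\<^bsub>N\<^esub>"
proof -
  interpret M: module R M using assms by (simp add: is_module_iso_def)
  interpret N: module R N using assms by (simp add: is_module_iso_def)
  have f: "f v \<in> carrier N" if "v \<in> carrier M" for v
    using assms that by (auto simp: is_module_iso_def bij_betw_def)
  have "f (\<zero>\<^bsub>M\<^esub> \<oplus>\<^bsub>M\<^esub> \<zero>\<^bsub>M\<^esub>) = f \<zero>\<^bsub>M\<^esub> \<oplus>\<^bsub>N\<^esub> f \<zero>\<^bsub>M\<^esub>"
    using assms M.M.zero_closed unfolding is_module_iso_def by blast
  then have "f \<zero>\<^bsub>M\<^esub> \<oplus>\<^bsub>N\<^esub> f \<zero>\<^bsub>M\<^esub> = f \<zero>\<^bsub>M\<^esub>" by simp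
  then show ?thesis using f[OF M.M.zero_closed] by (simp add: N.M.add.r_cancel_one)
qed

lemma module_iso_finsum:
  assumes iso: "is_module_iso R M N f" and "finite I" and "x \<in> I \<rightarrow> carrier M"
  shows "f (\<Oplus>\<^bsub>M\<^esub>i\<in>I. x i) = (\<Oplus>\<^bsub>N\<^esub>i\<in>I. f (x i))"
proof -
  interpret M: module R M using iso by (simp add: is_module_iso_def)
  interpret N: module R N using iso by (simp add: is_module_iso_def)
  have f: "f v \<in> carrier N" if "v \<in> carrier M" for v
    using iso that by (auto simp: is_module_iso_def bij_betw_def)
  have add: "f (v \<oplus>\<^bsub>M\<^esub> w) = f v \<oplus>\<^bsub>N\<^esub> f w" if "v \<in> carrier M" "w \<in> carrier M" for v w
    using iso that by (simp add: is_module_iso_def)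
  show ?thesis using assms(2,3)
  proof (induction I rule: finite_induct)
    case (insert j I)
    then have x: "x \<in> I \<rightarrow> carrier M" "x j \<in> carrier M" by auto
    have fx: "(\<lambda>i. f (x i)) \<in> I \<rightarrow> carrier N" using x f by auto
    show ?case using insert x f fx
      by (simp add: M.M.finsum_insert N.M.finsum_insert add M.M.finsum_closed)
  qed (simp add: module_iso_zero[OF iso])
qed

lemma module_iso_sym:
  assumes "is_module_iso R M N f"
  shows "is_module_iso R N M (inv_into (carrier M) f)"
proof -
  interpret M: module R M using assms by (simp add: is_module_iso_def)
  let ?g = "inv_into (carrier M) f"
  have bij: "bij_betw f (carrier M) (carrier N)" using assms by (simp add: is_module_iso_def)
  have g: "?g w \<in> carrier M" "f (?g w) = w" if "w \<in> carrier N" for w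
    using bij that by (auto simp: bij_betw_def inv_into_into f_inv_into_f)
  have gf: "?g (f v) = v" if "v \<in> carrier M" for v
    using bij that by (auto simp: bij_betw_def)
  have "?g (v \<oplus>\<^bsub>N\<^esub> w) = ?g v \<oplus>\<^bsub>M\<^esub> ?g w" if "v \<in> carrier N" "w \<in> carrier N" for v w
  proof -
    have "f (?g v \<oplus>\<^bsub>M\<^esub> ?g w) = v \<oplus>\<^bsub>N\<^esub> w"
      using assms that g by (simp add: is_module_iso_def)
    then show ?thesis using gf[of "?g v \<oplus>\<^bsub>M\<^esub> ?g w"] that g by simp
  qed
  moreover have "?g (a \<odot>\<^bsub>N\<^esub> w) = a \<odot>\<^bsub>M\<^esub> ?g w" if "a \<in> carrier R" "w \<in> carrier N" for a w
  proof -
    have "f (a \<odot>\<^bsub>M\<^esub> ?g w) = a \<odot>\<^bsub>N\<^esub> w"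
      using assms that g by (simp add: is_module_iso_def)
    then show ?thesis using gf[of "a \<odot>\<^bsub>M\<^esub> ?g w"] that g by simp
  qed
  ultimately show ?thesis
    using assms bij_betw_inv_into[OF bij] by (simp add: is_module_iso_def)
qed

lemma free_module_transport:
  assumes iso: "is_module_iso R M N f" and free: "is_free_module R M k"
  shows "is_free_module R N k"
proof -
  interpret M: module R M using iso by (simp add: is_module_iso_def)
  have f: "f v \<in> carrier N" if "v \<in> carrier M" for v
    using iso that by (auto simp: is_module_iso_def bij_betw_def)
  have smult: "f (a \<odot>\<^bsub>M\<^esub> v) = a \<odot>\<^bsub>N\<^esub> f v" if "a \<in> carrier R" "v \<in> carrier M" for a v
    using iso that by (simp add: is_module_iso_def)
  have N: "module R N" using iso by (simp add: is_module_iso_def)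
  from free have "\<exists>b\<in>{..<k} \<rightarrow> carrier M. \<forall>v\<in>carrier M.
      \<exists>!a. a \<in> {..<k} \<rightarrow>\<^sub>E carrier R \<and> v = (\<Oplus>\<^bsub>M\<^esub>i\<in>{..<k}. a i \<odot>\<^bsub>M\<^esub> b i)"
    by (simp only: is_free_module_def)
  then obtain b where b: "b \<in> {..<k} \<rightarrow> carrier M" and "\<forall>v\<in>carrier M.
      \<exists>!a. a \<in> {..<k} \<rightarrow>\<^sub>E carrier R \<and> v = (\<Oplus>\<^bsub>M\<^esub>i\<in>{..<k}. a i \<odot>\<^bsub>M\<^esub> b i)"
    by (rule bexE)
  note uniq = bspec[OF this(2)]
  have sum: "f (\<Oplus>\<^bsub>M\<^esub>i\<in>{..<k}. a i \<odot>\<^bsub>M\<^esub> b i) = (\<Oplus>\<^bsub>N\<^esub>i\<in>{..<k}. a i \<odot>\<^bsub>N\<^esub> f (b i))"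
    if a: "a \<in> {..<k} \<rightarrow>\<^sub>E carrier R" for a
  proof -
    interpret N: module R N by (rule N)
    have "f (\<Oplus>\<^bsub>M\<^esub>i\<in>{..<k}. a i \<odot>\<^bsub>M\<^esub> b i) = (\<Oplus>\<^bsub>N\<^esub>i\<in>{..<k}. f (a i \<odot>\<^bsub>M\<^esub> b i))"
      by (rule module_iso_finsum[OF iso]) (use a b in auto)
    also have "\<dots> = (\<Oplus>\<^bsub>N\<^esub>i\<in>{..<k}. a i \<odot>\<^bsub>N\<^esub> f (b i))"
    proof (rule N.M.finsum_cong')
      fix i assume "i \<in> {..<k}"
      then have "a i \<in> carrier R" "b i \<in> carrier M" using a b by auto
      then show "f (a i \<odot>\<^bsub>M\<^esub> b i) = a i \<odot>\<^bsub>N\<^esub> f (b i)" by (rule smult)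
    next
      show "(\<lambda>i. a i \<odot>\<^bsub>N\<^esub> f (b i)) \<in> {..<k} \<rightarrow> carrier N"
        by (rule Pi_I, rule N.smult_closed) (use a b f in auto)
    qed simp
    finally show ?thesis .
  qed
  have "\<exists>!a. a \<in> {..<k} \<rightarrow>\<^sub>E carrier R \<and> w = (\<Oplus>\<^bsub>N\<^esub>i\<in>{..<k}. a i \<odot>\<^bsub>N\<^esub> f (b i))" if w: "w \<in> carrier N" for w
  proof -
    have bij: "bij_betw f (carrier M) (carrier N)" using iso by (simp add: is_module_iso_def)
    have "w \<in> f ` carrier M" using bij_betw_imp_surj_on[OF bij] w by simp
    then obtain v where v: "v \<in> carrier M" "w = f v" by blast
    have inj: "x = y" if "f x = f y" "x \<in> carrier M" "y \<in> carrier M" for x y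
      using bij_betw_imp_inj_on[OF bij] that by (rule inj_onD)
    have "(w = (\<Oplus>\<^bsub>N\<^esub>i\<in>{..<k}. a i \<odot>\<^bsub>N\<^esub> f (b i))) = (v = (\<Oplus>\<^bsub>M\<^esub>i\<in>{..<k}. a i \<odot>\<^bsub>M\<^esub> b i))"
      if a: "a \<in> {..<k} \<rightarrow>\<^sub>E carrier R" for a
    proof -
      have "(\<Oplus>\<^bsub>M\<^esub>i\<in>{..<k}. a i \<odot>\<^bsub>M\<^esub> b i) \<in> carrier M"
        by (rule M.M.finsum_closed, rule Pi_I, rule M.smult_closed) (use a b in auto)
      then show ?thesis unfolding sum[OF a, symmetric] v(2) using inj v(1) by blast
    qed
    then show ?thesis using uniq[OF v(1)] by (simp cong: conj_cong)
  qed
  then have "\<forall>w\<in>carrier N. \<exists>!a. a \<in> {..<k} \<rightarrow>\<^sub>E carrier R \<and> w = (\<Oplus>\<^bsub>N\<^esub>i\<in>{..<k}. a i \<odot>\<^bsub>N\<^esub> f (b i))"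
    by (rule ballI)
  moreover have "(\<lambda>i. f (b i)) \<in> {..<k} \<rightarrow> carrier N" using b f by (simp add: Pi_iff)
  ultimately show ?thesis unfolding is_free_module_def by (intro conjI N) (rule bexI)
qed

lemma module_power_module:
  assumes "cring R"
  shows "module R (power_module R k)"
proof -
  interpret cring R by fact
  let ?C = "{..<k} \<rightarrow>\<^sub>E carrier R"
  have C: "x \<in> extensional {..<k}" "i < k \<Longrightarrow> x i \<in> carrier R" if "x \<in> ?C" for x i
    using that by (simp_all add: PiE_iff)
  have simps: "carrier (power_module R k) = ?C"
    "\<zero>\<^bsub>power_module R k\<^esub> = (\<lambda>i\<in>{..<k}. \<zero>\<^bsub>R\<^esub>)"
    "x \<oplus>\<^bsub>power_module R k\<^esub> y = (\<lambda>i\<in>{..<k}. x i \<oplus>\<^bsub>R\<^esub> y i)"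
    "a \<odot>\<^bsub>power_module R k\<^esub> x = (\<lambda>i\<in>{..<k}. a \<otimes>\<^bsub>R\<^esub> x i)" for x y a
    by (simp_all add: power_module_def)
  have grp: "abelian_group (power_module R k)"
  proof (rule abelian_groupI, unfold simps)
    fix x assume x: "x \<in> ?C"
    show "(\<lambda>i\<in>{..<k}. (\<lambda>i\<in>{..<k}. \<zero>\<^bsub>R\<^esub>) i \<oplus>\<^bsub>R\<^esub> x i) = x"
      by (rule extensionalityI[OF restrict_extensional C(1)[OF x]]) (use C(2)[OF x] in simp)
    show "\<exists>y\<in>?C. (\<lambda>i\<in>{..<k}. y i \<oplus>\<^bsub>R\<^esub> x i) = (\<lambda>i\<in>{..<k}. \<zero>\<^bsub>R\<^esub>)"
    proof (rule bexI)
      show "(\<lambda>i\<in>{..<k}. (\<lambda>i\<in>{..<k}. \<ominus>\<^bsub>R\<^esub> x i) i \<oplus>\<^bsub>R\<^esub> x i) = (\<lambda>i\<in>{..<k}. \<zero>\<^bsub>R\<^esub>)"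
        by (rule restrict_ext) (use C(2)[OF x] in \<open>simp add: l_neg\<close>)
      show "(\<lambda>i\<in>{..<k}. \<ominus>\<^bsub>R\<^esub> x i) \<in> ?C"
        unfolding restrict_PiE_iff using C(2)[OF x] by simp
    qed
  next
    fix x y z assume x: "x \<in> ?C" and y: "y \<in> ?C" and z: "z \<in> ?C"
    show "(\<lambda>i\<in>{..<k}. x i \<oplus>\<^bsub>R\<^esub> y i) \<in> ?C"
      unfolding restrict_PiE_iff using C(2)[OF x] C(2)[OF y] by simp
    show "(\<lambda>i\<in>{..<k}. x i \<oplus>\<^bsub>R\<^esub> y i) = (\<lambda>i\<in>{..<k}. y i \<oplus>\<^bsub>R\<^esub> x i)"
      by (rule restrict_ext) (use C(2)[OF x] C(2)[OF y] in \<open>simp add: a_comm\<close>)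
    show "(\<lambda>i\<in>{..<k}. (\<lambda>i\<in>{..<k}. x i \<oplus>\<^bsub>R\<^esub> y i) i \<oplus>\<^bsub>R\<^esub> z i) =
      (\<lambda>i\<in>{..<k}. x i \<oplus>\<^bsub>R\<^esub> (\<lambda>i\<in>{..<k}. y i \<oplus>\<^bsub>R\<^esub> z i) i)"
      by (rule restrict_ext) (use C(2)[OF x] C(2)[OF y] C(2)[OF z] in \<open>simp add: a_assoc\<close>)
  next
    show "(\<lambda>i\<in>{..<k}. \<zero>\<^bsub>R\<^esub>) \<in> ?C" unfolding restrict_PiE_iff by simp
  qed
  show ?thesis
  proof (rule moduleI[OF assms grp], unfold simps)
    fix a b x y assume a: "a \<in> carrier R" and b: "b \<in> carrier R" and x: "x \<in> ?C" and y: "y \<in> ?C"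
    show "(\<lambda>i\<in>{..<k}. a \<otimes>\<^bsub>R\<^esub> x i) \<in> ?C"
      unfolding restrict_PiE_iff using C(2)[OF x] a by simp
    show "(\<lambda>i\<in>{..<k}. (a \<oplus>\<^bsub>R\<^esub> b) \<otimes>\<^bsub>R\<^esub> x i) =
        (\<lambda>i\<in>{..<k}. (\<lambda>i\<in>{..<k}. a \<otimes>\<^bsub>R\<^esub> x i) i \<oplus>\<^bsub>R\<^esub> (\<lambda>i\<in>{..<k}. b \<otimes>\<^bsub>R\<^esub> x i) i)"
      by (rule restrict_ext) (use C(2)[OF x] a b in \<open>simp add: l_distr\<close>)
    show "(\<lambda>i\<in>{..<k}. a \<otimes>\<^bsub>R\<^esub> (\<lambda>i\<in>{..<k}. x i \<oplus>\<^bsub>R\<^esub> y i) i) =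
        (\<lambda>i\<in>{..<k}. (\<lambda>i\<in>{..<k}. a \<otimes>\<^bsub>R\<^esub> x i) i \<oplus>\<^bsub>R\<^esub> (\<lambda>i\<in>{..<k}. a \<otimes>\<^bsub>R\<^esub> y i) i)"
      by (rule restrict_ext) (use C(2)[OF x] C(2)[OF y] a in \<open>simp add: r_distr\<close>)
    show "(\<lambda>i\<in>{..<k}. (a \<otimes>\<^bsub>R\<^esub> b) \<otimes>\<^bsub>R\<^esub> x i) =
        (\<lambda>i\<in>{..<k}. a \<otimes>\<^bsub>R\<^esub> (\<lambda>i\<in>{..<k}. b \<otimes>\<^bsub>R\<^esub> x i) i)"
      by (rule restrict_ext) (use C(2)[OF x] a b in \<open>simp add: m_assoc\<close>)
  next
    fix x assume x: "x \<in> ?C"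
    show "(\<lambda>i\<in>{..<k}. \<one>\<^bsub>R\<^esub> \<otimes>\<^bsub>R\<^esub> x i) = x"
      by (rule extensionalityI[OF restrict_extensional C(1)[OF x]]) (use C(2)[OF x] in simp)
  qed
qed

lemma free_module_imp_power_module_iso:
  assumes free: "is_free_module R M k"
  obtains f where "is_module_iso R M (power_module R k) f"
proof -
  interpret module R M using free by (simp add: is_free_module_def)
  from free have "\<exists>b\<in>{..<k} \<rightarrow> carrier M. \<forall>v\<in>carrier M.
      \<exists>!a. a \<in> {..<k} \<rightarrow>\<^sub>E carrier R \<and> v = (\<Oplus>\<^bsub>M\<^esub>i\<in>{..<k}. a i \<odot>\<^bsub>M\<^esub> b i)"
    by (simp only: is_free_module_def)
  then obtain b where b: "b \<in> {..<k} \<rightarrow> carrier M" and "\<forall>v\<in>carrier M.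
      \<exists>!a. a \<in> {..<k} \<rightarrow>\<^sub>E carrier R \<and> v = (\<Oplus>\<^bsub>M\<^esub>i\<in>{..<k}. a i \<odot>\<^bsub>M\<^esub> b i)"
    by (rule bexE)
  note uniq = bspec[OF this(2)]
  define g where "g a = (\<Oplus>\<^bsub>M\<^esub>i\<in>{..<k}. a i \<odot>\<^bsub>M\<^esub> b i)" for a
  have car: "carrier (power_module R k) = {..<k} \<rightarrow>\<^sub>E carrier R" by (simp add: power_module_def)
  have terms: "(\<lambda>i. a i \<odot>\<^bsub>M\<^esub> b i) \<in> {..<k} \<rightarrow> carrier M" if "a \<in> {..<k} \<rightarrow>\<^sub>E carrier R" for a
    by (rule Pi_I, rule smult_closed) (use that b in auto)
  have g: "g a \<in> carrier M" if "a \<in> {..<k} \<rightarrow>\<^sub>E carrier R" for a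
    unfolding g_def by (rule M.finsum_closed[OF terms[OF that]])
  have "is_module_iso R (power_module R k) M g"
    unfolding is_module_iso_def car
  proof (intro conjI ballI)
    show "module R (power_module R k)" by (rule module_power_module) (rule R.is_cring)
    show "module R M" by (rule module_axioms)
    show "bij_betw g ({..<k} \<rightarrow>\<^sub>E carrier R) (carrier M)"
    proof (rule bij_betw_imageI)
      show "inj_on g ({..<k} \<rightarrow>\<^sub>E carrier R)"
      proof (rule inj_onI)
        fix a a' assume a: "a \<in> {..<k} \<rightarrow>\<^sub>E carrier R" "a' \<in> {..<k} \<rightarrow>\<^sub>E carrier R" "g a = g a'"
        then show "a = a'"
          using ex1_unique[OF uniq[OF g[OF a(1)]], of a a'] by (simp add: g_def)
      qed
      show "g ` ({..<k} \<rightarrow>\<^sub>E carrier R) = carrier M"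
      proof
        show "carrier M \<subseteq> g ` ({..<k} \<rightarrow>\<^sub>E carrier R)"
        proof
          fix v assume "v \<in> carrier M"
          then obtain a where "a \<in> {..<k} \<rightarrow>\<^sub>E carrier R" "v = g a"
            using ex1_implies_ex[OF uniq] unfolding g_def by blast
          then show "v \<in> g ` ({..<k} \<rightarrow>\<^sub>E carrier R)" by blast
        qed
      qed (use g in blast)
    qed
  next
    fix x y assume xy: "x \<in> {..<k} \<rightarrow>\<^sub>E carrier R" "y \<in> {..<k} \<rightarrow>\<^sub>E carrier R"
    have "g (x \<oplus>\<^bsub>power_module R k\<^esub> y) = (\<Oplus>\<^bsub>M\<^esub>i\<in>{..<k}. x i \<odot>\<^bsub>M\<^esub> b i \<oplus>\<^bsub>M\<^esub> y i \<odot>\<^bsub>M\<^esub> b i)"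
      unfolding g_def
    proof (rule M.finsum_cong')
      fix i assume i: "i \<in> {..<k}"
      then have "x i \<in> carrier R" "y i \<in> carrier R" "b i \<in> carrier M" using xy b by auto
      then show "(x \<oplus>\<^bsub>power_module R k\<^esub> y) i \<odot>\<^bsub>M\<^esub> b i = x i \<odot>\<^bsub>M\<^esub> b i \<oplus>\<^bsub>M\<^esub> y i \<odot>\<^bsub>M\<^esub> b i"
        using i by (simp add: power_module_def smult_l_distr)
    qed (use terms[OF xy(1)] terms[OF xy(2)] in auto)
    also have "\<dots> = g x \<oplus>\<^bsub>M\<^esub> g y" unfolding g_def
      by (rule M.finsum_addf[OF terms[OF xy(1)] terms[OF xy(2)]])
    finally show "g (x \<oplus>\<^bsub>power_module R k\<^esub> y) = g x \<oplus>\<^bsub>M\<^esub> g y" .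
  next
    fix c x assume c: "c \<in> carrier R" and x: "x \<in> {..<k} \<rightarrow>\<^sub>E carrier R"
    have "c \<odot>\<^bsub>M\<^esub> (\<Oplus>\<^bsub>M\<^esub>i\<in>I. x i \<odot>\<^bsub>M\<^esub> b i) = (\<Oplus>\<^bsub>M\<^esub>i\<in>I. c \<odot>\<^bsub>M\<^esub> (x i \<odot>\<^bsub>M\<^esub> b i))"
      if "finite I" "(\<lambda>i. x i \<odot>\<^bsub>M\<^esub> b i) \<in> I \<rightarrow> carrier M" for I using that
    proof (induction I rule: finite_induct)
      case (insert j I)
      then have 1: "(\<lambda>i. x i \<odot>\<^bsub>M\<^esub> b i) \<in> I \<rightarrow> carrier M" "x j \<odot>\<^bsub>M\<^esub> b j \<in> carrier M" by auto
      then have 2: "(\<lambda>i. c \<odot>\<^bsub>M\<^esub> (x i \<odot>\<^bsub>M\<^esub> b i)) \<in> I \<rightarrow> carrier M" using c by auto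
      show ?case using insert 1 2 c
        by (simp add: M.finsum_insert smult_r_distr M.finsum_closed)
    qed (use c in simp)
    from this[OF _ terms[OF x]] have "c \<odot>\<^bsub>M\<^esub> g x = (\<Oplus>\<^bsub>M\<^esub>i\<in>{..<k}. c \<odot>\<^bsub>M\<^esub> (x i \<odot>\<^bsub>M\<^esub> b i))"
      unfolding g_def by simp
    also have "\<dots> = g (c \<odot>\<^bsub>power_module R k\<^esub> x)" unfolding g_def
    proof (rule M.finsum_cong')
      fix i assume i: "i \<in> {..<k}"
      then have "x i \<in> carrier R" "b i \<in> carrier M" using x b by auto
      then show "c \<odot>\<^bsub>M\<^esub> (x i \<odot>\<^bsub>M\<^esub> b i) = (c \<odot>\<^bsub>power_module R k\<^esub> x) i \<odot>\<^bsub>M\<^esub> b i"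
        using i c by (simp add: power_module_def smult_assoc1)
    next
      have "c \<odot>\<^bsub>power_module R k\<^esub> x \<in> {..<k} \<rightarrow>\<^sub>E carrier R"
        using c x by (auto simp: power_module_def)
      then show "(\<lambda>i. (c \<odot>\<^bsub>power_module R k\<^esub> x) i \<odot>\<^bsub>M\<^esub> b i) \<in> {..<k} \<rightarrow> carrier M"
        by (rule terms)
    qed simp
    finally show "g (c \<odot>\<^bsub>power_module R k\<^esub> x) = c \<odot>\<^bsub>M\<^esub> g x" by simp
  qed
  from module_iso_sym[OF this] show ?thesis by (rule that)
qed

section \<open>Finite sums and subrings\<close>

lemma (in ring) finsum_subring:
  assumes "subring H R" "F \<in> A \<rightarrow> H"
  shows "finsum (R\<lparr>carrier := H\<rparr>) F A = finsum R F A"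
proof (cases "finite A")
  case True
  interpret H: ring "R\<lparr>carrier := H\<rparr>" by (rule subring_is_ring[OF assms(1)])
  have HR: "H \<subseteq> carrier R" using assms(1) by (rule subringE)
  from True assms(2) show ?thesis
  proof (induction A rule: finite_induct)
    case (insert x A)
    then have "F \<in> A \<rightarrow> H" "F x \<in> H" "F \<in> A \<rightarrow> carrier R" "F x \<in> carrier R" using HR by auto
    then show ?case using insert H.finsum_insert[of A x F] finsum_insert[of A x F] by simp
  qed (use H.finsum_empty in simp)
next
  case False
  interpret H: ring "R\<lparr>carrier := H\<rparr>" by (rule subring_is_ring[OF assms(1)])
  show ?thesis using H.finsum_infinite[OF False] finsum_infinite[OF False] by simp
qed

lemma (in ring) finsum_in_subring:
  assumes "subring H R" "F \<in> A \<rightarrow> H"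
  shows "finsum R F A \<in> H"
proof -
  interpret H: ring "R\<lparr>carrier := H\<rparr>" by (rule subring_is_ring[OF assms(1)])
  show ?thesis using H.finsum_closed[of F A] assms(2) by (simp add: finsum_subring[OF assms])
qed

lemma (in ring) subring_of_subring:
  assumes "subring H R" "subring U (R\<lparr>carrier := H\<rparr>)"
  shows "subring U R"
proof (rule ring_incl_imp_subring)
  interpret H: ring "R\<lparr>carrier := H\<rparr>" by (rule subring_is_ring[OF assms(1)])
  show "U \<subseteq> carrier R" using subringE(1)[OF assms(1)] subringE(1)[OF assms(2)] by auto
  show "ring (R\<lparr>carrier := U\<rparr>)" using H.subring_is_ring[OF assms(2)] by simp
qed

text \<open>An element commuting with all generators commutes with the generated ring; this is applied twice.\<close>

lemma (in ring) generate_ring_commute: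
  assumes H: "H \<subseteq> carrier R" and comm: "\<And>x y. x \<in> H \<Longrightarrow> y \<in> H \<Longrightarrow> x \<otimes> y = y \<otimes> x"
  shows "subcring (generate_ring R H) R"
proof (rule subcringI)
  show "subring (generate_ring R H) R" by (rule generate_ring_is_subring[OF H])
  have in_car: "x \<in> generate_ring R H \<Longrightarrow> x \<in> carrier R" for x
    by (rule generate_ring_in_carrier[OF H])
  have centralize: "x \<otimes> y = y \<otimes> x"
    if "x \<in> generate_ring R H" "y \<in> carrier R" "\<And>z. z \<in> H \<Longrightarrow> z \<otimes> y = y \<otimes> z" for x y
    using that(1)
  proof (induction x rule: generate_ring.induct)
    case (a_inv h)
    then show ?case using that(2) in_car by (simp add: l_minus r_minus)
  next
    case (eng_add h1 h2)
    then show ?case using that(2) in_car by (simp add: l_distr r_distr)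
  next
    case (eng_mult h1 h2)
    then show ?case using that(2) in_car by (metis m_assoc)
  qed (use that in auto)
  fix x y assume xy: "x \<in> generate_ring R H" "y \<in> generate_ring R H"
  have "z \<otimes> y = y \<otimes> z" if "z \<in> H" for z
    using centralize[of y z] xy(2) that H comm by (metis subsetD)
  then show "x \<otimes> y = y \<otimes> x" by (rule centralize[OF xy(1) in_car[OF xy(2)]])
qed

lemma (in abelian_monoid) finsum_lessThan_add:
  fixes p m :: nat
  assumes "F \<in> {..<p + m} \<rightarrow> carrier G"
  shows "(\<Oplus>i\<in>{..<p + m}. F i) = (\<Oplus>i\<in>{..<p}. F i) \<oplus> (\<Oplus>i\<in>{..<m}. F (p + i))"
  using assms
proof (induction m)
  case (Suc m)
  have F: "F \<in> {..<p + m} \<rightarrow> carrier G" "F (p + m) \<in> carrier G" "F \<in> {..<p} \<rightarrow> carrier G"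
    "(\<lambda>i. F (p + i)) \<in> {..<m} \<rightarrow> carrier G"
    using Suc.prems by auto
  have "(\<Oplus>i\<in>{..<p + Suc m}. F i) = F (p + m) \<oplus> (\<Oplus>i\<in>{..<p + m}. F i)"
    using F by (simp add: lessThan_Suc finsum_insert)
  also have "(\<Oplus>i\<in>{..<p + m}. F i) = (\<Oplus>i\<in>{..<p}. F i) \<oplus> (\<Oplus>i\<in>{..<m}. F (p + i))"
    by (rule Suc.IH[OF F(1)])
  also have "F (p + m) \<oplus> \<dots> = (\<Oplus>i\<in>{..<p}. F i) \<oplus> (F (p + m) \<oplus> (\<Oplus>i\<in>{..<m}. F (p + i)))"
    using F by (simp add: a_lcomm finsum_closed)
  also have "F (p + m) \<oplus> (\<Oplus>i\<in>{..<m}. F (p + i)) = (\<Oplus>i\<in>{..<Suc m}. F (p + i))"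
    using F by (simp add: lessThan_Suc finsum_insert)
  finally show ?case .
qed (simp add: finsum_closed)

lemma residue_index_less:
  fixes i j m s :: nat
  assumes "i < m" "j < s"
  shows "i + m * j < m * s"
proof -
  have "i + m * j < m * Suc j" using assms by simp
  also have "\<dots> \<le> m * s" using assms by (intro mult_le_mono2) simp
  finally show ?thesis .
qed

text \<open>Sorting the indices by their residue modulo \<open>m\<close>.\<close>

lemma (in abelian_monoid) finsum_residues:
  fixes m s :: nat
  assumes "F \<in> {..<m * s} \<rightarrow> carrier G"
  shows "(\<Oplus>i\<in>{..<m * s}. F i) = (\<Oplus>i\<in>{..<m}. \<Oplus>j\<in>{..<s}. F (i + m * j))"
  using assms
proof (induction s)
  case 0
  have "(\<Oplus>i\<in>{..<m}. \<zero>) = \<zero>" by (rule finsum_zero)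
  then show ?case by simp
next
  case (Suc s)
  have F: "F (i + m * j) \<in> carrier G" if "i < m" "j < Suc s" for i j
    using Suc.prems residue_index_less[OF that] by auto
  have inner: "(\<Oplus>j\<in>{..<s}. F (i + m * j)) \<in> carrier G" if "i < m" for i
    using F that by (intro finsum_closed) auto
  have "(\<Oplus>i\<in>{..<m * Suc s}. F i) = (\<Oplus>i\<in>{..<m * s + m}. F i)" by (simp add: add.commute)
  also have "\<dots> = (\<Oplus>i\<in>{..<m * s}. F i) \<oplus> (\<Oplus>i\<in>{..<m}. F (m * s + i))"
    by (rule finsum_lessThan_add) (use Suc.prems in \<open>simp add: add.commute\<close>)
  also have "(\<Oplus>i\<in>{..<m * s}. F i) = (\<Oplus>i\<in>{..<m}. \<Oplus>j\<in>{..<s}. F (i + m * j))"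
    by (rule Suc.IH) (use Suc.prems in auto)
  also have "\<dots> \<oplus> (\<Oplus>i\<in>{..<m}. F (m * s + i)) = (\<Oplus>i\<in>{..<m}. (\<Oplus>j\<in>{..<s}. F (i + m * j)) \<oplus> F (m * s + i))"
    by (rule finsum_addf[symmetric]) (use inner F[of _ s] in \<open>auto simp: add.commute\<close>)
  also have "\<dots> = (\<Oplus>i\<in>{..<m}. \<Oplus>j\<in>{..<Suc s}. F (i + m * j))"
  proof (rule finsum_cong')
    fix i assume "i \<in> {..<m}"
    then have i: "i < m" by simp
    have "(\<Oplus>j\<in>{..<Suc s}. F (i + m * j)) = F (i + m * s) \<oplus> (\<Oplus>j\<in>{..<s}. F (i + m * j))"
      unfolding lessThan_Suc by (rule finsum_insert) (use F[OF i] in auto)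
    then show "(\<Oplus>j\<in>{..<s}. F (i + m * j)) \<oplus> F (m * s + i) = (\<Oplus>j\<in>{..<Suc s}. F (i + m * j))"
      using inner[OF i] F[OF i, of s] by (simp add: a_comm add.commute)
  next
    show "(\<lambda>i. \<Oplus>j\<in>{..<Suc s}. F (i + m * j)) \<in> {..<m} \<rightarrow> carrier G"
      using F by (intro Pi_I finsum_closed) auto
  qed simp
  finally show ?case .
qed

section \<open>Endomorphism rings\<close>

context module
begin

abbreviation "E \<equiv> module_End R M"
abbreviation "scal \<equiv> scalar_End M"

lemma End_simps:
  "monoid.mult E = (\<lambda>f g. compose (carrier M) f g)"
  "\<one>\<^bsub>E\<^esub> = (\<lambda>v\<in>carrier M. v)"
  "\<zero>\<^bsub>E\<^esub> = (\<lambda>v\<in>carrier M. \<zero>\<^bsub>M\<^esub>)"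
  "add E = (\<lambda>f g. \<lambda>v\<in>carrier M. f v \<oplus>\<^bsub>M\<^esub> g v)"
  by (simp_all add: module_End_def)

lemma End_memD:
  assumes "f \<in> carrier E"
  shows "f \<in> extensional (carrier M)"
    and "v \<in> carrier M \<Longrightarrow> f v \<in> carrier M"
    and "v \<in> carrier M \<Longrightarrow> w \<in> carrier M \<Longrightarrow> f (v \<oplus>\<^bsub>M\<^esub> w) = f v \<oplus>\<^bsub>M\<^esub> f w"
    and "a \<in> carrier R \<Longrightarrow> v \<in> carrier M \<Longrightarrow> f (a \<odot>\<^bsub>M\<^esub> v) = a \<odot>\<^bsub>M\<^esub> f v"
  using assms by (auto simp: module_End_def PiE_iff)

lemma End_memI:
  assumes "f \<in> extensional (carrier M)"
    and "\<And>v. v \<in> carrier M \<Longrightarrow> f v \<in> carrier M"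
    and "\<And>v w. v \<in> carrier M \<Longrightarrow> w \<in> carrier M \<Longrightarrow> f (v \<oplus>\<^bsub>M\<^esub> w) = f v \<oplus>\<^bsub>M\<^esub> f w"
    and "\<And>a v. a \<in> carrier R \<Longrightarrow> v \<in> carrier M \<Longrightarrow> f (a \<odot>\<^bsub>M\<^esub> v) = a \<odot>\<^bsub>M\<^esub> f v"
  shows "f \<in> carrier E"
  using assms by (simp add: module_End_def PiE_iff)

lemma End_eqI:
  assumes "f \<in> carrier E" "g \<in> carrier E" "\<And>v. v \<in> carrier M \<Longrightarrow> f v = g v"
  shows "f = g"
  by (rule extensionalityI[OF End_memD(1)[OF assms(1)] End_memD(1)[OF assms(2)] assms(3)])

lemma End_apply [simp]:
  "v \<in> carrier M \<Longrightarrow> (f \<otimes>\<^bsub>E\<^esub> g) v = f (g v)"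
  "v \<in> carrier M \<Longrightarrow> (f \<oplus>\<^bsub>E\<^esub> g) v = f v \<oplus>\<^bsub>M\<^esub> g v"
  "v \<in> carrier M \<Longrightarrow> \<one>\<^bsub>E\<^esub> v = v"
  "v \<in> carrier M \<Longrightarrow> \<zero>\<^bsub>E\<^esub> v = \<zero>\<^bsub>M\<^esub>"
  "v \<in> carrier M \<Longrightarrow> scal a v = a \<odot>\<^bsub>M\<^esub> v"
  by (simp_all add: End_simps compose_def scalar_End_def)

lemma End_ext:
  "f \<otimes>\<^bsub>E\<^esub> g \<in> extensional (carrier M)" "f \<oplus>\<^bsub>E\<^esub> g \<in> extensional (carrier M)"
  "\<one>\<^bsub>E\<^esub> \<in> extensional (carrier M)" "\<zero>\<^bsub>E\<^esub> \<in> extensional (carrier M)"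
  "scal a \<in> extensional (carrier M)"
  by (simp_all add: End_simps compose_def scalar_End_def)

lemma End_closed:
  assumes "f \<in> carrier E" "g \<in> carrier E"
  shows "f \<otimes>\<^bsub>E\<^esub> g \<in> carrier E" "f \<oplus>\<^bsub>E\<^esub> g \<in> carrier E"
  by (rule End_memI; use End_memD[OF assms(1)] End_memD[OF assms(2)] in
      \<open>simp add: End_ext smult_r_distr M.a_ac\<close>)+

lemma End_const_closed: "\<one>\<^bsub>E\<^esub> \<in> carrier E" "\<zero>\<^bsub>E\<^esub> \<in> carrier E"
  by (rule End_memI; simp add: End_ext)+

lemma scal_closed: "a \<in> carrier R \<Longrightarrow> scal a \<in> carrier E"
  by (rule End_memI) (simp_all add: End_ext smult_r_distr smult_assoc1[symmetric] R.m_comm)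

lemma End_ring: "ring E"
proof (rule ringI)
  show "abelian_group E"
  proof (rule abelian_groupI)
    fix f assume f: "f \<in> carrier E"
    let ?g = "\<lambda>v\<in>carrier M. \<ominus>\<^bsub>M\<^esub> f v"
    have g: "?g \<in> carrier E"
      by (rule End_memI) (use End_memD[OF f] in \<open>simp_all add: M.minus_add smult_r_minus\<close>)
    have "?g \<oplus>\<^bsub>E\<^esub> f = \<zero>\<^bsub>E\<^esub>"
      by (rule End_eqI[OF End_closed(2)[OF g f] End_const_closed(2)])
         (use End_memD[OF f] in \<open>simp add: M.l_neg\<close>)
    then show "\<exists>y\<in>carrier E. y \<oplus>\<^bsub>E\<^esub> f = \<zero>\<^bsub>E\<^esub>" using g by blast
    show "\<zero>\<^bsub>E\<^esub> \<oplus>\<^bsub>E\<^esub> f = f"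
      by (rule End_eqI[OF End_closed(2)[OF End_const_closed(2) f] f]) (use End_memD[OF f] in simp)
  next
    fix f g k assume f: "f \<in> carrier E" and g: "g \<in> carrier E" and k: "k \<in> carrier E"
    show "f \<oplus>\<^bsub>E\<^esub> g \<oplus>\<^bsub>E\<^esub> k = f \<oplus>\<^bsub>E\<^esub> (g \<oplus>\<^bsub>E\<^esub> k)"
      by (rule End_eqI) (use End_memD[OF f] End_memD[OF g] End_memD[OF k] f g k in
        \<open>simp_all add: End_closed M.a_assoc\<close>)
  next
    fix f g assume f: "f \<in> carrier E" and g: "g \<in> carrier E"
    show "f \<oplus>\<^bsub>E\<^esub> g = g \<oplus>\<^bsub>E\<^esub> f"
      by (rule End_eqI) (use End_memD[OF f] End_memD[OF g] f g in \<open>simp_all add: End_closed M.a_comm\<close>)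
  qed (simp_all add: End_closed End_const_closed)
  show "monoid E"
  proof (rule monoidI)
    fix f g k assume f: "f \<in> carrier E" and g: "g \<in> carrier E" and k: "k \<in> carrier E"
    show "f \<otimes>\<^bsub>E\<^esub> g \<otimes>\<^bsub>E\<^esub> k = f \<otimes>\<^bsub>E\<^esub> (g \<otimes>\<^bsub>E\<^esub> k)"
      by (rule End_eqI) (use End_memD[OF k] f g k in \<open>simp_all add: End_closed\<close>)
  next
    fix f assume f: "f \<in> carrier E"
    show "\<one>\<^bsub>E\<^esub> \<otimes>\<^bsub>E\<^esub> f = f" "f \<otimes>\<^bsub>E\<^esub> \<one>\<^bsub>E\<^esub> = f"
      by (rule End_eqI; use End_memD[OF f] f in \<open>simp add: End_closed End_const_closed\<close>)+
  qed (simp_all add: End_closed End_const_closed)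
next
  fix f g k assume f: "f \<in> carrier E" and g: "g \<in> carrier E" and k: "k \<in> carrier E"
  show "(f \<oplus>\<^bsub>E\<^esub> g) \<otimes>\<^bsub>E\<^esub> k = f \<otimes>\<^bsub>E\<^esub> k \<oplus>\<^bsub>E\<^esub> g \<otimes>\<^bsub>E\<^esub> k"
    "k \<otimes>\<^bsub>E\<^esub> (f \<oplus>\<^bsub>E\<^esub> g) = k \<otimes>\<^bsub>E\<^esub> f \<oplus>\<^bsub>E\<^esub> k \<otimes>\<^bsub>E\<^esub> g"
    by (rule End_eqI; use End_memD[OF f] End_memD[OF g] End_memD[OF k] f g k in \<open>simp add: End_closed\<close>)+
qed

sublocale End: ring E by (rule End_ring)

lemma scal_hom: "scal \<in> ring_hom R E"
proof (rule ring_hom_memI)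
  show "scal \<one>\<^bsub>R\<^esub> = \<one>\<^bsub>E\<^esub>" by (rule End_eqI) (simp_all add: scal_closed)
  fix a b assume ab: "a \<in> carrier R" "b \<in> carrier R"
  show "scal a \<in> carrier E" using ab by (simp add: scal_closed)
  show "scal (a \<otimes>\<^bsub>R\<^esub> b) = scal a \<otimes>\<^bsub>E\<^esub> scal b" "scal (a \<oplus>\<^bsub>R\<^esub> b) = scal a \<oplus>\<^bsub>E\<^esub> scal b"
    by (rule End_eqI; use ab in \<open>simp add: scal_closed smult_assoc1 smult_l_distr\<close>)+
qed

lemma scal_commute:
  assumes "a \<in> carrier R" "f \<in> carrier E"
  shows "scal a \<otimes>\<^bsub>E\<^esub> f = f \<otimes>\<^bsub>E\<^esub> scal a"
  by (rule End_eqI) (use assms End_memD[OF assms(2)] in \<open>simp_all add: scal_closed\<close>)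

lemma End_finsum_apply:
  assumes "finite I" "F \<in> I \<rightarrow> carrier E" "v \<in> carrier M"
  shows "(\<Oplus>\<^bsub>E\<^esub>i\<in>I. F i) v = (\<Oplus>\<^bsub>M\<^esub>i\<in>I. F i v)"
  using assms(1,2)
proof (induction I rule: finite_induct)
  case (insert j I)
  then have 1: "F \<in> I \<rightarrow> carrier E" "F j \<in> carrier E" by auto
  then have 2: "(\<lambda>i. F i v) \<in> I \<rightarrow> carrier M" "F j v \<in> carrier M"
    using assms(3) End_memD(2) by auto
  show ?case using insert 1 2 assms(3) by (simp add: M.finsum_insert)
qed (use assms(3) in simp)

lemma adjoin_subcring:
  assumes f: "f \<in> carrier E"
  shows "subcring (adjoin_End R M f) E"
  unfolding adjoin_End_def
proof (rule End.generate_ring_commute)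
  show sub: "insert f (scal ` carrier R) \<subseteq> carrier E" using f scal_closed by blast
  fix x y assume x: "x \<in> insert f (scal ` carrier R)" and y: "y \<in> insert f (scal ` carrier R)"
  then have car: "x \<in> carrier E" "y \<in> carrier E" using sub by blast+
  consider "x = f" "y = f" | a where "a \<in> carrier R" "x = scal a" | a where "a \<in> carrier R" "y = scal a"
    using x y by blast
  then show "x \<otimes>\<^bsub>E\<^esub> y = y \<otimes>\<^bsub>E\<^esub> x"
  proof cases
    case 2
    then show ?thesis using scal_commute[OF _ car(2)] by blast
  next
    case 3
    then show ?thesis using scal_commute[OF _ car(1)] by metis
  qed simp
qed

lemma adjoin_incl:
  "f \<in> adjoin_End R M f" "a \<in> carrier R \<Longrightarrow> scal a \<in> adjoin_End R M f"
  unfolding adjoin_End_def by (auto intro: generate_ring.incl)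

lemma module_evaluation:
  assumes L: "subcring L E"
  shows "module (E\<lparr>carrier := L\<rparr>) (evaluation_module M)"
proof (rule moduleI)
  have LE: "L \<subseteq> carrier E" using L by (rule subcringE)
  show "cring (E\<lparr>carrier := L\<rparr>)" using L End.subcring_iff[OF LE] by simp
  show "abelian_group (evaluation_module M)"
    by (rule abelian_groupI) (auto simp: evaluation_module_def M.a_ac intro: M.l_neg)
qed (use subcringE(1)[OF L] End_memD in \<open>auto simp: evaluation_module_def\<close>)

end

lemma (in ring) module_regular:
  assumes K: "subcring K R" and L: "subcring L R" and KL: "K \<subseteq> L"
  shows "module (R\<lparr>carrier := K\<rparr>) (regular_module (R\<lparr>carrier := L\<rparr>))"
proof (rule moduleI)
  have LR: "L \<subseteq> carrier R" using L by (rule subcringE)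
  show "cring (R\<lparr>carrier := K\<rparr>)" using K subcring_iff[OF subcringE(1)[OF K]] by simp
  have in_R: "x \<in> carrier R" if "x \<in> L" for x using LR that by blast
  show "abelian_group (regular_module (R\<lparr>carrier := L\<rparr>))"
  proof (rule abelian_groupI)
    fix x assume "x \<in> carrier (regular_module (R\<lparr>carrier := L\<rparr>))"
    then have "x \<in> L" by (simp add: regular_module_def)
    then show "\<exists>y\<in>carrier (regular_module (R\<lparr>carrier := L\<rparr>)).
        y \<oplus>\<^bsub>regular_module (R\<lparr>carrier := L\<rparr>)\<^esub> x = \<zero>\<^bsub>regular_module (R\<lparr>carrier := L\<rparr>)\<^esub>"
      using in_R subcringE(5)[OF L] by (intro bexI[of _ "\<ominus> x"]) (simp_all add: regular_module_def l_neg)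
  qed (use subcringE(2,7)[OF L] in \<open>simp_all add: regular_module_def a_ac in_R\<close>)
qed (use subcringE(1)[OF L] KL in \<open>auto simp: regular_module_def subcringE(6)[OF L] l_distr r_distr m_assoc subset_iff\<close>)

lemma (in ring) finsum_regular:
  assumes "subring L R" "F \<in> A \<rightarrow> L"
  shows "finsum (regular_module (R\<lparr>carrier := L\<rparr>)) F A = finsum R F A"
proof -
  have "finsum (regular_module (R\<lparr>carrier := L\<rparr>)) F A = finsum (R\<lparr>carrier := L\<rparr>) F A"
    by (simp add: finsum_def finprod_def regular_module_def)
  then show ?thesis by (simp add: finsum_subring[OF assms])
qed

section \<open>Endomorphisms satisfying a binomial equation\<close>

text \<open>
  An endomorphism \<open>f\<close> of a finite vector space with \<open>f\<^sup>n = c\<close> whose powers below \<open>n\<close> are independent,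
  on a space of dimension at most \<open>n\<close>. Applied to \<open>\<pi>\<close> on the torsion module.
\<close>

locale binomial_endomorphism = module R M for R (structure) and M (structure) +
  fixes f n c
  assumes R_field: "field R" and finR: "finite (carrier R)" and finM: "finite (carrier M)"
    and f: "f \<in> carrier (module_End R M)" and n_pos: "n > (0::nat)" and c: "c \<in> carrier R"
    and root: "f [^]\<^bsub>module_End R M\<^esub> n = scalar_End M c"
    and indep: "\<And>a. a \<in> {..<n} \<rightarrow> carrier R \<Longrightarrow>
      (\<Oplus>\<^bsub>module_End R M\<^esub>i\<in>{..<n}. scalar_End M (a i) \<otimes>\<^bsub>module_End R M\<^esub> f [^]\<^bsub>module_End R M\<^esub> i) = \<zero>\<^bsub>module_End R M\<^esub> \<Longrightarrow>
      \<forall>i<n. a i = \<zero>"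
    and card_le: "card (carrier M) \<le> card (carrier R) ^ n"
begin

definition adj where "adj m = adjoin_End R M (f [^]\<^bsub>E\<^esub> (m::nat))"

lemma pow_closed [simp]: "f [^]\<^bsub>E\<^esub> (i::nat) \<in> carrier E"
  using f by simp

lemma adj_subcring: "subcring (adj m) E"
  unfolding adj_def by (rule adjoin_subcring) simp

lemma adj_incl: "f [^]\<^bsub>E\<^esub> m \<in> adj m" "a \<in> carrier R \<Longrightarrow> scal a \<in> adj m"
  unfolding adj_def by (rule adjoin_incl)+

lemma adj_subring: "subring (adj m) E"
  using adj_subcring by (rule subcring.axioms)

lemma adj_subset: "adj m \<subseteq> carrier E"
  using adj_subcring by (rule subcringE)

lemma pow_in_adj: "f [^]\<^bsub>E\<^esub> (m * j) \<in> adj m"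
proof (induction j)
  case 0
  show ?case using subcringE(3)[OF adj_subcring] by simp
next
  case (Suc j)
  have "f [^]\<^bsub>E\<^esub> (m * Suc j) = f [^]\<^bsub>E\<^esub> (m * j) \<otimes>\<^bsub>E\<^esub> f [^]\<^bsub>E\<^esub> m"
    using f by (simp add: End.nat_pow_mult add.commute)
  then show ?case using Suc adj_incl(1) subcringE(6)[OF adj_subcring] by simp
qed

lemma adj_mono: "adj m \<subseteq> adj 1"
proof -
  have "insert (f [^]\<^bsub>E\<^esub> m) (scal ` carrier R) \<subseteq> adj 1"
    using pow_in_adj[of 1 m] adj_incl(2) by auto
  then show ?thesis unfolding adj_def[of m] adjoin_End_def
    by (intro End.generate_ring_min_subring1 adj_subring) (use scal_closed in auto)
qed

lemma pow_in_adj_1: "f [^]\<^bsub>E\<^esub> (i::nat) \<in> adj 1"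
  using pow_in_adj[of 1 i] by simp

lemma mult_pow_in_adj_1: "x \<in> adj m \<Longrightarrow> x \<otimes>\<^bsub>E\<^esub> f [^]\<^bsub>E\<^esub> (i::nat) \<in> adj 1"
  using adj_mono[of m] pow_in_adj_1[of i] subcringE(6)[OF adj_subcring[of 1]] by blast

definition combination :: "nat \<Rightarrow> nat \<Rightarrow> (nat \<Rightarrow> 'a) \<Rightarrow> 'c \<Rightarrow> 'c" where
  "combination m k a = (\<Oplus>\<^bsub>E\<^esub>i\<in>{..<k}. scal (a i) \<otimes>\<^bsub>E\<^esub> (f [^]\<^bsub>E\<^esub> m) [^]\<^bsub>E\<^esub> i)"

lemma combination_terms:
  fixes k :: nat
  assumes "a \<in> {..<k} \<rightarrow> carrier R"
  shows "(\<lambda>i. scal (a i) \<otimes>\<^bsub>E\<^esub> (f [^]\<^bsub>E\<^esub> m) [^]\<^bsub>E\<^esub> i) \<in> {..<k} \<rightarrow> adj m"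
proof (rule Pi_I)
  fix i assume "i \<in> {..<k}"
  then have "scal (a i) \<in> adj m" using assms adj_incl(2) by auto
  moreover have "(f [^]\<^bsub>E\<^esub> m) [^]\<^bsub>E\<^esub> i \<in> adj m"
    using pow_in_adj[of m i] f by (simp add: End.nat_pow_pow)
  ultimately show "scal (a i) \<otimes>\<^bsub>E\<^esub> (f [^]\<^bsub>E\<^esub> m) [^]\<^bsub>E\<^esub> i \<in> adj m"
    using subcringE(6)[OF adj_subcring] by blast
qed

lemma combination_in_adj: "a \<in> {..<k} \<rightarrow> carrier R \<Longrightarrow> combination m k a \<in> adj m"
  unfolding combination_def by (rule End.finsum_in_subring[OF adj_subring combination_terms])

lemma combination_cong:
  assumes "a \<in> {..<k} \<rightarrow> carrier R" "\<And>i. i < k \<Longrightarrow> a i = b i"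
  shows "combination m k a = combination m k b"
  unfolding combination_def
proof (rule End.finsum_cong')
  have "b \<in> {..<k} \<rightarrow> carrier R" using assms by (auto simp: Pi_iff)
  from combination_terms[OF this, of m]
  show "(\<lambda>i. scal (b i) \<otimes>\<^bsub>E\<^esub> (f [^]\<^bsub>E\<^esub> m) [^]\<^bsub>E\<^esub> i) \<in> {..<k} \<rightarrow> carrier E"
    using adj_subset[of m] by blast
qed (use assms in auto)

text \<open>
  Division with remainder \<open>k = i + m j\<close> of the exponents: with \<open>u = f\<^sup>m\<close>,
  \<open>\<Sum>\<^sub>k a\<^sub>k f\<^sup>k = \<Sum>\<^sub>i (\<Sum>\<^sub>j a\<^bsub>i+mj\<^esub> u\<^sup>j) f\<^sup>i\<close>. This is the source of the structure of
  \<open>K[f]\<close> over \<open>K[u]\<close>.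
\<close>

lemma combination_tower:
  assumes A: "A \<in> {..<m * s} \<rightarrow> carrier R"
  shows "combination 1 (m * s) A =
    (\<Oplus>\<^bsub>E\<^esub>i\<in>{..<m}. combination m s (\<lambda>j. A (i + m * j)) \<otimes>\<^bsub>E\<^esub> f [^]\<^bsub>E\<^esub> i)"
proof -
  let ?F = "\<lambda>k. scal (A k) \<otimes>\<^bsub>E\<^esub> f [^]\<^bsub>E\<^esub> k"
  have F: "?F \<in> {..<m * s} \<rightarrow> carrier E" using A scal_closed by (simp add: Pi_iff)
  have "combination 1 (m * s) A = (\<Oplus>\<^bsub>E\<^esub>k\<in>{..<m * s}. ?F k)"
    using f by (simp add: combination_def)
  also have "\<dots> = (\<Oplus>\<^bsub>E\<^esub>i\<in>{..<m}. \<Oplus>\<^bsub>E\<^esub>j\<in>{..<s}. ?F (i + m * j))"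
    by (rule End.finsum_residues[OF F])
  also have "\<dots> = (\<Oplus>\<^bsub>E\<^esub>i\<in>{..<m}. combination m s (\<lambda>j. A (i + m * j)) \<otimes>\<^bsub>E\<^esub> f [^]\<^bsub>E\<^esub> i)"
  proof (rule End.finsum_cong')
    fix i assume "i \<in> {..<m}"
    then have i: "i < m" by simp
    have Ai: "(\<lambda>j. A (i + m * j)) \<in> {..<s} \<rightarrow> carrier R" using A residue_index_less[OF i] by (simp add: Pi_iff)
    let ?G = "\<lambda>j. scal (A (i + m * j)) \<otimes>\<^bsub>E\<^esub> (f [^]\<^bsub>E\<^esub> m) [^]\<^bsub>E\<^esub> j"
    have G: "?G \<in> {..<s} \<rightarrow> carrier E" using combination_terms[OF Ai, of m] adj_subset[of m] by blast
    have "combination m s (\<lambda>j. A (i + m * j)) \<otimes>\<^bsub>E\<^esub> f [^]\<^bsub>E\<^esub> i =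
       (\<Oplus>\<^bsub>E\<^esub>j\<in>{..<s}. ?G j \<otimes>\<^bsub>E\<^esub> f [^]\<^bsub>E\<^esub> i)"
      unfolding combination_def by (rule End.finsum_ldistr) (use G in auto)
    also have "\<dots> = (\<Oplus>\<^bsub>E\<^esub>j\<in>{..<s}. ?F (i + m * j))"
    proof (rule End.finsum_cong')
      fix j assume "j \<in> {..<s}"
      then have "scal (A (i + m * j)) \<in> carrier E" using Ai scal_closed by (simp add: Pi_iff)
      then show "?G j \<otimes>\<^bsub>E\<^esub> f [^]\<^bsub>E\<^esub> i = ?F (i + m * j)"
        using f by (simp add: End.m_assoc End.nat_pow_pow End.nat_pow_mult add.commute)
    qed (use F residue_index_less[OF i] in \<open>simp_all add: Pi_iff\<close>)
    finally show "(\<Oplus>\<^bsub>E\<^esub>j\<in>{..<s}. ?F (i + m * j)) = combination m s (\<lambda>j. A (i + m * j)) \<otimes>\<^bsub>E\<^esub> f [^]\<^bsub>E\<^esub> i"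
      by simp
  next
    show "(\<lambda>i. combination m s (\<lambda>j. A (i + m * j)) \<otimes>\<^bsub>E\<^esub> f [^]\<^bsub>E\<^esub> i) \<in> {..<m} \<rightarrow> carrier E"
    proof (rule Pi_I)
      fix i assume "i \<in> {..<m}"
      then have "(\<lambda>j. A (i + m * j)) \<in> {..<s} \<rightarrow> carrier R" using A residue_index_less by (simp add: Pi_iff)
      then have "combination m s (\<lambda>j. A (i + m * j)) \<in> carrier E"
        using combination_in_adj adj_subset by blast
      then show "combination m s (\<lambda>j. A (i + m * j)) \<otimes>\<^bsub>E\<^esub> f [^]\<^bsub>E\<^esub> i \<in> carrier E" by simp
    qed
  qed simp
  finally show ?thesis .
qed

lemma combination_zero:
  assumes "\<And>i. i < k \<Longrightarrow> a i = \<zero>"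
  shows "combination m k a = \<zero>\<^bsub>E\<^esub>"
proof -
  have "scal \<zero> = \<zero>\<^bsub>E\<^esub>" by (rule End_eqI) (simp_all add: scal_closed)
  then have "combination m k a = (\<Oplus>\<^bsub>E\<^esub>i\<in>{..<k}. \<zero>\<^bsub>E\<^esub>)"
    unfolding combination_def using assms by (intro End.finsum_cong') auto
  then show ?thesis by simp
qed

text \<open>
  The case \<open>m = 1\<close> describes \<open>K[f]\<close> itself. Powers of \<open>f\<^sup>m\<close> below \<open>s\<close> are powers of \<open>f\<close> below
  \<open>n\<close>, whence their independence.
\<close>

lemma binomial_generator_power:
  assumes n: "n = m * s"
  shows "binomial_generator R (E\<lparr>carrier := adj m\<rparr>) scal (f [^]\<^bsub>E\<^esub> m) s c"
proof -
  let ?B = "E\<lparr>carrier := adj m\<rparr>" and ?u = "f [^]\<^bsub>E\<^esub> m"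
  have B: "cring ?B" using adj_subcring End.subcring_iff[OF adj_subset] by simp
  have pow: "?u [^]\<^bsub>?B\<^esub> (i::nat) = ?u [^]\<^bsub>E\<^esub> i" for i
    by (rule End.nat_pow_consistent[symmetric])
  have hom: "scal \<in> ring_hom R ?B"
    using scal_hom adj_incl(2) by (auto simp: ring_hom_def)
  show ?thesis
  proof (intro binomial_generator.intro binomial_generator_axioms.intro)
    show "ring_hom_cring R ?B scal" by (rule ring_hom_cringI[OF R.is_cring B hom])
    show "?u \<in> carrier ?B" using adj_incl(1) by simp
    show "0 < s" using n n_pos by (cases s) auto
    show "c \<in> carrier R" by (rule c)
    show "?u [^]\<^bsub>?B\<^esub> s = scal c" unfolding pow using f root n by (simp add: End.nat_pow_pow)
    show "\<one> \<noteq> \<zero>" using R_field by (simp add: field.axioms(1) domain.one_not_zero)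
    fix U assume U: "subring U ?B" "scal ` carrier R \<subseteq> U" "?u \<in> U"
    have "adj m \<subseteq> U" unfolding adj_def adjoin_End_def
      by (rule End.generate_ring_min_subring1)
         (use U End.subring_of_subring[OF adj_subring U(1)] scal_closed in auto)
    then show "carrier ?B \<subseteq> U" by simp
  next
    fix a assume a: "a \<in> {..<s} \<rightarrow> carrier R"
      and "(\<Oplus>\<^bsub>?B\<^esub>i\<in>{..<s}. scal (a i) \<otimes>\<^bsub>?B\<^esub> ?u [^]\<^bsub>?B\<^esub> i) = \<zero>\<^bsub>?B\<^esub>"
    then have a0: "combination m s a = \<zero>\<^bsub>E\<^esub>"
      unfolding pow using End.finsum_subring[OF adj_subring combination_terms[OF a]]
      by (simp add: combination_def)
    have m_pos: "m > 0" using n n_pos by (cases m) auto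
    \<comment> \<open>The coefficients of the same element as a combination of powers of \<open>f\<close>.\<close>
    define A where "A k = (if k mod m = 0 then a (k div m) else \<zero>)" for k
    have A: "A \<in> {..<m * s} \<rightarrow> carrier R"
      using a by (auto simp: A_def less_mult_imp_div_less mult.commute Pi_iff)
    have zero: "combination m s (\<lambda>j. A (i + m * j)) = \<zero>\<^bsub>E\<^esub>" if "i < m" for i
    proof (cases "i = 0")
      case True
      then have "(\<lambda>j. A (i + m * j)) = a" using m_pos by (simp add: A_def fun_eq_iff)
      then show ?thesis using a0 by simp
    next
      case False
      then show ?thesis using that by (intro combination_zero) (simp add: A_def)
    qed
    have "combination 1 (m * s) A = (\<Oplus>\<^bsub>E\<^esub>i\<in>{..<m}. \<zero>\<^bsub>E\<^esub>)"
      unfolding combination_tower[OF A] by (rule End.finsum_cong') (simp_all add: zero)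
    then have "combination 1 n A = \<zero>\<^bsub>E\<^esub>" by (simp add: n)
    then have "\<forall>k<n. A k = \<zero>" using f A by (intro indep) (simp_all add: combination_def n)
    then show "\<forall>j<s. a j = \<zero>"
      using m_pos n by (auto simp: A_def dest: spec[of _ "m * _"])
  qed
qed

end

context binomial_endomorphism
begin

abbreviation ring_adj where "ring_adj m \<equiv> E\<lparr>carrier := adj m\<rparr>"
abbreviation reg where "reg \<equiv> regular_module (ring_adj 1)"

lemma expansion:
  assumes n: "n = m * s" and b: "b \<in> adj m"
  obtains a where "a \<in> {..<s} \<rightarrow>\<^sub>E carrier R" "b = combination m s a"
proof -
  interpret G: binomial_generator R "ring_adj m" scal "f [^]\<^bsub>E\<^esub> m" s c
    by (rule binomial_generator_power[OF n])
  have pow: "(f [^]\<^bsub>E\<^esub> m) [^]\<^bsub>ring_adj m\<^esub> (i::nat) = (f [^]\<^bsub>E\<^esub> m) [^]\<^bsub>E\<^esub> i" for i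
    by (rule End.nat_pow_consistent[symmetric])
  have "b \<in> carrier (ring_adj m)" using b by simp
  from G.expansion[OF this] obtain a where a: "a \<in> {..<s} \<rightarrow>\<^sub>E carrier R"
    "b = (\<Oplus>\<^bsub>ring_adj m\<^esub>i\<in>{..<s}. scal (a i) \<otimes>\<^bsub>ring_adj m\<^esub> (f [^]\<^bsub>E\<^esub> m) [^]\<^bsub>ring_adj m\<^esub> i)"
    by blast
  have "b = combination m s a"
    using a End.finsum_subring[OF adj_subring combination_terms[of a s m]]
    by (simp add: combination_def pow PiE_iff Pi_iff)
  with a(1) show ?thesis by (rule that)
qed

lemma combination_unique:
  assumes a: "a \<in> {..<n} \<rightarrow> carrier R" and b: "b \<in> {..<n} \<rightarrow> carrier R"
    and eq: "combination 1 n a = combination 1 n b" and "i < n"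
  shows "a i = b i"
proof -
  interpret G: binomial_generator R "ring_adj 1" scal "f [^]\<^bsub>E\<^esub> (1::nat)" n c
    by (rule binomial_generator_power) simp
  have pow: "(f [^]\<^bsub>E\<^esub> (1::nat)) [^]\<^bsub>ring_adj 1\<^esub> (i::nat) = (f [^]\<^bsub>E\<^esub> (1::nat)) [^]\<^bsub>E\<^esub> i" for i
    by (rule End.nat_pow_consistent[symmetric])
  have sum: "combination 1 n x = (\<Oplus>\<^bsub>ring_adj 1\<^esub>i\<in>{..<n}. scal (x i) \<otimes>\<^bsub>ring_adj 1\<^esub> (f [^]\<^bsub>E\<^esub> (1::nat)) [^]\<^bsub>ring_adj 1\<^esub> i)"
    if "x \<in> {..<n} \<rightarrow> carrier R" for x
  proof -
    have mult: "monoid.mult (ring_adj 1) = monoid.mult E" by simp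
    show ?thesis unfolding combination_def pow mult
      by (rule End.finsum_subring[OF adj_subring combination_terms[OF that], symmetric])
  qed
  show ?thesis
    by (rule G.expansion_unique[OF a b _ \<open>i < n\<close>]) (simp only: sum[OF a, symmetric] sum[OF b, symmetric] eq)
qed

lemma card_adj_1: "card (adj 1) = card (carrier R) ^ n" "finite (adj 1)"
proof -
  interpret G: binomial_generator R "ring_adj 1" scal "f [^]\<^bsub>E\<^esub> (1::nat)" n c
    by (rule binomial_generator_power) simp
  show "card (adj 1) = card (carrier R) ^ n" "finite (adj 1)"
    using G.card_carrier G.finite_carrier[OF finR] by simp_all
qed

lemma tower_coefficients:
  assumes n: "n = m * s" and b: "b \<in> {..<m} \<rightarrow>\<^sub>E adj m"
  obtains A where "A \<in> {..<n} \<rightarrow> carrier R" "\<And>i. i < m \<Longrightarrow> b i = combination m s (\<lambda>j. A (i + m * j))"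
    "(\<Oplus>\<^bsub>E\<^esub>i\<in>{..<m}. b i \<otimes>\<^bsub>E\<^esub> f [^]\<^bsub>E\<^esub> i) = combination 1 n A"
proof -
  have "\<exists>a. a \<in> {..<s} \<rightarrow>\<^sub>E carrier R \<and> b i = combination m s a" if "i < m" for i
    using expansion[OF n, of "b i"] b that by (metis PiE_mem lessThan_iff)
  then obtain a where a: "\<And>i. i < m \<Longrightarrow> a i \<in> {..<s} \<rightarrow>\<^sub>E carrier R"
    "\<And>i. i < m \<Longrightarrow> b i = combination m s (a i)" by metis
  have m_pos: "m > 0" using n n_pos by (cases m) auto
  define A where "A k = a (k mod m) (k div m)" for k
  have A: "A \<in> {..<n} \<rightarrow> carrier R"
  proof (rule Pi_I)
    fix k assume "k \<in> {..<n}"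
    then have "k div m < s" "k mod m < m"
      using m_pos by (simp_all add: n less_mult_imp_div_less mult.commute)
    then show "A k \<in> carrier R" using a(1)[of "k mod m"] by (auto simp: A_def PiE_iff)
  qed
  have bA: "b i = combination m s (\<lambda>j. A (i + m * j))" if "i < m" for i
    using a(2)[OF that] that by (simp add: A_def)
  have "combination 1 n A = (\<Oplus>\<^bsub>E\<^esub>i\<in>{..<m}. combination m s (\<lambda>j. A (i + m * j)) \<otimes>\<^bsub>E\<^esub> f [^]\<^bsub>E\<^esub> i)"
    using combination_tower[of A m s] A by (simp add: n)
  also have "\<dots> = (\<Oplus>\<^bsub>E\<^esub>i\<in>{..<m}. b i \<otimes>\<^bsub>E\<^esub> f [^]\<^bsub>E\<^esub> i)"
  proof (rule End.finsum_cong')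
    show "(\<lambda>i. b i \<otimes>\<^bsub>E\<^esub> f [^]\<^bsub>E\<^esub> i) \<in> {..<m} \<rightarrow> carrier E"
      using b adj_subset[of m] by (auto simp: PiE_iff)
  qed (simp_all add: bA)
  finally show ?thesis using that A bA by metis
qed

lemma module_regular_adj: "module (ring_adj m) reg"
  by (rule End.module_regular[OF adj_subcring adj_subcring adj_mono])

lemma finsum_regular_adj:
  fixes k :: nat
  assumes b: "b \<in> {..<k} \<rightarrow> adj m"
  shows "(\<Oplus>\<^bsub>reg\<^esub>i\<in>{..<k}. b i \<odot>\<^bsub>reg\<^esub> f [^]\<^bsub>E\<^esub> i) =
    (\<Oplus>\<^bsub>E\<^esub>i\<in>{..<k}. b i \<otimes>\<^bsub>E\<^esub> f [^]\<^bsub>E\<^esub> i)"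
proof -
  have "(\<lambda>i. b i \<otimes>\<^bsub>E\<^esub> f [^]\<^bsub>E\<^esub> i) \<in> {..<k} \<rightarrow> adj 1"
    using b mult_pow_in_adj_1[of _ m] by (simp add: Pi_iff)
  from End.finsum_regular[OF adj_subring this] show ?thesis by (simp add: regular_module_def)
qed

text \<open>
  By \<open>tower_coefficients\<close>, coefficients in \<open>K[f\<^sup>m]\<close> with respect to \<open>1, f, \<dots>, f\<^sup>m\<^sup>-\<^sup>1\<close> amount to
  coefficients in \<open>K\<close> with respect to the powers of \<open>f\<close> below \<open>n\<close>, and those are unique.
\<close>

lemma regular_expansion_ex1:
  assumes n: "n = m * s" and v: "v \<in> adj 1"
  shows "\<exists>!b. b \<in> {..<m} \<rightarrow>\<^sub>E adj m \<and>
    v = (\<Oplus>\<^bsub>reg\<^esub>i\<in>{..<m}. b i \<odot>\<^bsub>reg\<^esub> f [^]\<^bsub>E\<^esub> i)"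
proof (rule ex_ex1I)
  obtain A where A: "A \<in> {..<n} \<rightarrow>\<^sub>E carrier R" "v = combination 1 n A"
    using expansion[OF _ v, of n] by auto
  define b where "b = (\<lambda>i\<in>{..<m}. combination m s (\<lambda>j. A (i + m * j)))"
  have b: "b \<in> {..<m} \<rightarrow>\<^sub>E adj m"
    unfolding b_def restrict_PiE_iff
  proof
    fix i assume "i \<in> {..<m}"
    then have "(\<lambda>j. A (i + m * j)) \<in> {..<s} \<rightarrow> carrier R"
      using A(1) residue_index_less by (auto simp: n PiE_iff)
    then show "combination m s (\<lambda>j. A (i + m * j)) \<in> adj m" by (rule combination_in_adj)
  qed
  have "v = (\<Oplus>\<^bsub>E\<^esub>i\<in>{..<m}. combination m s (\<lambda>j. A (i + m * j)) \<otimes>\<^bsub>E\<^esub> f [^]\<^bsub>E\<^esub> i)"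
    using combination_tower[of A m s] A by (simp add: n PiE_iff Pi_iff)
  also have "\<dots> = (\<Oplus>\<^bsub>E\<^esub>i\<in>{..<m}. b i \<otimes>\<^bsub>E\<^esub> f [^]\<^bsub>E\<^esub> i)"
  proof (rule End.finsum_cong')
    show "(\<lambda>i. b i \<otimes>\<^bsub>E\<^esub> f [^]\<^bsub>E\<^esub> i) \<in> {..<m} \<rightarrow> carrier E"
      using b adj_subset[of m] by (auto simp: PiE_iff)
  qed (simp_all add: b_def)
  finally show "\<exists>b. b \<in> {..<m} \<rightarrow>\<^sub>E adj m \<and>
    v = (\<Oplus>\<^bsub>reg\<^esub>i\<in>{..<m}. b i \<odot>\<^bsub>reg\<^esub> f [^]\<^bsub>E\<^esub> i)"
    using b finsum_regular_adj[of b m m] by (intro exI[of _ b]) (simp add: PiE_iff Pi_iff)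
next
  fix b b'
  assume "b \<in> {..<m} \<rightarrow>\<^sub>E adj m \<and>
      v = (\<Oplus>\<^bsub>reg\<^esub>i\<in>{..<m}. b i \<odot>\<^bsub>reg\<^esub> f [^]\<^bsub>E\<^esub> i)"
    and "b' \<in> {..<m} \<rightarrow>\<^sub>E adj m \<and>
      v = (\<Oplus>\<^bsub>reg\<^esub>i\<in>{..<m}. b' i \<odot>\<^bsub>reg\<^esub> f [^]\<^bsub>E\<^esub> i)"
  then have b: "b \<in> {..<m} \<rightarrow>\<^sub>E adj m" "v = (\<Oplus>\<^bsub>E\<^esub>i\<in>{..<m}. b i \<otimes>\<^bsub>E\<^esub> f [^]\<^bsub>E\<^esub> i)"
    and b': "b' \<in> {..<m} \<rightarrow>\<^sub>E adj m" "v = (\<Oplus>\<^bsub>E\<^esub>i\<in>{..<m}. b' i \<otimes>\<^bsub>E\<^esub> f [^]\<^bsub>E\<^esub> i)"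
    using finsum_regular_adj[of b m m] finsum_regular_adj[of b' m m] by (simp_all add: PiE_iff Pi_iff)
  obtain A where A: "A \<in> {..<n} \<rightarrow> carrier R" "\<And>i. i < m \<Longrightarrow> b i = combination m s (\<lambda>j. A (i + m * j))"
    "v = combination 1 n A" using tower_coefficients[OF n b(1)] b(2) by metis
  obtain A' where A': "A' \<in> {..<n} \<rightarrow> carrier R" "\<And>i. i < m \<Longrightarrow> b' i = combination m s (\<lambda>j. A' (i + m * j))"
    "v = combination 1 n A'" using tower_coefficients[OF n b'(1)] b'(2) by metis
  have eq: "A k = A' k" if "k < n" for k
    by (rule combination_unique[OF A(1) A'(1) _ that]) (use A(3) A'(3) in simp)
  show "b = b'"
  proof (rule PiE_ext[OF b(1) b'(1)])
    fix i assume "i \<in> {..<m}"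
    then have i: "i < m" by simp
    have lt: "i + m * j < n" if "j < s" for j using residue_index_less[OF i that] n by simp
    have "combination m s (\<lambda>j. A (i + m * j)) = combination m s (\<lambda>j. A' (i + m * j))"
      by (rule combination_cong) (use A(1) lt eq in \<open>auto simp: Pi_iff\<close>)
    then show "b i = b' i" using A(2)[OF i] A'(2)[OF i] by simp
  qed
qed

theorem regular_free:
  assumes n: "n = m * s"
  shows "is_free_module (ring_adj m) reg m"
proof -
  have "(\<lambda>i. f [^]\<^bsub>E\<^esub> i) \<in> {..<m} \<rightarrow> carrier reg"
    using pow_in_adj_1 by (simp add: regular_module_def)
  moreover have "\<forall>v\<in>carrier reg. \<exists>!b. b \<in> {..<m} \<rightarrow>\<^sub>E carrier (ring_adj m) \<and>
      v = (\<Oplus>\<^bsub>reg\<^esub>i\<in>{..<m}. b i \<odot>\<^bsub>reg\<^esub> f [^]\<^bsub>E\<^esub> i)"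
    using regular_expansion_ex1[OF n] by (simp add: regular_module_def)
  ultimately show ?thesis
    unfolding is_free_module_def by (intro conjI module_regular_adj) (rule bexI)
qed

lemma adj_comm: "x \<in> adj 1 \<Longrightarrow> y \<in> adj 1 \<Longrightarrow> x \<otimes>\<^bsub>E\<^esub> y = y \<otimes>\<^bsub>E\<^esub> x"
  by (rule subcringE(8)[OF adj_subcring])

theorem regular_direct_sum:
  assumes n: "n = m * s"
  shows "is_internal_direct_sum (ring_adj m) reg {..<m}
    (\<lambda>i. (f [^]\<^bsub>E\<^esub> i) <#\<^bsub>E\<^esub> carrier (ring_adj m))"
proof -
  let ?N = "reg"
  let ?H = "\<lambda>i. (f [^]\<^bsub>E\<^esub> (i::nat)) <#\<^bsub>E\<^esub> carrier (ring_adj m)"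
  interpret N: module "ring_adj m" ?N by (rule module_regular_adj)
  have H: "?H i = {b \<otimes>\<^bsub>E\<^esub> f [^]\<^bsub>E\<^esub> i | b. b \<in> adj m}" for i
    using adj_comm[OF _ pow_in_adj_1] adj_mono[of m] unfolding l_coset_def by (auto simp: subset_iff) metis+
  have m1: "x \<in> adj 1" if "x \<in> adj m" for x using that adj_mono by blast
  have mE: "x \<in> carrier E" if "x \<in> adj m" for x using that adj_subset by blast
  have sub: "submodule (?H i) (ring_adj m) ?N" for i
  proof (rule N.submoduleI)
    show "?H i \<subseteq> carrier ?N"
      unfolding H using mult_pow_in_adj_1[of _ m] by (auto simp: regular_module_def)
    have "\<zero>\<^bsub>E\<^esub> = \<zero>\<^bsub>E\<^esub> \<otimes>\<^bsub>E\<^esub> f [^]\<^bsub>E\<^esub> i" by simp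
    then have "\<zero>\<^bsub>E\<^esub> \<in> ?H i"
      unfolding H using subcringE(2)[OF adj_subcring[of m]] by blast
    then show "\<zero>\<^bsub>?N\<^esub> \<in> ?H i" by (simp add: regular_module_def)
    have smult: "a \<odot>\<^bsub>?N\<^esub> x \<in> ?H i" if "a \<in> carrier (ring_adj m)" "x \<in> ?H i" for a x
    proof -
      obtain b where b: "b \<in> adj m" "x = b \<otimes>\<^bsub>E\<^esub> f [^]\<^bsub>E\<^esub> i" using \<open>x \<in> ?H i\<close> unfolding H by blast
      have "a \<odot>\<^bsub>?N\<^esub> x = (a \<otimes>\<^bsub>E\<^esub> b) \<otimes>\<^bsub>E\<^esub> f [^]\<^bsub>E\<^esub> i"
        using b mE that by (simp add: regular_module_def End.m_assoc)
      moreover have "a \<otimes>\<^bsub>E\<^esub> b \<in> adj m" using b that subcringE(6)[OF adj_subcring] by simp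
      ultimately show ?thesis unfolding H by blast
    qed
    then show "\<And>a x. a \<in> carrier (ring_adj m) \<Longrightarrow> x \<in> ?H i \<Longrightarrow> a \<odot>\<^bsub>?N\<^esub> x \<in> ?H i" .
    fix x assume x: "x \<in> ?H i"
    have xN: "x \<in> carrier ?N" using x \<open>?H i \<subseteq> carrier ?N\<close> by blast
    \<comment> \<open>Negation is multiplication by the scalar \<open>- 1\<close>.\<close>
    have "(\<ominus>\<^bsub>ring_adj m\<^esub> \<one>\<^bsub>ring_adj m\<^esub>) \<odot>\<^bsub>?N\<^esub> x \<in> ?H i"
      by (rule smult[OF _ x]) (rule N.R.a_inv_closed[OF N.R.one_closed])
    then show "\<ominus>\<^bsub>?N\<^esub> x \<in> ?H i" using xN by (simp only: N.smult_l_minus N.R.one_closed N.smult_one)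
    fix y assume y: "y \<in> ?H i"
    obtain b where b: "b \<in> adj m" "x = b \<otimes>\<^bsub>E\<^esub> f [^]\<^bsub>E\<^esub> i" using x unfolding H by blast
    obtain b' where b': "b' \<in> adj m" "y = b' \<otimes>\<^bsub>E\<^esub> f [^]\<^bsub>E\<^esub> i" using y unfolding H by blast
    have "x \<oplus>\<^bsub>?N\<^esub> y = (b \<oplus>\<^bsub>E\<^esub> b') \<otimes>\<^bsub>E\<^esub> f [^]\<^bsub>E\<^esub> i"
      using b b' mE by (simp add: regular_module_def End.l_distr)
    moreover have "b \<oplus>\<^bsub>E\<^esub> b' \<in> adj m" using b b' subcringE(7)[OF adj_subcring] by simp
    ultimately show "x \<oplus>\<^bsub>?N\<^esub> y \<in> ?H i" unfolding H by blast
  qed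
  have ex1: "\<exists>!h. h \<in> Pi\<^sub>E {..<m} ?H \<and> v = (\<Oplus>\<^bsub>?N\<^esub>i\<in>{..<m}. h i)" if v: "v \<in> adj 1" for v
  proof -
    have smult: "b \<odot>\<^bsub>?N\<^esub> x = b \<otimes>\<^bsub>E\<^esub> x" for b x by (simp add: regular_module_def)
    note ex1 = regular_expansion_ex1[OF n v, unfolded smult]
    show ?thesis
    proof (rule ex_ex1I)
      obtain b where b: "b \<in> {..<m} \<rightarrow>\<^sub>E adj m" "v = (\<Oplus>\<^bsub>?N\<^esub>i\<in>{..<m}. b i \<otimes>\<^bsub>E\<^esub> f [^]\<^bsub>E\<^esub> i)"
        using ex1_implies_ex[OF ex1] by blast
      let ?h = "\<lambda>i\<in>{..<m}. b i \<otimes>\<^bsub>E\<^esub> f [^]\<^bsub>E\<^esub> i"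
      have "?h \<in> Pi\<^sub>E {..<m} ?H" unfolding restrict_PiE_iff H using b(1) by (auto simp: PiE_iff)
      moreover have "v = (\<Oplus>\<^bsub>?N\<^esub>i\<in>{..<m}. ?h i)" unfolding b(2)
      proof (rule N.M.finsum_cong')
        show "?h \<in> {..<m} \<rightarrow> carrier ?N"
          using b(1) mult_pow_in_adj_1[of _ m] by (auto simp: PiE_iff regular_module_def)
      qed simp_all
      ultimately show "\<exists>h. h \<in> Pi\<^sub>E {..<m} ?H \<and> v = (\<Oplus>\<^bsub>?N\<^esub>i\<in>{..<m}. h i)" by blast
    next
      have coeffs: "\<exists>b. b \<in> {..<m} \<rightarrow>\<^sub>E adj m \<and> v = (\<Oplus>\<^bsub>?N\<^esub>i\<in>{..<m}. b i \<otimes>\<^bsub>E\<^esub> f [^]\<^bsub>E\<^esub> i) \<and>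
          (\<forall>i<m. h i = b i \<otimes>\<^bsub>E\<^esub> f [^]\<^bsub>E\<^esub> i)"
        if h: "h \<in> Pi\<^sub>E {..<m} ?H" "v = (\<Oplus>\<^bsub>?N\<^esub>i\<in>{..<m}. h i)" for h
      proof -
        have "\<exists>b. b \<in> adj m \<and> h i = b \<otimes>\<^bsub>E\<^esub> f [^]\<^bsub>E\<^esub> i" if "i < m" for i
          using PiE_mem[OF h(1), of i] that unfolding H by auto
        then obtain b where b: "\<And>i. i < m \<Longrightarrow> b i \<in> adj m" "\<And>i. i < m \<Longrightarrow> h i = b i \<otimes>\<^bsub>E\<^esub> f [^]\<^bsub>E\<^esub> i"
          by metis
        have "v = (\<Oplus>\<^bsub>?N\<^esub>i\<in>{..<m}. restrict b {..<m} i \<otimes>\<^bsub>E\<^esub> f [^]\<^bsub>E\<^esub> i)" unfolding h(2)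
        proof (rule N.M.finsum_cong')
          show "(\<lambda>i. restrict b {..<m} i \<otimes>\<^bsub>E\<^esub> f [^]\<^bsub>E\<^esub> i) \<in> {..<m} \<rightarrow> carrier ?N"
            using b(1) mult_pow_in_adj_1[of _ m] by (auto simp: regular_module_def)
        qed (simp_all add: b(2))
        moreover have "restrict b {..<m} \<in> {..<m} \<rightarrow>\<^sub>E adj m" unfolding restrict_PiE_iff using b(1) by simp
        ultimately show ?thesis using b(2) by (intro exI[of _ "restrict b {..<m}"]) simp
      qed
      fix h h'
      assume "h \<in> Pi\<^sub>E {..<m} ?H \<and> v = (\<Oplus>\<^bsub>?N\<^esub>i\<in>{..<m}. h i)" "h' \<in> Pi\<^sub>E {..<m} ?H \<and> v = (\<Oplus>\<^bsub>?N\<^esub>i\<in>{..<m}. h' i)"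
      then have hh: "h \<in> Pi\<^sub>E {..<m} ?H" "v = (\<Oplus>\<^bsub>?N\<^esub>i\<in>{..<m}. h i)" "h' \<in> Pi\<^sub>E {..<m} ?H" "v = (\<Oplus>\<^bsub>?N\<^esub>i\<in>{..<m}. h' i)"
        by blast+
      obtain b where b: "b \<in> {..<m} \<rightarrow>\<^sub>E adj m \<and> v = (\<Oplus>\<^bsub>?N\<^esub>i\<in>{..<m}. b i \<otimes>\<^bsub>E\<^esub> f [^]\<^bsub>E\<^esub> i)"
        "\<forall>i<m. h i = b i \<otimes>\<^bsub>E\<^esub> f [^]\<^bsub>E\<^esub> i" using coeffs[OF hh(1,2)] by blast
      obtain b' where b': "b' \<in> {..<m} \<rightarrow>\<^sub>E adj m \<and> v = (\<Oplus>\<^bsub>?N\<^esub>i\<in>{..<m}. b' i \<otimes>\<^bsub>E\<^esub> f [^]\<^bsub>E\<^esub> i)"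
        "\<forall>i<m. h' i = b' i \<otimes>\<^bsub>E\<^esub> f [^]\<^bsub>E\<^esub> i" using coeffs[OF hh(3,4)] by blast
      have "b = b'" using ex1_unique[OF ex1, of b b'] b(1) b'(1) by blast
      then show "h = h'"
        using b(2) b'(2) by (intro PiE_ext[OF hh(1,3)]) simp
    qed
  qed
  have "carrier ?N = adj 1" by (simp add: regular_module_def)
  then show ?thesis unfolding is_internal_direct_sum_def
    using sub ex1 by (intro conjI module_regular_adj ballI) simp_all
qed

lemma cyclic_vector:
  obtains v where "v \<in> carrier M" "\<And>x. x \<in> adj 1 \<Longrightarrow> x v = \<zero>\<^bsub>M\<^esub> \<Longrightarrow> x = \<zero>\<^bsub>E\<^esub>"
proof -
  let ?V = "evaluation_module M"
  interpret G: binomial_generator R "ring_adj 1" scal "f [^]\<^bsub>E\<^esub> (1::nat)" n c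
    by (rule binomial_generator_power) simp
  interpret V: module "ring_adj 1" ?V by (rule module_evaluation[OF adj_subcring])
  have V: "carrier ?V = carrier M" "\<zero>\<^bsub>?V\<^esub> = \<zero>\<^bsub>M\<^esub>" "x \<odot>\<^bsub>?V\<^esub> v = x v" for x v
    by (simp_all add: evaluation_module_def)
  have faithful: "x = \<zero>\<^bsub>ring_adj 1\<^esub>" if x: "x \<in> carrier (ring_adj 1)"
    and "\<And>v. v \<in> carrier ?V \<Longrightarrow> x \<odot>\<^bsub>?V\<^esub> v = \<zero>\<^bsub>?V\<^esub>" for x
  proof -
    have "x \<in> carrier E" using x adj_subset by auto
    then have "x = \<zero>\<^bsub>E\<^esub>" using that(2) by (intro End_eqI) (simp_all add: V)
    then show ?thesis by simp
  qed
  obtain v where "v \<in> carrier ?V"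
    "\<And>x. x \<in> carrier (ring_adj 1) \<Longrightarrow> x \<odot>\<^bsub>?V\<^esub> v = \<zero>\<^bsub>?V\<^esub> \<Longrightarrow> x = \<zero>\<^bsub>ring_adj 1\<^esub>"
    using V.faithful_imp_cyclic_vector[OF G.finite_carrier[OF finR] G.ideal_principal[OF R_field] faithful]
    by blast
  then show ?thesis using that by (simp add: V)
qed

text \<open>Evaluation at a vector with zero annihilator is injective, and \<open>M\<close> has no more elements than \<open>K[f]\<close>.\<close>

lemma evaluation_bij:
  obtains v where "v \<in> carrier M" "bij_betw (\<lambda>x. x v) (adj 1) (carrier M)"
proof -
  obtain v where v: "v \<in> carrier M" and ann: "\<And>x. x \<in> adj 1 \<Longrightarrow> x v = \<zero>\<^bsub>M\<^esub> \<Longrightarrow> x = \<zero>\<^bsub>E\<^esub>"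
    using cyclic_vector by blast
  have E: "x \<in> carrier E" if "x \<in> adj 1" for x using that adj_subset by blast
  have inj: "inj_on (\<lambda>x. x v) (adj 1)"
  proof (rule inj_onI)
    fix x y assume xy: "x \<in> adj 1" "y \<in> adj 1" "x v = y v"
    let ?d = "x \<oplus>\<^bsub>E\<^esub> \<ominus>\<^bsub>E\<^esub> y"
    have d: "?d \<in> adj 1" using xy subcringE(5,7)[OF adj_subcring[of 1]] by blast
    have y': "\<ominus>\<^bsub>E\<^esub> y \<in> carrier E" using E xy by simp
    have yv: "y v \<in> carrier M" "(\<ominus>\<^bsub>E\<^esub> y) v \<in> carrier M"
      using End_memD(2)[OF E[OF xy(2)] v] End_memD(2)[OF y' v] .
    have "?d v = (y \<oplus>\<^bsub>E\<^esub> \<ominus>\<^bsub>E\<^esub> y) v" using v xy(3) by simp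
    also have "y \<oplus>\<^bsub>E\<^esub> \<ominus>\<^bsub>E\<^esub> y = \<zero>\<^bsub>E\<^esub>" using E[OF xy(2)] by (rule End.r_neg)
    finally have "?d = \<zero>\<^bsub>E\<^esub>" using ann[OF d] v by simp
    then show "x = y" using E xy(1,2) by (metis End.minus_equality End.minus_minus End.a_inv_closed)
  qed
  have sub: "(\<lambda>x. x v) ` adj 1 \<subseteq> carrier M" using End_memD(2)[OF E v] by blast
  have "card (carrier M) \<le> card ((\<lambda>x. x v) ` adj 1)"
    using card_le card_adj_1(1) by (simp only: card_image[OF inj])
  then have "(\<lambda>x. x v) ` adj 1 = carrier M" by (rule card_seteq[OF finM sub])
  then show ?thesis using v inj by (intro that[of v]) (simp_all add: bij_betw_def)
qed

text \<open>The isomorphism is linear over every \<open>K[f\<^sup>m]\<close>, since all of \<open>K[f]\<close> acts by composition.\<close>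

theorem evaluation_iso:
  obtains g where "is_module_iso (ring_adj m) reg (evaluation_module M) g"
proof -
  obtain v where v: "v \<in> carrier M" and bij: "bij_betw (\<lambda>x. x v) (adj 1) (carrier M)"
    using evaluation_bij by blast
  have "is_module_iso (ring_adj m) reg (evaluation_module M) (\<lambda>x. x v)"
    unfolding is_module_iso_def
    using module_regular_adj module_evaluation[OF adj_subcring] bij v
    by (simp add: regular_module_def evaluation_module_def)
  then show ?thesis by (rule that)
qed

theorem evaluation_free:
  assumes n: "n = m * s"
  shows "is_free_module (ring_adj m) (evaluation_module M) m"
proof -
  obtain g where "is_module_iso (ring_adj m) reg (evaluation_module M) g"
    by (rule evaluation_iso)
  then show ?thesis by (rule free_module_transport[OF _ regular_free[OF n]])
qed

end

section \<open>Residue rings\<close>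

abbreviation polyring where "polyring \<equiv> (ring_of_type_algebra :: 'f::field poly ring)"

lemma polyring_simps:
  "carrier polyring = UNIV" "monoid.mult polyring = (*)" "add polyring = (+)" "\<one>\<^bsub>polyring\<^esub> = 1" "\<zero>\<^bsub>polyring\<^esub> = 0"
  by (simp_all add: ring_of_type_algebra_def fun_eq_iff)

lemma ideal_polyring: "ideal (PIdl\<^bsub>polyring\<^esub> p) polyring"
  by (rule cring.cgenideal_ideal[OF cring_from_type_algebra]) (simp add: polyring_simps)

lemma residue_class_mem_iff: "b \<in> residue_class_at p a \<longleftrightarrow> p dvd b - a"
proof -
  have "b \<in> residue_class_at p a \<longleftrightarrow> (\<exists>x. b = x * p + a)"
    by (auto simp: residue_class_at_def a_r_coset_def' cgenideal_def polyring_simps)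
  also have "\<dots> \<longleftrightarrow> p dvd b - a" by (auto simp: dvd_def mult.commute diff_eq_eq)
  finally show ?thesis .
qed

lemma residue_class_eq_iff: "residue_class_at p a = residue_class_at p b \<longleftrightarrow> p dvd a - b"
proof
  assume "residue_class_at p a = residue_class_at p b"
  then show "p dvd a - b" using residue_class_mem_iff[of a p a] residue_class_mem_iff[of a p b] by simp
next
  assume ab: "p dvd a - b"
  have "p dvd x - a \<longleftrightarrow> p dvd x - b" for x
    using dvd_add_left_iff[OF ab, of "x - a"] by simp
  then show "residue_class_at p a = residue_class_at p b" by (simp add: set_eq_iff residue_class_mem_iff)
qed

lemma residue_class_hom: "residue_class_at p \<in> ring_hom polyring (residue_ring_at p)"
  unfolding residue_ring_at_def residue_class_at_def[abs_def]
  by (rule ideal.rcos_ring_hom[OF ideal_polyring])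

lemma residue_ring_carrier: "carrier (residue_ring_at p) = range (residue_class_at p)"
  unfolding residue_ring_at_def residue_class_at_def FactRing_def A_RCOSETS_def'
  by (auto simp: polyring_simps)

lemma residue_ring_cring: "cring (residue_ring_at p)"
  unfolding residue_ring_at_def
  by (rule ideal.quotient_is_cring[OF ideal_polyring cring_from_type_algebra])

lemma residue_ring_ops:
  "residue_class_at p a \<otimes>\<^bsub>residue_ring_at p\<^esub> residue_class_at p b = residue_class_at p (a * b)"
  "residue_class_at p a \<oplus>\<^bsub>residue_ring_at p\<^esub> residue_class_at p b = residue_class_at p (a + b)"
  "\<one>\<^bsub>residue_ring_at p\<^esub> = residue_class_at p 1"
  using ring_hom_mult[OF residue_class_hom, of a b p] ring_hom_add[OF residue_class_hom, of a b p]
    ring_hom_one[OF residue_class_hom, of p] by (simp_all add: polyring_simps)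

lemma residue_ring_zero: "\<zero>\<^bsub>residue_ring_at p\<^esub> = residue_class_at p 0"
  using ring_hom_zero[OF residue_class_hom ring_from_type_algebra cring.axioms(1)[OF residue_ring_cring], of p]
  by (simp add: polyring_simps)

lemma residue_class_unit:
  assumes "Factorial_Ring.irreducible p" "\<not> p dvd a"
  obtains b where "residue_class_at p a \<otimes>\<^bsub>residue_ring_at p\<^esub> residue_class_at p b = \<one>\<^bsub>residue_ring_at p\<^esub>"
proof -
  obtain u w where "u * p + w * a = 1" using irreducible_bezout[OF assms] by blast
  then have "a * w - 1 = - (u * p)" by (simp add: algebra_simps eq_neg_iff_add_eq_0)
  then have "p dvd a * w - 1" by simp
  then show ?thesis using that[of w] by (simp add: residue_ring_ops residue_class_eq_iff)
qed

lemma residue_class_Units: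
  assumes "Factorial_Ring.irreducible p" "\<not> p dvd a"
  shows "residue_class_at p a \<in> Units (residue_ring_at p)"
proof -
  interpret cring "residue_ring_at p" by (rule residue_ring_cring)
  obtain b where b: "residue_class_at p a \<otimes>\<^bsub>residue_ring_at p\<^esub> residue_class_at p b = \<one>\<^bsub>residue_ring_at p\<^esub>"
    using residue_class_unit[OF assms] .
  have car: "residue_class_at p x \<in> carrier (residue_ring_at p)" for x by (simp add: residue_ring_carrier)
  show ?thesis unfolding Units_def using b m_comm[OF car car, of a b] car by auto
qed

text \<open>Units come from Bezout coefficients of \<open>p\<close> and a representative.\<close>

lemma residue_ring_field:
  assumes p: "Factorial_Ring.irreducible p"
  shows "field (residue_ring_at p)"
proof (rule cring.cring_fieldI2[OF residue_ring_cring])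
  have "\<not> p dvd 1" using p by (auto simp: Factorial_Ring.irreducible_def)
  then show "\<zero>\<^bsub>residue_ring_at p\<^esub> \<noteq> \<one>\<^bsub>residue_ring_at p\<^esub>"
    by (simp add: residue_ring_zero residue_ring_ops residue_class_eq_iff)
next
  fix k assume k: "k \<in> carrier (residue_ring_at p)" "k \<noteq> \<zero>\<^bsub>residue_ring_at p\<^esub>"
  from k(1) obtain a where ka: "k = residue_class_at p a" unfolding residue_ring_carrier by blast
  have "\<not> p dvd a" using k(2) by (simp add: ka residue_ring_zero residue_class_eq_iff)
  note a = ka this
  then show "\<exists>b\<in>carrier (residue_ring_at p). k \<otimes>\<^bsub>residue_ring_at p\<^esub> b = \<one>\<^bsub>residue_ring_at p\<^esub>"
    using residue_class_unit[OF p a(2)] by (metis rangeI residue_ring_carrier)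
qed

lemma residue_ring_card:
  fixes p :: "'f::{field,finite} poly"
  assumes p: "degree p > 0"
  shows "finite (carrier (residue_ring_at p))"
    and "card (carrier (residue_ring_at p)) = CARD('f) ^ degree p"
proof -
  let ?A = "{a :: 'f poly. a = 0 \<or> degree a < degree p}"
  have "p \<noteq> 0" using p by auto
  have "inj_on (residue_class_at p) ?A"
  proof (rule inj_onI)
    fix a b assume ab: "a \<in> ?A" "b \<in> ?A" "residue_class_at p a = residue_class_at p b"
    then have "p dvd a - b" by (simp add: residue_class_eq_iff)
    moreover have "a - b \<noteq> 0 \<Longrightarrow> degree (a - b) < degree p"
      using ab p by (auto intro: degree_diff_less)
    ultimately show "a = b" using dvd_imp_degree_le[of p "a - b"] by (cases "a = b") auto
  qed
  moreover have "residue_class_at p ` ?A = carrier (residue_ring_at p)"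
  proof
    show "carrier (residue_ring_at p) \<subseteq> residue_class_at p ` ?A"
    proof
      fix k assume "k \<in> carrier (residue_ring_at p)"
      then obtain a where a: "k = residue_class_at p a" by (auto simp: residue_ring_carrier)
      have "k = residue_class_at p (a mod p)"
        unfolding a by (simp add: residue_class_eq_iff minus_mod_eq_mult_div)
      moreover have "a mod p \<in> ?A" using degree_mod_less[OF \<open>p \<noteq> 0\<close>, of a] by simp
      ultimately show "k \<in> residue_class_at p ` ?A" by (rule image_eqI)
    qed
  qed (simp add: residue_ring_carrier image_subset_iff)
  ultimately have bij: "bij_betw (residue_class_at p) ?A (carrier (residue_ring_at p))"
    by (rule bij_betw_imageI)
  show "finite (carrier (residue_ring_at p))"
    using bij_betw_finite[OF bij] card_small_polys(1)[where 'f='f] by simp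
  show "card (carrier (residue_ring_at p)) = CARD('f) ^ degree p"
    using bij_betw_same_card[OF bij] card_small_polys(2)[where 'f='f] by simp
qed

section \<open>The torsion module\<close>

locale drinfeld_torsion = drinfeld_frobenius p0 r n t \<phi>
  for p0 :: "'f::{field,finite} poly" and r n t \<phi> +
  fixes p :: "'f poly"
  assumes irr: "Factorial_Ring.irreducible p" and not_dvd: "\<not> p0 dvd p" and not_dvd': "\<not> p dvd p0"
begin

abbreviation "\<kappa> \<equiv> residue_ring_at p"
abbreviation "T \<equiv> torsion_module \<phi> p"

lemma torsion_simps:
  "v \<in> carrier T \<longleftrightarrow> twisted_act (\<phi> p) v = 0" "\<zero>\<^bsub>T\<^esub> = 0" "v \<oplus>\<^bsub>T\<^esub> w = v + w"
  by (simp_all add: torsion_module_def)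

text \<open>On the torsion, multiples of \<open>p\<close> act as zero, so the chosen representative does not matter.\<close>

lemma torsion_smult:
  assumes "v \<in> carrier T"
  shows "residue_class_at p a \<odot>\<^bsub>T\<^esub> v = twisted_act (\<phi> a) v"
proof -
  define b where "b = (SOME b. b \<in> residue_class_at p a)"
  have "b \<in> residue_class_at p a" unfolding b_def
    by (rule someI[of _ a]) (simp add: residue_class_mem_iff)
  then have "p dvd b - a" by (simp add: residue_class_mem_iff)
  then obtain k where "b - a = p * k" by (elim dvdE)
  then have "b = a + k * p" by (simp add: algebra_simps)
  then have "twisted_act (\<phi> b) v = twisted_act (\<phi> a) v"
    using assms by (simp add: phi_add twisted_act_add act_phi_mult torsion_simps)
  then show ?thesis by (simp add: torsion_module_def b_def)
qed

lemma torsion_act_closed: "v \<in> carrier T \<Longrightarrow> twisted_act (\<phi> a) v \<in> carrier T"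
  by (simp add: torsion_simps act_phi_commute[of p a])

lemma torsion_is_module: "module \<kappa> T"
proof (rule moduleI[OF residue_ring_cring])
  show "abelian_group T"
  proof (rule abelian_groupI)
    fix v assume "v \<in> carrier T"
    then show "\<exists>w\<in>carrier T. w \<oplus>\<^bsub>T\<^esub> v = \<zero>\<^bsub>T\<^esub>"
      by (intro bexI[of _ "- v"]) (simp_all add: torsion_simps twisted_act_arg_minus)
  qed (simp_all add: torsion_simps twisted_act_arg_add)
next
  fix k l v w assume "k \<in> carrier \<kappa>" "l \<in> carrier \<kappa>" and v: "v \<in> carrier T" and w: "w \<in> carrier T"
  then obtain a b where kl: "k = residue_class_at p a" "l = residue_class_at p b"
    unfolding residue_ring_carrier by blast
  have vw: "v \<oplus>\<^bsub>T\<^esub> w \<in> carrier T" using v w by (simp add: torsion_simps twisted_act_arg_add)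
  show "k \<odot>\<^bsub>T\<^esub> v \<in> carrier T"
    unfolding kl torsion_smult[OF v] by (rule torsion_act_closed[OF v])
  show "(k \<oplus>\<^bsub>\<kappa>\<^esub> l) \<odot>\<^bsub>T\<^esub> v = k \<odot>\<^bsub>T\<^esub> v \<oplus>\<^bsub>T\<^esub> l \<odot>\<^bsub>T\<^esub> v"
    unfolding kl residue_ring_ops torsion_smult[OF v] by (simp add: torsion_simps(3) phi_add twisted_act_add)
  show "k \<odot>\<^bsub>T\<^esub> (v \<oplus>\<^bsub>T\<^esub> w) = k \<odot>\<^bsub>T\<^esub> v \<oplus>\<^bsub>T\<^esub> k \<odot>\<^bsub>T\<^esub> w"
    unfolding kl torsion_smult[OF v] torsion_smult[OF w] torsion_smult[OF vw]
    by (simp add: torsion_simps(3) twisted_act_arg_add)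
  show "(k \<otimes>\<^bsub>\<kappa>\<^esub> l) \<odot>\<^bsub>T\<^esub> v = k \<odot>\<^bsub>T\<^esub> (l \<odot>\<^bsub>T\<^esub> v)"
    unfolding kl residue_ring_ops torsion_smult[OF v] torsion_smult[OF torsion_act_closed[OF v]]
    by (rule act_phi_mult)
next
  fix v assume v: "v \<in> carrier T"
  show "\<one>\<^bsub>\<kappa>\<^esub> \<odot>\<^bsub>T\<^esub> v = v"
    unfolding residue_ring_ops torsion_smult[OF v] by (simp add: phi_const one_pCons twisted_act_const)
qed

sublocale T: module \<kappa> T by (rule torsion_is_module)

definition \<pi> where "\<pi> = (\<lambda>v\<in>carrier T. v ^ (CARD('f) ^ r))"

lemma torsion_frob_closed: "v \<in> carrier T \<Longrightarrow> v ^ (CARD('f) ^ (r * k)) \<in> carrier T"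
  by (simp add: torsion_simps act_phi_frob zero_power)

lemma \<pi>_closed: "\<pi> \<in> carrier (T.E)"
proof (rule T.End_memI)
  show "\<pi> \<in> extensional (carrier T)" by (simp add: \<pi>_def)
  fix v assume v: "v \<in> carrier T"
  show "\<pi> v \<in> carrier T" using v torsion_frob_closed[OF v, of 1] by (simp add: \<pi>_def)
  fix w assume w: "w \<in> carrier T"
  have "v \<oplus>\<^bsub>T\<^esub> w \<in> carrier T" using v w by simp
  then show "\<pi> (v \<oplus>\<^bsub>T\<^esub> w) = \<pi> v \<oplus>\<^bsub>T\<^esub> \<pi> w"
    using v w by (simp add: \<pi>_def torsion_simps(3) frob_add)
next
  fix k v assume k: "k \<in> carrier \<kappa>" and v: "v \<in> carrier T"
  then obtain a where a: "k = residue_class_at p a" by (auto simp: residue_ring_carrier)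
  have \<pi>v: "v ^ (CARD('f) ^ r) \<in> carrier T" using torsion_frob_closed[OF v, of 1] by simp
  show "\<pi> (k \<odot>\<^bsub>T\<^esub> v) = k \<odot>\<^bsub>T\<^esub> \<pi> v"
    unfolding a using v \<pi>v act_phi_frob[of a v 1] torsion_act_closed[OF v, of a]
    by (simp add: \<pi>_def torsion_smult)
qed

lemma \<pi>_power:
  assumes v: "v \<in> carrier T"
  shows "(\<pi> [^]\<^bsub>T.E\<^esub> (i::nat)) v = v ^ (CARD('f) ^ (r * i))"
proof (induction i)
  case 0
  then show ?case using v by simp
next
  case (Suc i)
  have "(\<pi> [^]\<^bsub>T.E\<^esub> Suc i) v = (\<pi> [^]\<^bsub>T.E\<^esub> i \<otimes>\<^bsub>T.E\<^esub> \<pi>) v"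
    by simp
  also have "\<dots> = (\<pi> \<otimes>\<^bsub>T.E\<^esub> \<pi> [^]\<^bsub>T.E\<^esub> i) v"
    using \<pi>_closed by (simp add: T.End.nat_pow_Suc2[symmetric])
  also have "\<dots> = \<pi> (v ^ (CARD('f) ^ (r * i)))" using v by (simp add: Suc)
  also have "\<dots> = (v ^ (CARD('f) ^ (r * i))) ^ (CARD('f) ^ r)"
    using torsion_frob_closed[OF v] by (simp add: \<pi>_def)
  finally show ?case by (simp add: frob_frob add.commute)
qed

lemma \<pi>_root: "\<pi> [^]\<^bsub>T.E\<^esub> n = T.scal (residue_class_at p p0)"
proof (rule T.End_eqI)
  show "T.scal (residue_class_at p p0) \<in> carrier (T.E)"
    by (rule T.scal_closed) (simp add: residue_ring_carrier)
qed (use \<pi>_closed in \<open>simp_all add: \<pi>_power torsion_smult act_phi_p0\<close>)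

lemma torsion_finsum: "finite I \<Longrightarrow> x \<in> I \<rightarrow> carrier T \<Longrightarrow> finsum T x I = (\<Sum>i\<in>I. x i)"
proof (induction I rule: finite_induct)
  case (insert j I)
  then show ?case by (simp add: T.M.finsum_insert torsion_simps(3) Pi_iff)
qed (simp add: torsion_simps)

lemma \<pi>_indep:
  assumes a: "a \<in> {..<n} \<rightarrow> carrier \<kappa>"
    and zero: "(\<Oplus>\<^bsub>T.E\<^esub>i\<in>{..<n}. T.scal (a i) \<otimes>\<^bsub>T.E\<^esub> \<pi> [^]\<^bsub>T.E\<^esub> i)
      = \<zero>\<^bsub>T.E\<^esub>"
  shows "\<forall>i<n. a i = \<zero>\<^bsub>\<kappa>\<^esub>"
proof -
  have "\<forall>i\<in>{..<n}. \<exists>x. a i = residue_class_at p x"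
    using a by (auto simp: residue_ring_carrier Pi_iff)
  then obtain x where x: "\<And>i. i < n \<Longrightarrow> a i = residue_class_at p (x i)"
    by (auto dest!: bchoice)
  have terms: "(\<lambda>i. T.scal (a i) \<otimes>\<^bsub>T.E\<^esub> \<pi> [^]\<^bsub>T.E\<^esub> i) \<in> {..<n} \<rightarrow> carrier (T.E)"
    using a \<pi>_closed T.scal_closed by (simp add: Pi_iff)
  have "twisted_act (endo x) v = 0" if v: "v \<in> carrier T" for v
  proof -
    have vals: "(T.scal (a i) \<otimes>\<^bsub>T.E\<^esub> \<pi> [^]\<^bsub>T.E\<^esub> i) v =
        twisted_act (\<phi> (x i)) (v ^ (CARD('f) ^ (r * i)))" if "i < n" for i
      using v torsion_frob_closed[OF v] by (simp add: \<pi>_power x[OF that] torsion_smult)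
    have "0 = (\<Oplus>\<^bsub>T\<^esub>i\<in>{..<n}. (T.scal (a i) \<otimes>\<^bsub>T.E\<^esub> \<pi> [^]\<^bsub>T.E\<^esub> i) v)"
      using T.End_finsum_apply[OF _ terms v] v by (simp add: zero torsion_simps(2))
    also have "\<dots> = (\<Sum>i<n. (T.scal (a i) \<otimes>\<^bsub>T.E\<^esub> \<pi> [^]\<^bsub>T.E\<^esub> i) v)"
      by (rule torsion_finsum) (use terms T.End_memD(2) v in \<open>auto simp: Pi_iff simp del: T.End_apply\<close>)
    also have "\<dots> = twisted_act (endo x) v"
      unfolding act_endo by (rule sum.cong) (simp_all add: vals del: T.End_apply)
    finally show ?thesis by simp
  qed
  then have "p dvd x i" if "i < n" for i
    using endo_kills_torsion_imp_dvd[OF not_dvd _ that] by (simp add: torsion_simps)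
  then show ?thesis by (simp add: x residue_ring_zero residue_class_eq_iff)
qed

sublocale B: binomial_endomorphism \<kappa> T \<pi> n "residue_class_at p p0"
proof (intro binomial_endomorphism.intro binomial_endomorphism_axioms.intro torsion_is_module)
  have deg: "degree p > 0" by (rule degree_irreducible_pos[OF irr])
  show "field \<kappa>" by (rule residue_ring_field[OF irr])
  show "finite (carrier \<kappa>)" by (rule residue_ring_card[OF deg])
  have car: "carrier T = {v. twisted_act (\<phi> p) v = 0}" by (simp add: torsion_module_def)
  show "finite (carrier T)" unfolding car by (rule card_torsion[OF not_dvd])
  show "card (carrier T) \<le> card (carrier \<kappa>) ^ n"
    unfolding car card_torsion(2)[OF not_dvd] residue_ring_card(2)[OF deg]
    by (simp add: power_mult[symmetric] mult.commute)
  show "n > 0" using n_pos by simp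
  show "residue_class_at p p0 \<in> carrier \<kappa>" by (simp add: residue_ring_carrier)
qed (rule \<pi>_closed \<pi>_root \<pi>_indep; assumption?)+

end

lemma monic_irreducible_dvd_imp_eq:
  fixes a b :: "'f::field poly"
  assumes "lead_coeff a = 1" "lead_coeff b = 1"
    "Factorial_Ring.irreducible a" "Factorial_Ring.irreducible b" "a dvd b"
  shows "a = b"
proof -
  obtain k where k: "b = a * k" using assms(5) by (elim dvdE)
  then have "is_unit k"
    using Factorial_Ring.irreducibleD[OF assms(4) k] assms(3) by (auto simp: Factorial_Ring.irreducible_def)
  then obtain e where e: "k = [:e:]" by (auto simp: is_unit_poly_iff)
  have "lead_coeff b = lead_coeff a * e" unfolding k e by (simp add: lead_coeff_mult)
  then have "e = 1" using assms by simp
  then show ?thesis using k e by simp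
qed

theorem proposition2p5:
  fixes p0 p :: "'f::{field,finite} poly"
    and n r m s :: nat
    and t :: "'f alg_closure"
    and \<phi> :: "'f poly \<Rightarrow> 'f alg_closure poly"
  assumes "n \<ge> 1"
    and "Polynomial.lead_coeff p0 = 1" and "Factorial_Ring.irreducible p0" and "Polynomial.degree p0 = r" and "gcd n r = 1"
    and "t \<in> frob_fixed r" and "poly (map_poly to_ac p0) t = 0"
    and "is_drinfeld_module r n t \<phi>"
    and "Polynomial.lead_coeff p = 1" and "Factorial_Ring.irreducible p" and "p \<noteq> p0"
    and "m dvd n" and "s = n div m"
    and "\<kappa> = residue_ring_at p"
    and "c = residue_class_at p p0"
    and "M = torsion_module \<phi> p"
    and "E = module_End \<kappa> M"
    and "\<pi> = (\<lambda>v\<in>carrier M. v ^ (CARD('f) ^ r))"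
    and "u = \<pi> [^]\<^bsub>E\<^esub> m"
    and "S = E\<lparr>carrier := adjoin_End \<kappa> M \<pi>\<rparr>"
    and "R\<^sub>0 = E\<lparr>carrier := adjoin_End \<kappa> M u\<rparr>"
  shows "c \<in> Units \<kappa> \<and> subring (carrier S) E \<and> subring (carrier R\<^sub>0) E \<and>
    is_free_module R\<^sub>0 (evaluation_module M) m \<and>
    (\<exists>\<psi>. is_binomial_algebra_iso \<kappa> n c S (scalar_End M) \<pi> \<psi>) \<and>
    is_free_module S (evaluation_module M) 1 \<and>
    is_internal_direct_sum R\<^sub>0 (regular_module S) {..<m} (\<lambda>i. (\<pi> [^]\<^bsub>E\<^esub> i) <#\<^bsub>E\<^esub> carrier R\<^sub>0) \<and>
    is_free_module R\<^sub>0 (regular_module S) m \<and>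
    (\<exists>\<psi>. is_binomial_algebra_iso \<kappa> s c R\<^sub>0 (scalar_End M) u \<psi>) \<and>
    (\<exists>f. is_module_iso R\<^sub>0 (evaluation_module M) (regular_module S) f) \<and>
    (\<exists>f. is_module_iso R\<^sub>0 (regular_module S) (power_module R\<^sub>0 m) f)"
proof -
  have not_dvd: "\<not> p0 dvd p" "\<not> p dvd p0"
    using monic_irreducible_dvd_imp_eq[of p0 p] monic_irreducible_dvd_imp_eq[of p p0] assms(2,3,9,10,11)
    by auto
  interpret D: drinfeld_torsion p0 r n t \<phi> p
    by unfold_locales
       (use assms(1-8,10) not_dvd in \<open>simp_all add: frob_fixed_def coprime_iff_gcd_eq_1\<close>)
  have n: "n = m * s" using assms(12,13) by simp
  have \<pi>: "\<pi> = D.\<pi>" unfolding D.\<pi>_def assms(16,18) by (rule refl)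
  have E: "E = module_End (residue_ring_at p) (torsion_module \<phi> p)" using assms(14,16,17) by simp
  have pow1: "D.\<pi> [^]\<^bsub>E\<^esub> (1::nat) = D.\<pi>" unfolding E using D.\<pi>_closed by simp
  have R0: "R\<^sub>0 = D.B.ring_adj m"
    unfolding assms(21) assms(19) D.B.adj_def \<pi> E assms(14,16) by (rule refl)
  have S: "S = D.B.ring_adj 1"
    unfolding assms(20) D.B.adj_def \<pi> assms(14,16) E pow1[unfolded E] by (rule refl)
  interpret G1: binomial_generator \<kappa> S "scalar_End M" \<pi> n c
    using D.B.binomial_generator_power[of 1 n] pow1
    unfolding S \<pi> assms(14,15,16) E by simp
  interpret Gm: binomial_generator \<kappa> R\<^sub>0 "scalar_End M" u s c
    using D.B.binomial_generator_power[OF n]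
    unfolding R0 \<pi> assms(14,15,16,19) E .
  obtain g where g: "is_module_iso R\<^sub>0 (regular_module S) (evaluation_module M) g"
    using D.B.evaluation_iso[of m] unfolding R0 S assms(16) by blast
  have free: "is_free_module R\<^sub>0 (regular_module S) m"
    using D.B.regular_free[OF n] unfolding R0 S .
  obtain h where h: "is_module_iso R\<^sub>0 (regular_module S) (power_module R\<^sub>0 m) h"
    using free_module_imp_power_module_iso[OF free] by blast
  show ?thesis
  proof (intro conjI)
    show "c \<in> Units \<kappa>" unfolding assms(14,15) by (rule residue_class_Units[OF assms(10) not_dvd(2)])
    show "subring (carrier S) E" "subring (carrier R\<^sub>0) E"
      unfolding S R0 E using D.B.adj_subring[of 1] D.B.adj_subring[of m] by simp_all
    show "is_free_module R\<^sub>0 (evaluation_module M) m"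
      using D.B.evaluation_free[OF n] unfolding R0 assms(16) .
    show "\<exists>\<psi>. is_binomial_algebra_iso \<kappa> n c S (scalar_End M) \<pi> \<psi>"
      by (rule G1.binomial_algebra_iso)
    show "is_free_module S (evaluation_module M) 1"
      using D.B.evaluation_free[of 1 n] unfolding S assms(16) by simp
    show "is_internal_direct_sum R\<^sub>0 (regular_module S) {..<m} (\<lambda>i. (\<pi> [^]\<^bsub>E\<^esub> i) <#\<^bsub>E\<^esub> carrier R\<^sub>0)"
      using D.B.regular_direct_sum[OF n] unfolding R0 S \<pi> E .
    show "is_free_module R\<^sub>0 (regular_module S) m" by (rule free)
    show "\<exists>\<psi>. is_binomial_algebra_iso \<kappa> s c R\<^sub>0 (scalar_End M) u \<psi>"
      by (rule Gm.binomial_algebra_iso)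
    show "\<exists>f. is_module_iso R\<^sub>0 (evaluation_module M) (regular_module S) f"
      using module_iso_sym[OF g] by blast
    show "\<exists>f. is_module_iso R\<^sub>0 (regular_module S) (power_module R\<^sub>0 m) f"
      using h by blast
  qed
qed

end
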